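(* Let $\Phi$ be a locally square-integrable invariant random measure on $\mathbb R^d$, and let $K,L$ be invariant probability kernels from $\Omega\times\mathbb R^d$ to $\mathbb R^d$ such that $K\Phi$ or $L\Phi$ is locally square-integrable. Let $$\kappa(y):=\big\|\mathbb E^\Phi_{0,y}[K_y\otimes K_0-L_y\otimes L_0]\big\|,\quad y\in\mathbb R^d,$$ and assume that $\int\kappa(y)\,\alpha_\Phi(\mathrm dy)<\infty$. Let $\eta:=\alpha_{K\Phi}-\alpha_{L\Phi}$. Then $$\hat\beta_{K\Phi}=\hat\beta_{L\Phi}+\hat\eta\cdot\lambda_d .$$ Further, $$\hat\eta(k)=\int\mathbb E^\Phi_{0,y}\Big[\hat K_y(k)\overline{\hat K_0(k)}-\hat L_y(k)\overline{\hat L_0(k)}\Big]\,\alpha_\Phi(\mathrm dy),\quad k\in\mathbb R^d,$$ and $\hat\eta$ is continuous with $\hat\eta(0)=0$.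
   Context: $\lambda_d$ is Lebesgue measure and $\mathcal B^d$ the Borel $\sigma$-field on $\mathbb R^d$. $(\Omega,\mathcal A,\mathbb P)$ is a probability space, $(\Omega,\mathcal A)$ is a Borel space, and there is a measurable flow on $\Omega$: maps $\theta_x\colon\Omega\to\Omega$, $x\in\mathbb R^d$, with $(\omega,x)\mapsto\theta_x\omega$ measurable, $\theta_0=\mathrm{id}$, $\theta_x\circ\theta_y=\theta_{x+y}$, and $\mathbb P(\theta_xA)=\mathbb P(A)$ for all $x\in\mathbb R^d$, $A\in\mathcal A$. A random measure $\Phi$ on $\mathbb R^d$ is a random locally finite measure. It is invariant if $\Phi(\omega,B+x)=\Phi(\theta_x\omega,B)$ for all $\omega,x,B$, and locally square-integrable if $\mathbb E\Phi(B)^2<\infty$ for all bounded $B\in\mathcal B^d$. Its intensity $\gamma:=\mathbb E\Phi([0,1]^d)$ is assumed positive and finite. The reduced second moment measure is $$\alpha_\Phi(B):=\mathbb E\int \mathbf 1\{x\in[0,1]^d,\,y-x\in B\}\,\Phi^2(\mathrm d(x,y)),\quad B\in\mathcal B^d .$$ The two-point Palm probability measures $\mathbb P^\Phi_{0,y}$, $y\in\mathbb R^d$, form a probability kernel from $\mathbb R^d$ to $\Omega$ satisfying $$\mathbb E\int f(x,y-x,\theta_x)\,\Phi^2(\mathrm d(x,y))=\iiint f(x,y,\omega)\,\mathbb P^\Phi_{0,y}(\mathrm d\omega)\,\alpha_\Phi(\mathrm dy)\,\mathrm dx$$ for all measurable $f\ge0$; $\mathbb E^\Phi_{0,y}$ is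 the corresponding expectation. A probability kernel $K$ from $\Omega\times\mathbb R^d$ to $\mathbb R^d$ is invariant if $K(\omega,x,B+x)=K(\theta_x\omega,0,B)$ for all $\omega,x,B$. Write $K_x=K(x)$ for the random probability measure $\omega\mapsto K(\omega,x,\cdot)$ and $K\Phi(\omega,\cdot):=\int K(\omega,x,\cdot)\,\Phi(\omega,\mathrm dx)$ (an invariant random measure with the same intensity as $\Phi$). Expectations of random (signed) measures are taken setwise. For a finite signed measure $\nu$, $\|\nu\|:=\sup|\int f\,\mathrm d\nu|$ over measurable $f$ with values in $[-1,1]$. Under the hypotheses both $K\Phi$ and $L\Phi$ are locally square-integrable and $\eta$ (defined on bounded Borel sets by the difference) extends to a signed measure of finite total variation on $\mathbb R^d$. Fourier conventions: $\hat f(k)=\int f(x)e^{-i\langle k,x\rangle}\mathrm dx$; for a signed measure $\nu$ of finite total variation, $\hat\nu(k)=\int e^{-i\langle k,x\rangle}\nu(\mathrm dx)$; $\hat K_y(k):=\widehat{K_y}(k)$. The covariance measure of a stationary locally square-integrable random measure $\Psi$ with intensity $\gamma_\Psi$ is the signed measure (on bounded Borel sets) $\beta_\Psi:=\alpha_\Psi-\gamma_\Psi^2\lambda_d$; its Bartlett spectral measure $\hat\beta_\Psi$ is the unique locally finite measure on $\mathbb R^d$ with $\int (f\star g)(x)\,\beta_\Psi(\mathrm dx)=(2\pi)^{-d}\int\hat f(k)\overline{\hat g(k)}\,\hat\beta_\Psi(\mathrm dk)$ for all bounded measurable $f,g\colon\mathbb R^d\to\mathbb R$ with bounded support, where $(f\star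 g)(y)=\int f(x)g(x-y)\,\mathrm dx$. For a function $h$ and measure $\nu$, $h\cdot\nu$ is the measure with density $h$ w.r.t. $\nu$. *)

theory Defs
  imports "HOL-Probability.Probability"
begin

text \<open>
  A finite signed measure is a real-valued, countably additive set function on the sets of \<open>M\<close>.
  Such a function automatically has finite total variation, and taking all sets equal to the empty
  set shows that it vanishes there.
\<close>

definition finite_signed_measure :: "'a measure \<Rightarrow> ('a set \<Rightarrow> real) \<Rightarrow> bool" where
  "finite_signed_measure M \<nu> \<longleftrightarrow>
     (\<forall>A :: nat \<Rightarrow> 'a set. range A \<subseteq> sets M \<longrightarrow> disjoint_family A \<longrightarrow>
        (\<lambda>i. \<nu> (A i)) sums \<nu> (\<Union>i. A i))"

text \<open>
  The positive part of the Jordan decomposition. Negative values of \<open>\<nu>\<close> are cut off at \<open>0\<close> by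
  \<open>ennreal\<close>, which does not change the supremum because \<open>B = {}\<close> is allowed.
\<close>

definition jordan_pos :: "'a measure \<Rightarrow> ('a set \<Rightarrow> real) \<Rightarrow> 'a measure" where
  "jordan_pos M \<nu> =
     measure_of (space M) (sets M) (\<lambda>A. SUP B\<in>{B \<in> sets M. B \<subseteq> A}. ennreal (\<nu> B))"

definition jordan_neg :: "'a measure \<Rightarrow> ('a set \<Rightarrow> real) \<Rightarrow> 'a measure" where
  "jordan_neg M \<nu> = jordan_pos M (\<lambda>B. - \<nu> B)"

definition signed_integral ::
    "'a measure \<Rightarrow> ('a set \<Rightarrow> real) \<Rightarrow> ('a \<Rightarrow> 'b) \<Rightarrow> 'b::{banach, second_countable_topology}" where
  "signed_integral M \<nu> f = (LINT x|jordan_pos M \<nu>. f x) - (LINT x|jordan_neg M \<nu>. f x)"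

definition tv_norm :: "'a measure \<Rightarrow> ('a set \<Rightarrow> real) \<Rightarrow> ennreal" where
  "tv_norm M \<nu> =
     (SUP f\<in>{f \<in> borel_measurable M. \<forall>x\<in>space M. f x \<in> {-1..1}}.
        ennreal \<bar>signed_integral M \<nu> f :: real\<bar>)"

text \<open>
  Integration of a measurable function with bounded support against a signed measure that is only
  defined on bounded Borel sets: the signed measure is restricted to the set where the function
  does not vanish.
\<close>

definition local_signed_integral ::
    "('v::euclidean_space set \<Rightarrow> real) \<Rightarrow> ('v \<Rightarrow> real) \<Rightarrow> real" where
  "local_signed_integral \<nu> h = signed_integral borel (\<lambda>B. \<nu> (B \<inter> {x. h x \<noteq> 0})) h"

definition fourier_char :: "'v::euclidean_space \<Rightarrow> 'v \<Rightarrow> complex" where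
  "fourier_char k x = exp (- (\<i> * complex_of_real (k \<bullet> x)))"

definition fourier_fun :: "('v::euclidean_space \<Rightarrow> real) \<Rightarrow> 'v \<Rightarrow> complex" where
  "fourier_fun f k = (LINT x|lborel. complex_of_real (f x) * fourier_char k x)"

definition fourier_measure :: "'v::euclidean_space measure \<Rightarrow> 'v \<Rightarrow> complex" where
  "fourier_measure \<mu> k = (LINT x|\<mu>. fourier_char k x)"

definition fourier_signed :: "('v::euclidean_space set \<Rightarrow> real) \<Rightarrow> 'v \<Rightarrow> complex" where
  "fourier_signed \<nu> k = signed_integral borel \<nu> (fourier_char k)"

definition borel_space :: "'w measure \<Rightarrow> bool" where
  "borel_space M \<longleftrightarrow>
     (\<exists>(S :: real set) f g. S \<in> sets borel \<and> S \<subseteq> {0..1} \<and>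
        f \<in> M \<rightarrow>\<^sub>M restrict_space borel S \<and> g \<in> restrict_space borel S \<rightarrow>\<^sub>M M \<and>
        (\<forall>\<omega>\<in>space M. g (f \<omega>) = \<omega>) \<and> (\<forall>s\<in>S. f (g s) = s))"

locale stationary_setting = prob_space P
  for P :: "'w measure" +
  fixes \<theta> :: "'v::euclidean_space \<Rightarrow> 'w \<Rightarrow> 'w"
  assumes borel_space: "borel_space P"
    and flow_measurable: "(\<lambda>(\<omega>, x). \<theta> x \<omega>) \<in> P \<Otimes>\<^sub>M borel \<rightarrow>\<^sub>M P"
    and flow_zero: "\<And>\<omega>. \<omega> \<in> space P \<Longrightarrow> \<theta> 0 \<omega> = \<omega>"
    and flow_add: "\<And>x y \<omega>. \<omega> \<in> space P \<Longrightarrow> \<theta> x (\<theta> y \<omega>) = \<theta> (x + y) \<omega>"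
    and flow_preserves: "\<And>x A. A \<in> sets P \<Longrightarrow> emeasure P (\<theta> x ` A) = emeasure P A"

definition locally_finite_measure :: "'v::euclidean_space measure \<Rightarrow> bool" where
  "locally_finite_measure \<mu> \<longleftrightarrow>
     sets \<mu> = sets borel \<and> (\<forall>B\<in>sets borel. bounded B \<longrightarrow> emeasure \<mu> B < \<infinity>)"

definition random_measure :: "'w measure \<Rightarrow> ('w \<Rightarrow> 'v::euclidean_space measure) \<Rightarrow> bool" where
  "random_measure P \<Psi> \<longleftrightarrow>
     (\<forall>\<omega>\<in>space P. locally_finite_measure (\<Psi> \<omega>)) \<and>
     (\<forall>B\<in>sets borel. (\<lambda>\<omega>. emeasure (\<Psi> \<omega>) B) \<in> borel_measurable P)"

definition invariant_measure ::
    "'w measure \<Rightarrow> ('v::euclidean_space \<Rightarrow> 'w \<Rightarrow> 'w) \<Rightarrow> ('w \<Rightarrow> 'v measure) \<Rightarrow> bool" where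
  "invariant_measure P \<theta> \<Psi> \<longleftrightarrow>
     (\<forall>\<omega>\<in>space P. \<forall>x. \<forall>B\<in>sets borel.
        emeasure (\<Psi> \<omega>) ((\<lambda>b. b + x) ` B) = emeasure (\<Psi> (\<theta> x \<omega>)) B)"

definition locally_square_integrable ::
    "'w measure \<Rightarrow> ('w \<Rightarrow> 'v::euclidean_space measure) \<Rightarrow> bool" where
  "locally_square_integrable P \<Psi> \<longleftrightarrow>
     (\<forall>B\<in>sets borel. bounded B \<longrightarrow> (\<integral>\<^sup>+\<omega>. (emeasure (\<Psi> \<omega>) B)\<^sup>2 \<partial>P) < \<infinity>)"

definition intensity :: "'w measure \<Rightarrow> ('w \<Rightarrow> 'v::euclidean_space measure) \<Rightarrow> ennreal" where
  "intensity P \<Psi> = (\<integral>\<^sup>+\<omega>. emeasure (\<Psi> \<omega>) (cbox 0 One) \<partial>P)"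

definition reduced_second_moment ::
    "'w measure \<Rightarrow> ('w \<Rightarrow> 'v::euclidean_space measure) \<Rightarrow> 'v measure" where
  "reduced_second_moment P \<Psi> =
     measure_of UNIV (sets borel)
       (\<lambda>B. \<integral>\<^sup>+\<omega>. (\<integral>\<^sup>+(x, y). indicator (cbox 0 One) x * indicator B (y - x) \<partial>(\<Psi> \<omega> \<Otimes>\<^sub>M \<Psi> \<omega>)) \<partial>P)"

definition two_point_palm ::
    "'w measure \<Rightarrow> ('v::euclidean_space \<Rightarrow> 'w \<Rightarrow> 'w) \<Rightarrow> ('w \<Rightarrow> 'v measure) \<Rightarrow> ('v \<Rightarrow> 'w measure) \<Rightarrow> bool"
  where
  "two_point_palm P \<theta> \<Phi> Q \<longleftrightarrow>
     Q \<in> borel \<rightarrow>\<^sub>M prob_algebra P \<and>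
     (\<forall>f :: 'v \<times> 'v \<times> 'w \<Rightarrow> ennreal. f \<in> borel_measurable (borel \<Otimes>\<^sub>M borel \<Otimes>\<^sub>M P) \<longrightarrow>
        (\<integral>\<^sup>+\<omega>. (\<integral>\<^sup>+(x, y). f (x, y - x, \<theta> x \<omega>) \<partial>(\<Phi> \<omega> \<Otimes>\<^sub>M \<Phi> \<omega>)) \<partial>P) =
        (\<integral>\<^sup>+x. (\<integral>\<^sup>+y. (\<integral>\<^sup>+\<omega>. f (x, y, \<omega>) \<partial>Q y) \<partial>reduced_second_moment P \<Phi>) \<partial>lborel))"

definition probability_kernel ::
    "'w measure \<Rightarrow> ('w \<Rightarrow> 'v::euclidean_space \<Rightarrow> 'v measure) \<Rightarrow> bool" where
  "probability_kernel P K \<longleftrightarrow> (\<lambda>(\<omega>, x). K \<omega> x) \<in> P \<Otimes>\<^sub>M borel \<rightarrow>\<^sub>M prob_algebra borel"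

definition invariant_kernel ::
    "'w measure \<Rightarrow> ('v::euclidean_space \<Rightarrow> 'w \<Rightarrow> 'w) \<Rightarrow> ('w \<Rightarrow> 'v \<Rightarrow> 'v measure) \<Rightarrow> bool" where
  "invariant_kernel P \<theta> K \<longleftrightarrow>
     (\<forall>\<omega>\<in>space P. \<forall>x. \<forall>B\<in>sets borel.
        emeasure (K \<omega> x) ((\<lambda>b. b + x) ` B) = emeasure (K (\<theta> x \<omega>) 0) B)"

text \<open>The Giry bind is the integral of the measures \<open>K \<omega> x\<close> with respect to \<open>\<Phi> \<omega>\<close>; the measure
  \<open>\<Phi> \<omega>\<close> need not be finite for this.\<close>

definition transport ::
    "('w \<Rightarrow> 'v::euclidean_space \<Rightarrow> 'v measure) \<Rightarrow> ('w \<Rightarrow> 'v measure) \<Rightarrow> 'w \<Rightarrow> 'v measure" where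
  "transport K \<Phi> \<omega> = Giry_Monad.bind (\<Phi> \<omega>) (K \<omega>)"

text \<open>The setwise expectation of the random signed measure \<open>K\<^sub>y \<otimes> K\<^sub>0 - L\<^sub>y \<otimes> L\<^sub>0\<close> under \<open>Q y\<close>.\<close>

definition palm_difference ::
    "('v \<Rightarrow> 'w measure) \<Rightarrow> ('w \<Rightarrow> 'v::euclidean_space \<Rightarrow> 'v measure) \<Rightarrow> ('w \<Rightarrow> 'v \<Rightarrow> 'v measure)
      \<Rightarrow> 'v \<Rightarrow> ('v \<times> 'v) set \<Rightarrow> real" where
  "palm_difference Q K L y B =
     (LINT \<omega>|Q y. measure (K \<omega> y \<Otimes>\<^sub>M K \<omega> 0) B - measure (L \<omega> y \<Otimes>\<^sub>M L \<omega> 0) B)"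

definition kappa ::
    "('v \<Rightarrow> 'w measure) \<Rightarrow> ('w \<Rightarrow> 'v::euclidean_space \<Rightarrow> 'v measure) \<Rightarrow> ('w \<Rightarrow> 'v \<Rightarrow> 'v measure)
      \<Rightarrow> 'v \<Rightarrow> ennreal" where
  "kappa Q K L y = tv_norm (borel \<Otimes>\<^sub>M borel) (palm_difference Q K L y)"

text \<open>
  A finite signed measure \<open>\<eta>\<close> extending the difference of two reduced second moment measures, which
  itself makes sense on bounded Borel sets only. Continuity along bounded Borel sets increasing to
  the whole space makes the extension unique.
\<close>

definition extends_moment_difference ::
    "'w measure \<Rightarrow> ('w \<Rightarrow> 'v::euclidean_space measure) \<Rightarrow> ('w \<Rightarrow> 'v measure) \<Rightarrow> ('v set \<Rightarrow> real) \<Rightarrow> bool"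
  where
  "extends_moment_difference P \<Psi> \<Psi>' \<eta> \<longleftrightarrow>
     finite_signed_measure borel \<eta> \<and>
     (\<forall>B\<in>sets borel. bounded B \<longrightarrow>
        \<eta> B = measure (reduced_second_moment P \<Psi>) B - measure (reduced_second_moment P \<Psi>') B)"

text \<open>To be used for bounded Borel sets only.\<close>

definition covariance_measure ::
    "'w measure \<Rightarrow> ('w \<Rightarrow> 'v::euclidean_space measure) \<Rightarrow> 'v set \<Rightarrow> real" where
  "covariance_measure P \<Psi> B =
     measure (reduced_second_moment P \<Psi>) B - (enn2real (intensity P \<Psi>))\<^sup>2 * measure lborel B"

definition correlation ::
    "('v::euclidean_space \<Rightarrow> real) \<Rightarrow> ('v \<Rightarrow> real) \<Rightarrow> 'v \<Rightarrow> real" where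
  "correlation f g y = (LINT x|lborel. f x * g (x - y))"

definition bounded_test_fun :: "('v::euclidean_space \<Rightarrow> real) \<Rightarrow> bool" where
  "bounded_test_fun f \<longleftrightarrow>
     f \<in> borel_measurable borel \<and> bounded (range f) \<and> bounded {x. f x \<noteq> 0}"

text \<open>
  Integrability is stated because the Bochner integral of a non-integrable function is \<open>0\<close> by
  convention.
\<close>

definition bartlett_spectral_measure ::
    "'w measure \<Rightarrow> ('w \<Rightarrow> 'v::euclidean_space measure) \<Rightarrow> 'v measure \<Rightarrow> bool" where
  "bartlett_spectral_measure P \<Psi> \<sigma> \<longleftrightarrow>
     locally_finite_measure \<sigma> \<and>
     (\<forall>f g. bounded_test_fun f \<longrightarrow> bounded_test_fun g \<longrightarrow>
        integrable \<sigma> (\<lambda>k. fourier_fun f k * cnj (fourier_fun g k)) \<and>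
        complex_of_real (local_signed_integral (covariance_measure P \<Psi>) (correlation f g)) =
          (LINT k|\<sigma>. fourier_fun f k * cnj (fourier_fun g k)) / (2 * pi) ^ DIM('v))"

end

theory Submission
  imports Defs
begin

text \<open>
  Let \<open>N\<^sub>y\<close> be the mean of \<open>K\<^sub>y \<otimes> K\<^sub>0\<close> under the two-point Palm measure. Invariance of the kernel and the
  Palm formula show that the reduced second moment measure of the transport of \<open>\<Phi>\<close> by \<open>K\<close> is the image of
  \<open>\<alpha>(dy) N\<^sub>y(du, dv)\<close> under \<open>(y, u, v) \<mapsto> u - v\<close>, and that the transport is locally square-integrable
  iff this image is locally finite. For two kernels the measures on triples \<open>(y, u, v)\<close> differ by at most the integral
  of \<open>kappa\<close> on every Borel set, so their difference is a difference of two finite measures. Working on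
  triples matters: when truncating in \<open>y\<close> rather than in \<open>u - v\<close>, the limits are dominated by the Palm
  expectation under the integral itself, whereas \<open>kappa\<close> need not be measurable.

  For the spectral measures, \<open>f\<close> a normalized ball indicator and \<open>g\<close> its translates turn the defining identity
  into an identity of Fourier transforms. Averaging over the translation against modulated
  Gaussians gives an identity for all Gaussian averages of the spectral measures weighted by the squared
  modulus of the transform of \<open>f\<close>. These averages determine the weighted measures, and the weight tends to \<open>1\<close> as the ball shrinks. This produces the complex conjugate of the transform of \<open>\<eta>\<close>, and
  conjugation is harmless because the spectral measures are real. The intensities agree by mass transport, so they cancel.
\<close>

section \<open>Sums and differences of measures\<close>

text \<open>Neither second moment measure is finite in general, so their difference has no value on
  unbounded sets; comparisons are carried as additive identities A + D = B + C between measures and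
  are read as differences only where all four terms are finite. The uniform bound by one constant
  becomes finiteness of both Jordan parts by testing it on the two halves of a Hahn decomposition.
  Where \<open>kappa\<close> is not measurable, its \<open>nn_integral\<close> is the supremum over
  simple functions below it, which still bounds the integral of every measurable function that
  \<open>kappa\<close> dominates. The spectral measures are only locally finite and may have no
  Fourier transform; the squared modulus of the transform of a test function turns them into finite
  measures, and the factor produced by a translation is exactly a character. The transform of a
  modulated Gaussian is an explicit positive Gaussian, so Fourier inversion for these functions is a
  calculation. The transform of an autocorrelation must be Lebesgue integrable for the interchanges
  of integrals; this too follows from Gaussian weights, by Fatou's lemma.\<close>

definition sum_measure :: "'a measure \<Rightarrow> 'a measure \<Rightarrow> 'a measure" where
  "sum_measure M N = measure_of (space M) (sets M) (\<lambda>A. emeasure M A + emeasure N A)"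

lemma sets_sum_measure [simp, measurable_cong]: "sets (sum_measure M N) = sets M"
  and space_sum_measure [simp]: "space (sum_measure M N) = space M"
  by (simp_all add: sum_measure_def)

lemma emeasure_sum_measure:
  assumes "sets N = sets M" "A \<in> sets M"
  shows "emeasure (sum_measure M N) A = emeasure M A + emeasure N A"
  unfolding sum_measure_def
proof (rule emeasure_measure_of_sigma)
  show "sigma_algebra (space M) (sets M)" ..
  show "positive (sets M) (\<lambda>A. emeasure M A + emeasure N A)"
    by (simp add: positive_def)
  show "countably_additive (sets M) (\<lambda>A. emeasure M A + emeasure N A)"
  proof (rule countably_additiveI)
    fix B :: "nat \<Rightarrow> 'a set"
    assume B: "range B \<subseteq> sets M" "disjoint_family B"
    have "(\<Sum>i. emeasure M (B i) + emeasure N (B i)) = (\<Sum>i. emeasure M (B i)) + (\<Sum>i. emeasure N (B i))"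
      by (rule suminf_add[symmetric]) auto
    then show "(\<Sum>i. emeasure M (B i) + emeasure N (B i)) = emeasure M (\<Union> (range B)) + emeasure N (\<Union> (range B))"
      using B assms by (simp add: suminf_emeasure)
  qed
qed (use assms in auto)

lemma finite_measure_sum_measure:
  assumes "finite_measure M" "finite_measure N" "sets N = sets M"
  shows "finite_measure (sum_measure M N)"
  using assms
  by (intro finite_measureI)
    (simp add: emeasure_sum_measure finite_measure.emeasure_finite)

lemma le_sum_measure1:
  assumes "sets N = sets M" shows "M \<le> sum_measure M N"
  using assms by (simp add: le_measure emeasure_sum_measure)

lemma le_sum_measure2:
  assumes "sets N = sets M" shows "N \<le> sum_measure M N"
  using assms by (simp add: le_measure emeasure_sum_measure)

lemma integrable_mono_measure:
  fixes f :: "'a \<Rightarrow> 'b::{banach, second_countable_topology}"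
  assumes "integrable N f" "sets M = sets N" "M \<le> N"
  shows "integrable M f"
proof -
  have "(\<integral>\<^sup>+x. norm (f x) \<partial>M) \<le> (\<integral>\<^sup>+x. norm (f x) \<partial>N)"
    by (rule nn_integral_mono_measure[OF assms(2,3)])
  also have "\<dots> < \<infinity>"
    using assms(1) by (simp add: integrable_iff_bounded)
  finally show ?thesis
    using borel_measurable_integrable[OF assms(1)]
    by (intro integrableI_bounded) (simp_all add: measurable_cong_sets[OF assms(2) refl])
qed

text \<open>Each summand is dominated by the sum, so integrability passes down to it. The induction
  from indicators through sums to dominated limits then runs under all three measures at once, with
  the same majorant \<open>2 * norm (f x)\<close>.\<close>

lemma integral_sum_measure:
  fixes f :: "'a \<Rightarrow> 'b::{banach, second_countable_topology}"
  assumes sets: "sets N = sets M" and f: "integrable (sum_measure M N) f"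
  shows "(LINT x|sum_measure M N. f x) = (LINT x|M. f x) + (LINT x|N. f x)"
proof -
  have sp: "space N = space M" using sets by (rule sets_eq_imp_space_eq)
  have iM: "integrable M g" if "integrable (sum_measure M N) g" for g :: "'a \<Rightarrow> 'b"
    using that by (rule integrable_mono_measure) (simp_all add: sets le_sum_measure1)
  have iN: "integrable N g" if "integrable (sum_measure M N) g" for g :: "'a \<Rightarrow> 'b"
    using that by (rule integrable_mono_measure) (simp_all add: sets le_sum_measure2)
  show ?thesis using f
  proof (induction rule: integrable_induct)
    case (base A c)
    then have fin: "emeasure M A < \<infinity>" "emeasure N A < \<infinity>" "A \<in> sets M"
      using sets by (auto simp: emeasure_sum_measure)
    then have m: "measure (sum_measure M N) A = measure M A + measure N A"
      using sets by (simp add: measure_def emeasure_sum_measure enn2real_plus)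
    have *: "(LINT x|R. indicator A x *\<^sub>R c) = measure R A *\<^sub>R c"
      if "A \<in> sets R" "emeasure R A < \<infinity>" for R :: "'a measure"
    proof -
      have "A \<inter> space R = A" using sets.sets_into_space[OF that(1)] by blast
      with that show ?thesis by simp
    qed
    have "A \<in> sets N" using fin(3) sets by simp
    show ?case
      unfolding *[OF fin(3,1)] *[OF \<open>A \<in> sets N\<close> fin(2)] *[OF base] m by (rule scaleR_left_distrib)
  next
    case (add f g)
    from iM[OF add.hyps(1)] iM[OF add.hyps(2)] iN[OF add.hyps(1)] iN[OF add.hyps(2)] show ?case
      by (simp add: add.hyps add.IH)
  next
    case (lim f s)
    have cM: "(\<lambda>i. LINT x|M. s i x) \<longlonglongrightarrow> (LINT x|M. f x)"
      using iM[OF lim.hyps(4)] iM[OF lim.hyps(1)] lim.hyps(2,3)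
      by (intro integral_dominated_convergence[where w="\<lambda>x. 2 * norm (f x)"]) auto
    have cN: "(\<lambda>i. LINT x|N. s i x) \<longlonglongrightarrow> (LINT x|N. f x)"
      using iN[OF lim.hyps(4)] iN[OF lim.hyps(1)] lim.hyps(2,3) sp
      by (intro integral_dominated_convergence[where w="\<lambda>x. 2 * norm (f x)"]) auto
    have "(\<lambda>i. LINT x|sum_measure M N. s i x) \<longlonglongrightarrow> (LINT x|sum_measure M N. f x)"
      using lim.hyps(4) lim.hyps(1) lim.hyps(2,3)
      by (intro integral_dominated_convergence[where w="\<lambda>x. 2 * norm (f x)"]) auto
    moreover have "(\<lambda>i. LINT x|sum_measure M N. s i x) \<longlonglongrightarrow> (LINT x|M. f x) + (LINT x|N. f x)"
      using tendsto_add[OF cM cN] lim.IH by simp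
    ultimately show ?case by (rule LIMSEQ_unique)
  qed
qed

lemma integrable_bounded_finite:
  fixes f :: "'a \<Rightarrow> 'b::{banach, second_countable_topology}"
  assumes "finite_measure M" "f \<in> borel_measurable M" "\<And>x. x \<in> space M \<Longrightarrow> norm (f x) \<le> C"
  shows "integrable M f"
  using assms by (intro finite_measure.integrable_const_bound[where B=C]) auto

text \<open>This is A - B = C - D with the negative terms moved across. Equality of the set
  functions makes the two sum measures literally equal, so a bounded function has the same integral
  against both.\<close>

lemma integral_add_eq:
  fixes f :: "'a \<Rightarrow> 'b::{banach, second_countable_topology}"
  assumes fin: "finite_measure A" "finite_measure B" "finite_measure C" "finite_measure D"
    and sets: "sets A = sets M" "sets B = sets M" "sets C = sets M" "sets D = sets M"
    and eq: "\<And>X. X \<in> sets M \<Longrightarrow> emeasure A X + emeasure D X = emeasure B X + emeasure C X"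
    and f: "f \<in> borel_measurable M" "\<And>x. x \<in> space M \<Longrightarrow> norm (f x) \<le> K"
  shows "(LINT x|A. f x) + (LINT x|D. f x) = (LINT x|B. f x) + (LINT x|C. f x)"
proof -
  have *: "sum_measure A D = sum_measure B C"
    using sets eq by (intro measure_eqI) (auto simp: emeasure_sum_measure)
  have sp: "space A = space M" "space B = space M"
    using sets by (auto dest: sets_eq_imp_space_eq)
  have "integrable (sum_measure A D) f"
    using fin sets f sp
    by (intro integrable_bounded_finite[where C=K] finite_measure_sum_measure)
      (auto cong: measurable_cong_sets)
  moreover from this have "integrable (sum_measure B C) f" by (simp add: *)
  ultimately show ?thesis
    using integral_sum_measure[of D A f] integral_sum_measure[of C B f] sets * by simp
qed

text \<open>The way back from an additive identity to differences. Finiteness is asked on the single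
  set \<open>X\<close>, so it applies on bounded sets to measures of infinite total mass.\<close>

lemma measure_diff_eq:
  assumes "emeasure A X < \<infinity>" "emeasure B X < \<infinity>" "emeasure C X < \<infinity>" "emeasure D X < \<infinity>"
    and eq: "emeasure A X + emeasure D X = emeasure B X + emeasure C X"
  shows "measure A X - measure B X = measure C X - measure D X"
proof -
  have "ennreal (measure A X) + ennreal (measure D X) = ennreal (measure B X) + ennreal (measure C X)"
    using assms by (simp add: emeasure_eq_ennreal_measure less_top[symmetric])
  then have "ennreal (measure A X + measure D X) = ennreal (measure B X + measure C X)"
    by (simp add: ennreal_plus)
  then have "measure A X + measure D X = measure B X + measure C X"
    by (subst (asm) ennreal_inj) auto
  then show ?thesis by simp
qed

section \<open>Jordan decompositions\<close>

text \<open>Densities \<open>p\<close> and \<open>q\<close> with respect to the sum of the two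
  measures reduce the decomposition to the pointwise positive and negative parts of
  \<open>p - q\<close>, with \<open>q < p\<close> as the Hahn set. The relation to \<open>M\<close>
  and \<open>N\<close> is additive because both may be infinite on a set, although they are finite
  on each \<open>A i\<close>.\<close>

lemma jordan_decomposition_exists:
  fixes A :: "nat \<Rightarrow> 'a set"
  assumes sets: "sets N = sets M"
    and A: "range A \<subseteq> sets M" "(\<Union>i. A i) = space M"
    and finM: "\<And>i. emeasure M (A i) \<noteq> \<infinity>" and finN: "\<And>i. emeasure N (A i) \<noteq> \<infinity>"
  obtains Jp Jn Y where "sets Jp = sets M" "sets Jn = sets M" "Y \<in> sets M"
    "\<And>B. B \<in> sets M \<Longrightarrow> emeasure Jp B + emeasure N B = emeasure Jn B + emeasure M B"
    "emeasure Jp (space M - Y) = 0" "emeasure Jn Y = 0"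
    "\<And>B. B \<in> sets M \<Longrightarrow> emeasure Jp B \<le> emeasure M B"
    "\<And>B. B \<in> sets M \<Longrightarrow> emeasure Jn B \<le> emeasure N B"
proof -
  define S where "S = sum_measure M N"
  have setsS [measurable_cong, simp]: "sets S = sets M" and spS [simp]: "space S = space M"
    by (simp_all add: S_def)
  interpret S: sigma_finite_measure S
  proof
    show "\<exists>F. countable F \<and> F \<subseteq> sets S \<and> \<Union> F = space S \<and> (\<forall>a\<in>F. emeasure S a \<noteq> \<infinity>)"
      using A finM finN sets
      by (intro exI[of _ "range A"]) (auto simp: S_def emeasure_sum_measure range_subsetD)
  qed
  have "absolutely_continuous S M" "absolutely_continuous S N"
    using sets by (auto simp: absolutely_continuous_def null_sets_def S_def emeasure_sum_measure)
  then obtain p q where p [measurable]: "p \<in> borel_measurable S" and Mp: "density S p = M"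
    and q [measurable]: "q \<in> borel_measurable S" and Nq: "density S q = N"
    using S.Radon_Nikodym sets setsS by metis
  define Jp where "Jp = density S (\<lambda>x. if q x < p x then p x - q x else 0)"
  define Jn where "Jn = density S (\<lambda>x. if p x < q x then q x - p x else 0)"
  define Y where "Y = {x \<in> space S. q x < p x}"
  show thesis
  proof (rule that)
    show "sets Jp = sets M" "sets Jn = sets M" by (auto simp: Jp_def Jn_def)
    show Y: "Y \<in> sets M" unfolding Y_def setsS[symmetric] by measurable
    \<comment> \<open>The identity also holds where a density is infinite: the subtraction is only
      ever made from the strictly larger value.\<close>
    have 1: "(if q x < p x then p x - q x else 0) + q x = (if p x < q x then q x - p x else 0) + p x" for x
      using diff_add_cancel_ennreal[of "q x" "p x"] diff_add_cancel_ennreal[of "p x" "q x"]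
      by (cases "p x" "q x" rule: linorder_cases) auto
    have eM: "emeasure M B = (\<integral>\<^sup>+x. p x * indicator B x \<partial>S)"
      and eN: "emeasure N B = (\<integral>\<^sup>+x. q x * indicator B x \<partial>S)" if "B \<in> sets M" for B
      using emeasure_density[OF p, of B] emeasure_density[OF q, of B] that by (simp_all add: Mp Nq)
    show "emeasure Jp B + emeasure N B = emeasure Jn B + emeasure M B" if "B \<in> sets M" for B
      using that 1
      by (simp add: eM eN Jp_def Jn_def emeasure_density
          nn_integral_add[symmetric] distrib_right[symmetric])
    show "emeasure Jp (space M - Y) = 0"
      using Y by (auto simp: Jp_def emeasure_density Y_def indicator_def ennreal_minus_eq_0
          intro!: nn_integral_0_iff_AE[THEN iffD2])
    show "emeasure Jn Y = 0"
      using Y by (auto simp: Jn_def emeasure_density Y_def indicator_def ennreal_minus_eq_0 not_less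
          intro!: nn_integral_0_iff_AE[THEN iffD2] AE_I2)
    show "emeasure Jp B \<le> emeasure M B" if "B \<in> sets M" for B
      using that by (simp add: eM Jp_def emeasure_density)
        (auto intro!: nn_integral_mono mult_right_mono diff_le_self_ennreal)
    show "emeasure Jn B \<le> emeasure N B" if "B \<in> sets M" for B
      using that by (simp add: eN Jn_def emeasure_density)
        (auto intro!: nn_integral_mono mult_right_mono diff_le_self_ennreal)
  qed
qed

text \<open>The supremum over subsets of \<open>A\<close> is attained at
  \<open>A \<inter> Y\<close>: the negative part vanishes there and the positive part already has
  its full mass. For the upper bound the negative part is dropped and the set enlarged.\<close>

lemma jordan_pos_eq:
  assumes fin: "finite_measure Jp" "finite_measure Jn"
    and sets: "sets Jp = sets M" "sets Jn = sets M"
    and Y: "Y \<in> sets M" "emeasure Jp (space M - Y) = 0" "emeasure Jn Y = 0"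
    and \<nu>: "\<And>B. B \<in> sets M \<Longrightarrow> \<nu> B = measure Jp B - measure Jn B"
  shows "jordan_pos M \<nu> = Jp"
proof -
  interpret p: finite_measure Jp by fact
  interpret n: finite_measure Jn by fact
  have sp: "space Jp = space M" using sets by (auto dest: sets_eq_imp_space_eq)
  have *: "(SUP B\<in>{B \<in> sets M. B \<subseteq> A}. ennreal (\<nu> B)) = emeasure Jp A" if A: "A \<in> sets M" for A
  proof (rule antisym)
    show "(SUP B\<in>{B \<in> sets M. B \<subseteq> A}. ennreal (\<nu> B)) \<le> emeasure Jp A"
    proof (rule SUP_least)
      fix B assume B: "B \<in> {B \<in> sets M. B \<subseteq> A}"
      then have "ennreal (\<nu> B) \<le> ennreal (measure Jp B)"
        by (intro ennreal_leI) (simp add: \<nu>)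
      also have "\<dots> \<le> emeasure Jp A"
        using A B sets unfolding p.emeasure_eq_measure by (intro ennreal_leI p.finite_measure_mono) auto
      finally show "ennreal (\<nu> B) \<le> emeasure Jp A" .
    qed
    have n0: "measure Jn (A \<inter> Y) = 0"
      using emeasure_mono[of "A \<inter> Y" Y Jn] Y(1,3) sets
      by (simp add: n.emeasure_eq_measure measure_le_0_iff)
    have "emeasure Jp (A - Y) = 0"
      using emeasure_mono[of "A - Y" "space M - Y" Jp] Y(1,2) sets A sets.sets_into_space[OF A]
      by auto
    moreover have "emeasure Jp A = emeasure Jp (A \<inter> Y) + emeasure Jp (A - Y)"
      using A Y sets by (subst plus_emeasure) (auto intro!: arg_cong[where f="emeasure Jp"])
    ultimately have "emeasure Jp A = ennreal (\<nu> (A \<inter> Y))"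
      using A Y n0 by (simp add: \<nu> p.emeasure_eq_measure)
    also have "\<dots> \<le> (SUP B\<in>{B \<in> sets M. B \<subseteq> A}. ennreal (\<nu> B))"
      using A Y by (intro SUP_upper) auto
    finally show "emeasure Jp A \<le> (SUP B\<in>{B \<in> sets M. B \<subseteq> A}. ennreal (\<nu> B))" .
  qed
  have "jordan_pos M \<nu> = measure_of (space M) (sets M) (emeasure Jp)"
    unfolding jordan_pos_def
    by (rule measure_of_eq) (use * in \<open>auto simp: sets.sigma_sets_eq sets.space_closed\<close>)
  also have "\<dots> = Jp"
    using measure_of_of_measure[of Jp] sets sp by simp
  finally show ?thesis .
qed

lemma signed_integral_Jordan:
  assumes fin: "finite_measure Jp" "finite_measure Jn"
    and sets: "sets Jp = sets M" "sets Jn = sets M"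
    and Y: "Y \<in> sets M" "emeasure Jp (space M - Y) = 0" "emeasure Jn Y = 0"
    and \<nu>: "\<And>B. B \<in> sets M \<Longrightarrow> \<nu> B = measure Jp B - measure Jn B"
  shows "signed_integral M \<nu> f = (LINT x|Jp. f x) - (LINT x|Jn. f x)"
proof -
  have "jordan_neg M \<nu> = Jn"
    \<comment> \<open>Negating \<nu> exchanges the two parts and replaces the Hahn set by its
      complement.\<close>
    unfolding jordan_neg_def using assms sets.sets_into_space[OF Y(1)]
    by (intro jordan_pos_eq[where Y="space M - Y" and Jn=Jp]) (auto simp: double_diff)
  then show ?thesis
    using jordan_pos_eq[OF assms] by (simp add: signed_integral_def)
qed

text \<open>\<open>M1\<close> and \<open>M2\<close> may overlap, whereas
  \<open>signed_integral\<close> is defined through mutually singular parts. The additive identity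
  linking the two pairs shows that bounded functions cannot tell them apart, so any representation
  by finite measures may be used for evaluation.\<close>

lemma signed_integral_diff:
  fixes f :: "'a \<Rightarrow> 'b::{banach, second_countable_topology}"
  assumes fin: "finite_measure M1" "finite_measure M2"
    and sets: "sets M1 = sets M" "sets M2 = sets M"
    and \<nu>: "\<And>B. B \<in> sets M \<Longrightarrow> \<nu> B = measure M1 B - measure M2 B"
    and f: "f \<in> borel_measurable M" "\<And>x. x \<in> space M \<Longrightarrow> norm (f x) \<le> C"
  shows "signed_integral M \<nu> f = (LINT x|M1. f x) - (LINT x|M2. f x)"
proof -
  interpret m1: finite_measure M1 by fact
  interpret m2: finite_measure M2 by fact
  have sp: "space M1 = space M" using sets by (auto dest: sets_eq_imp_space_eq)
  have A: "range (\<lambda>i::nat. space M1) \<subseteq> sets M1" by auto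
  obtain Jp Jn Y where J: "sets Jp = sets M1" "sets Jn = sets M1" "Y \<in> sets M1"
    "\<And>B. B \<in> sets M1 \<Longrightarrow> emeasure Jp B + emeasure M2 B = emeasure Jn B + emeasure M1 B"
    "emeasure Jp (space M1 - Y) = 0" "emeasure Jn Y = 0"
    "\<And>B. B \<in> sets M1 \<Longrightarrow> emeasure Jp B \<le> emeasure M1 B"
    "\<And>B. B \<in> sets M1 \<Longrightarrow> emeasure Jn B \<le> emeasure M2 B"
    by (rule jordan_decomposition_exists[of M2 M1, OF _ A]) (use sets in auto)
  have fJ: "finite_measure Jp" "finite_measure Jn"
    using J(7,8)[of "space M1"] J(1,2)[THEN sets_eq_imp_space_eq]
    by (auto intro!: finite_measureI simp: top_unique)
  have "\<nu> B = measure Jp B - measure Jn B" if "B \<in> sets M" for B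
    using measure_diff_eq[of Jp B Jn M1 M2] J(4)[of B] that sets \<nu> fJ fin
    by (simp add: finite_measure.emeasure_finite less_top[symmetric])
  then have "signed_integral M \<nu> f = (LINT x|Jp. f x) - (LINT x|Jn. f x)"
    using J sets sp fJ by (intro signed_integral_Jordan[where Y=Y]) auto
  also have "\<dots> = (LINT x|M1. f x) - (LINT x|M2. f x)"
    using integral_add_eq[OF fJ(1) fJ(2) fin(1) fin(2), of M f C] J sets f
    by (simp add: algebra_simps)
  finally show ?thesis .
qed

lemma finite_signed_measure_diff:
  assumes "finite_measure M1" "finite_measure M2" "sets M1 = sets M" "sets M2 = sets M"
  shows "finite_signed_measure M (\<lambda>B. measure M1 B - measure M2 B)"
  unfolding finite_signed_measure_def using assms
  by (auto intro!: sums_diff finite_measure.finite_measure_UNION)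

text \<open>Disjoint bounded shells around the origin exhaust \<open>B\<close>, and countable
  additivity expresses both values at \<open>B\<close> through values on these shells. This makes
  the extension of a locally defined difference unique.\<close>

lemma finite_signed_measure_eq_bounded:
  fixes \<eta> \<eta>' :: "'v::euclidean_space set \<Rightarrow> real"
  assumes "finite_signed_measure borel \<eta>" "finite_signed_measure borel \<eta>'"
    and eq: "\<And>B. B \<in> sets borel \<Longrightarrow> bounded B \<Longrightarrow> \<eta> B = \<eta>' B"
    and B: "B \<in> sets borel"
  shows "\<eta> B = \<eta>' B"
proof -
  define A where "A i = B \<inter> {x. real i \<le> norm x \<and> norm x < real i + 1}" for i :: nat
  have [measurable]: "A i \<in> sets borel" for i
    using B unfolding A_def by measurable
  have bd: "bounded (A i)" for i
    by (rule bounded_subset[of "ball 0 (real i + 1)"]) (auto simp: A_def)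
  have U: "(\<Union>i. A i) = B"
  proof (intro equalityI subsetI)
    fix x assume "x \<in> B"
    then have "x \<in> A (nat \<lfloor>norm x\<rfloor>)" by (auto simp: A_def)
    then show "x \<in> (\<Union>i. A i)" by blast
  qed (auto simp: A_def)
  have "disjoint_family A"
    by (auto simp: disjoint_family_on_def A_def)
  moreover have "range A \<subseteq> sets borel" by auto
  ultimately have "(\<lambda>i. \<eta> (A i)) sums \<eta> B" "(\<lambda>i. \<eta>' (A i)) sums \<eta>' B"
    using assms(1,2)[unfolded finite_signed_measure_def, rule_format, of A] by (simp_all add: U)
  then show ?thesis using eq[OF _ bd] sums_unique2 by auto
qed

section \<open>Fourier analysis of Gaussians and correlations\<close>

text \<open>Tonelli factors the integral of the majorant into two finite integrals. This criterion
  justifies the interchanges of Bochner integrals in the Gaussian smoothing arguments.\<close>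

lemma integrable_product_bound:
  fixes F :: "'a \<times> 'b \<Rightarrow> 'c::{banach, second_countable_topology}"
  assumes "sigma_finite_measure M" "sigma_finite_measure N"
    and F: "F \<in> borel_measurable (M \<Otimes>\<^sub>M N)"
    and g: "integrable M g" and h: "integrable N h"
    and le: "\<And>x y. x \<in> space M \<Longrightarrow> y \<in> space N \<Longrightarrow> norm (F (x, y)) \<le> norm (g x :: real) * norm (h y :: real)"
  shows "integrable (M \<Otimes>\<^sub>M N) F"
proof (rule integrableI_bounded)
  interpret pair_sigma_finite M N using assms(1,2) by (rule pair_sigma_finite.intro)
  show "F \<in> borel_measurable (M \<Otimes>\<^sub>M N)" by fact
  have [measurable]: "g \<in> borel_measurable M" "h \<in> borel_measurable N"
    using g h by auto
  have "(\<integral>\<^sup>+z. norm (F z) \<partial>(M \<Otimes>\<^sub>M N)) \<le> (\<integral>\<^sup>+z. ennreal (norm (g (fst z))) * ennreal (norm (h (snd z))) \<partial>(M \<Otimes>\<^sub>M N))"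
    using le by (intro nn_integral_mono)
      (auto simp: space_pair_measure ennreal_mult[symmetric] intro!: ennreal_leI)
  also have "\<dots> = (\<integral>\<^sup>+x. \<integral>\<^sup>+y. ennreal (norm (g x)) * ennreal (norm (h y)) \<partial>N \<partial>M)"
    by (subst M2.nn_integral_fst[symmetric]) auto
  also have "\<dots> = (\<integral>\<^sup>+x. norm (g x) \<partial>M) * (\<integral>\<^sup>+y. norm (h y) \<partial>N)"
    by (simp add: nn_integral_cmult nn_integral_multc)
  also have "\<dots> < \<infinity>"
    using g h by (simp add: integrable_iff_bounded ennreal_mult_less_top)
  finally show "(\<integral>\<^sup>+z. norm (F z) \<partial>(M \<Otimes>\<^sub>M N)) < \<infinity>" .
qed

lemma integral_swap_bound:
  fixes F :: "'a \<Rightarrow> 'b \<Rightarrow> 'c::{banach, second_countable_topology}"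
  assumes sf: "sigma_finite_measure M" "sigma_finite_measure N"
    and F: "case_prod F \<in> borel_measurable (M \<Otimes>\<^sub>M N)"
    and gh: "integrable M g" "integrable N h"
    and le: "\<And>x y. x \<in> space M \<Longrightarrow> y \<in> space N \<Longrightarrow> norm (F x y) \<le> norm (g x :: real) * norm (h y :: real)"
  shows "(LINT x|M. LINT y|N. F x y) = (LINT y|N. LINT x|M. F x y)"
proof -
  interpret pair_sigma_finite M N using sf by (rule pair_sigma_finite.intro)
  have "integrable (M \<Otimes>\<^sub>M N) (case_prod F)"
    using le by (intro integrable_product_bound[OF sf F gh]) auto
  from Fubini_integral[OF this] show ?thesis by simp
qed

lemma lborel_integral_affine:
  fixes f :: "'v::euclidean_space \<Rightarrow> 'b::{banach, second_countable_topology}"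
  assumes [measurable]: "f \<in> borel_measurable borel" and c: "c \<noteq> 0"
  shows "(LINT x|lborel. f x) = \<bar>c\<bar> ^ DIM('v) *\<^sub>R (LINT x|lborel. f (t + c *\<^sub>R x))"
  by (subst lborel_affine[OF c, of t]) (simp add: integral_density integral_distr)

lemma lborel_integrable_affine:
  fixes f :: "'v::euclidean_space \<Rightarrow> 'b::{banach, second_countable_topology}"
  assumes c: "c \<noteq> 0" and f: "integrable lborel f"
  shows "integrable lborel (\<lambda>x. f (t + c *\<^sub>R x))"
proof -
  have [measurable]: "f \<in> borel_measurable borel" using f by auto
  have "integrable (density (distr lborel borel (\<lambda>x. t + c *\<^sub>R x)) (\<lambda>_. \<bar>c\<bar> ^ DIM('v))) f"
    using f by (simp flip: lborel_affine[OF c])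
  then have "integrable lborel (\<lambda>x. \<bar>c\<bar> ^ DIM('v) *\<^sub>R f (t + c *\<^sub>R x))"
    by (simp add: integrable_density integrable_distr_eq)
  then have "integrable lborel (\<lambda>x. inverse (\<bar>c\<bar> ^ DIM('v)) *\<^sub>R (\<bar>c\<bar> ^ DIM('v) *\<^sub>R f (t + c *\<^sub>R x)))"
    by (rule integrable_scaleR_right)
  then show ?thesis using c by simp
qed

lemma lborel_integral_reflect:
  fixes f :: "'v::euclidean_space \<Rightarrow> 'b::{banach, second_countable_topology}"
  assumes "f \<in> borel_measurable borel"
  shows "(LINT x|lborel. f (t - x)) = (LINT x|lborel. f x)"
  using lborel_integral_affine[OF assms, of "-1" t] by simp

lemma lborel_integral_translate:
  fixes f :: "'v::euclidean_space \<Rightarrow> 'b::{banach, second_countable_topology}"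
  assumes "f \<in> borel_measurable borel"
  shows "(LINT x|lborel. f (x + t)) = (LINT x|lborel. f x)"
  using lborel_integral_affine[OF assms, of 1 t] by (simp add: add.commute)

section \<open>Unimodular characters\<close>

lemma continuous_on_fourier_char [continuous_intros]:
  assumes "continuous_on A f" "continuous_on A g"
  shows "continuous_on A (\<lambda>z. fourier_char (f z) (g z))"
  unfolding fourier_char_def by (intro continuous_intros assms)

lemma fourier_char_measurable [measurable (raw)]:
  fixes f g :: "'a \<Rightarrow> 'v::euclidean_space"
  assumes "f \<in> borel_measurable M" "g \<in> borel_measurable M"
  shows "(\<lambda>x. fourier_char (f x) (g x)) \<in> borel_measurable M"
proof -
  have "(\<lambda>z. fourier_char (fst z) (snd z :: 'v)) \<in> borel_measurable (borel \<Otimes>\<^sub>M borel)"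
    unfolding borel_prod by (intro borel_measurable_continuous_onI continuous_intros)
  from measurable_compose[OF measurable_Pair[OF assms] this] show ?thesis by simp
qed

lemma fourier_char_measurable1 [measurable]: "fourier_char k \<in> borel_measurable borel"
  using borel_measurable_continuous_onI[OF continuous_on_fourier_char[OF continuous_on_const continuous_on_id], of k]
  by (simp add: id_def)

lemma fourier_char_measurable2 [measurable]: "(\<lambda>k. fourier_char k x) \<in> borel_measurable borel"
  by (intro borel_measurable_continuous_onI continuous_intros)

lemma measurable_cnj [measurable (raw)]:
  assumes "f \<in> borel_measurable M" shows "(\<lambda>x. cnj (f x)) \<in> borel_measurable M"
  by (rule measurable_compose[OF assms]) (intro borel_measurable_continuous_onI continuous_intros)

lemma norm_fourier_char [simp]: "norm (fourier_char k x) = 1"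
  by (simp add: fourier_char_def norm_exp_eq_Re)

lemma fourier_char_0 [simp]: "fourier_char 0 x = 1" "fourier_char k 0 = 1"
  by (simp_all add: fourier_char_def)

lemma fourier_char_add: "fourier_char k (x + y) = fourier_char k x * fourier_char k y"
  by (simp add: fourier_char_def exp_add[symmetric] inner_add_right algebra_simps)

lemma fourier_char_uminus: "fourier_char k (- x) = cnj (fourier_char k x)"
  "fourier_char (- k) x = cnj (fourier_char k x)"
  by (simp_all add: fourier_char_def exp_cnj)

lemma fourier_char_diff: "fourier_char k (x - y) = fourier_char k x * cnj (fourier_char k y)"
  using fourier_char_add[of k x "- y"] by (simp add: fourier_char_uminus)

lemma fourier_char_commute: "fourier_char k x = fourier_char x k"
  by (simp add: fourier_char_def inner_commute)

lemma fourier_char_scale: "fourier_char (s *\<^sub>R k) x = fourier_char k (s *\<^sub>R x)"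
  by (simp add: fourier_char_def)

section \<open>Gaussians, their modulations and dilations\<close>

text \<open>Left unnormalised: it is at most \<open>1\<close>, takes the value \<open>1\<close> at
  the origin, and its transform is a constant multiple of itself.\<close>

definition gauss :: "'v::euclidean_space \<Rightarrow> real" where
  "gauss x = exp (- (x \<bullet> x) / 2)"

lemma gauss_measurable [measurable]: "gauss \<in> borel_measurable borel"
  unfolding gauss_def[abs_def] by (intro borel_measurable_continuous_onI continuous_intros) auto

lemma gauss_pos: "0 < gauss x" and gauss_le_1: "gauss x \<le> 1" and gauss_uminus [simp]: "gauss (- x) = gauss x"
  by (simp_all add: gauss_def)

text \<open>The characteristic function of the standard normal law at \<open>- t\<close>, with the
  normalising factor of the density moved to the right-hand side.\<close>

lemma gauss_real_char:
  "integrable lborel (\<lambda>x. complex_of_real (exp (- x\<^sup>2 / 2)) * exp (- (\<i> * complex_of_real (t * x))))"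
  "(LINT x|lborel. complex_of_real (exp (- x\<^sup>2 / 2)) * exp (- (\<i> * complex_of_real (t * x))))
     = complex_of_real (sqrt (2 * pi) * exp (- t\<^sup>2 / 2))"
proof -
  have d: "std_normal_density x = exp (- x\<^sup>2 / 2) / sqrt (2 * pi)" for x
    by (simp add: std_normal_density_def)
  have eq: "complex_of_real (exp (- x\<^sup>2 / 2)) * exp (- (\<i> * complex_of_real (t * x)))
      = complex_of_real (sqrt (2 * pi)) * (std_normal_density x *\<^sub>R iexp (- t * x))" for x
    by (simp add: d scaleR_conv_of_real)
  interpret prob_space std_normal_distribution
    by (rule prob_space_normal_density) simp
  have "integrable std_normal_distribution (\<lambda>x. iexp (- t * x))"
    by (rule integrable_const_bound[where B=1]) (auto simp: norm_exp_eq_Re)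
  then have i: "integrable lborel (\<lambda>x. std_normal_density x *\<^sub>R iexp (- t * x))"
    by (subst (asm) integrable_density) (auto simp: normal_density_nonneg)
  then show "integrable lborel (\<lambda>x. complex_of_real (exp (- x\<^sup>2 / 2)) * exp (- (\<i> * complex_of_real (t * x))))"
    unfolding eq by (intro integrable_mult_right)
  have "(LINT x|lborel. std_normal_density x *\<^sub>R iexp (- t * x)) = char std_normal_distribution (- t)"
    unfolding char_def by (subst integral_density) (auto simp: normal_density_nonneg)
  then show "(LINT x|lborel. complex_of_real (exp (- x\<^sup>2 / 2)) * exp (- (\<i> * complex_of_real (t * x))))
     = complex_of_real (sqrt (2 * pi) * exp (- t\<^sup>2 / 2))"
    unfolding eq integral_mult_right_zero by (simp add: char_std_normal_distribution)
qed

text \<open>The Gaussian and the character both factor over the coordinates of the orthonormal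
  basis, so the integral is a product of one-dimensional ones.\<close>

lemma gauss_fourier:
  fixes k :: "'v::euclidean_space"
  shows "integrable lborel (\<lambda>x. complex_of_real (gauss x) * fourier_char k x)"
    and "(LINT x|lborel. complex_of_real (gauss x) * fourier_char k x)
      = complex_of_real (sqrt (2 * pi) ^ DIM('v) * gauss k)"
proof -
  define h where "h b t = complex_of_real (exp (- t\<^sup>2 / 2)) * exp (- (\<i> * complex_of_real ((k \<bullet> b) * t)))" for b t
  have [measurable]: "(\<lambda>x. complex_of_real (gauss x) * fourier_char k x) \<in> borel_measurable borel"
    by measurable
  interpret product_sigma_finite "\<lambda>_::'v. lborel :: real measure"
    by (simp add: product_sigma_finite_def sigma_finite_lborel)
  have inn: "(\<Sum>b\<in>Basis. f b *\<^sub>R b) \<bullet> (\<Sum>b\<in>Basis. f b *\<^sub>R b) = (\<Sum>b\<in>Basis. (f b)\<^sup>2)" for f :: "'v \<Rightarrow> real"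
    by (subst euclidean_inner) (simp add: power2_eq_square)
  have eq: "complex_of_real (gauss (\<Sum>b\<in>Basis. f b *\<^sub>R b)) * fourier_char k (\<Sum>b\<in>Basis. f b *\<^sub>R b)
     = (\<Prod>b\<in>Basis. h b (f b))" for f
    by (simp add: gauss_def fourier_char_def inn h_def exp_sum[symmetric] prod.distrib of_real_prod[symmetric]
        sum_negf sum_divide_distrib inner_sum_right sum_distrib_left mult.commute
        power2_eq_square del: of_real_prod)
  have h: "integrable lborel (h b)" "(LINT t|lborel. h b t) = complex_of_real (sqrt (2 * pi) * exp (- (k \<bullet> b)\<^sup>2 / 2))" for b
    using gauss_real_char[of "k \<bullet> b"] unfolding h_def[abs_def] by auto
  have "integrable (\<Pi>\<^sub>M b\<in>Basis. lborel) (\<lambda>f. \<Prod>b\<in>(Basis::'v set). h b (f b))"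
    by (rule product_integrable_prod) (auto simp: h)
  then show "integrable lborel (\<lambda>x. complex_of_real (gauss x) * fourier_char k x)"
    by (subst lborel_eq) (simp add: integrable_distr_eq eq)
  have "(LINT x|lborel. complex_of_real (gauss x) * fourier_char k x) = (\<Prod>b\<in>(Basis::'v set). LINT t|lborel. h b t)"
    by (subst lborel_eq) (simp add: integral_distr eq product_integral_prod h(1))
  also have "\<dots> = complex_of_real (sqrt (2 * pi) ^ DIM('v) * (\<Prod>b\<in>(Basis::'v set). exp (- (k \<bullet> b)\<^sup>2 / 2)))"
    by (simp add: h(2) prod.distrib)
  also have "(\<Prod>b\<in>(Basis::'v set). exp (- (k \<bullet> b)\<^sup>2 / 2)) = gauss k"
  proof -
    have "k \<bullet> k = (\<Sum>b\<in>Basis. (k \<bullet> b)\<^sup>2)"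
      by (subst euclidean_inner) (simp add: power2_eq_square)
    then show ?thesis
      by (simp add: gauss_def exp_sum[symmetric] sum_negf sum_divide_distrib)
  qed
  finally show "(LINT x|lborel. complex_of_real (gauss x) * fourier_char k x)
      = complex_of_real (sqrt (2 * pi) ^ DIM('v) * gauss k)" .
qed

lemma integrable_gauss: "integrable lborel (gauss :: 'v::euclidean_space \<Rightarrow> real)"
  and integral_gauss: "(LINT x|lborel. gauss (x :: 'v)) = sqrt (2 * pi) ^ DIM('v)"
proof -
  have i: "integrable lborel (\<lambda>x::'v. complex_of_real (gauss x))"
    using gauss_fourier(1)[of "0 :: 'v"] by simp
  then show "integrable lborel (gauss :: 'v \<Rightarrow> real)"
    by (simp add: complex_of_real_integrable_eq)
  have "complex_of_real (LINT x|lborel. gauss (x :: 'v)) = complex_of_real (sqrt (2 * pi) ^ DIM('v))"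
    using gauss_fourier(2)[of "0 :: 'v"] by (simp add: gauss_def[of 0])
  then show "(LINT x|lborel. gauss (x :: 'v)) = sqrt (2 * pi) ^ DIM('v)"
    by (simp only: of_real_eq_iff)
qed

text \<open>A Gaussian of width \<open>1/s\<close> modulated by a character. The conjugate is there
  so that integration against \<open>fourier_char k\<close> gives a bump at \<open>k0\<close> and
  not at \<open>- k0\<close>.\<close>

definition window :: "real \<Rightarrow> 'v::euclidean_space \<Rightarrow> 'v \<Rightarrow> complex" where
  "window s k0 x = complex_of_real (gauss (s *\<^sub>R x)) * cnj (fourier_char k0 x)"

text \<open>The transform of \<open>window s k0\<close>, written as a real function: a positive bump
  of width \<open>s\<close> around \<open>k0\<close>, so that integrating it against a measure is a
  local averaging.\<close>

definition window_hat :: "real \<Rightarrow> 'v::euclidean_space \<Rightarrow> 'v \<Rightarrow> real" where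
  "window_hat s k0 k = (sqrt (2 * pi) / s) ^ DIM('v) * gauss ((k - k0) /\<^sub>R s)"

lemma window_measurable [measurable]: "window s k0 \<in> borel_measurable borel"
  "window_hat s k0 \<in> borel_measurable borel"
proof -
  have "continuous_on UNIV (window s k0)" "continuous_on UNIV (window_hat s k0)"
    unfolding window_def[abs_def] window_hat_def[abs_def] gauss_def by (auto intro!: continuous_intros)
  then show "window s k0 \<in> borel_measurable borel" "window_hat s k0 \<in> borel_measurable borel"
    by (auto intro: borel_measurable_continuous_onI)
qed

lemma window_integrable:
  assumes "0 < s" shows "integrable lborel (window s k0)" "integrable lborel (window_hat s k0)"
proof -
  have "integrable lborel (\<lambda>x. gauss (s *\<^sub>R x))"
    using lborel_integrable_affine[OF _ integrable_gauss, of s 0] assms by simp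
  then show "integrable lborel (window s k0)"
    by (rule Bochner_Integration.integrable_bound)
      (auto simp: window_def norm_mult gauss_pos less_imp_le)
  have "integrable lborel (\<lambda>x. gauss (- (k0 /\<^sub>R s) + (1/s) *\<^sub>R x))"
    using lborel_integrable_affine[OF _ integrable_gauss, of "1/s" "- (k0 /\<^sub>R s)"] assms by simp
  then have "integrable lborel (\<lambda>x. gauss ((x - k0) /\<^sub>R s))"
    by (simp add: algebra_simps divide_inverse)
  then show "integrable lborel (window_hat s k0)"
    unfolding window_hat_def[abs_def] by (intro integrable_mult_right)
qed

lemma window_hat_nonneg: "0 < s \<Longrightarrow> 0 \<le> window_hat s k0 k"
  by (simp add: window_hat_def gauss_pos less_imp_le)

lemma window_hat_le: "0 < s \<Longrightarrow> window_hat s k0 (k :: 'v::euclidean_space) \<le> (sqrt (2 * pi) / s) ^ DIM('v)"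
  unfolding window_hat_def by (rule mult_left_le) (auto simp: gauss_le_1)

text \<open>The substitution \<open>a = x / s\<close> reduces the integral to the standard Gaussian
  at frequency \<open>(k - k0) / s\<close>; its Jacobian supplies the powers of
  \<open>1 / s\<close>.\<close>

lemma window_fourier:
  assumes s: "0 < s"
  shows "(LINT a|lborel. window s k0 a * fourier_char k a) = window_hat s k0 (k :: 'v::euclidean_space)"
proof -
  have eq: "window s k0 ((1/s) *\<^sub>R x) * fourier_char k ((1/s) *\<^sub>R x)
      = complex_of_real (gauss x) * fourier_char ((k - k0) /\<^sub>R s) x" for x
  proof -
    have "fourier_char ((k - k0) /\<^sub>R s) x = cnj (fourier_char k0 ((1/s) *\<^sub>R x)) * fourier_char k ((1/s) *\<^sub>R x)"
      by (simp add: fourier_char_scale fourier_char_commute[of "k - k0"] fourier_char_diff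
          fourier_char_commute[of _ k] fourier_char_commute[of _ k0] divide_inverse mult.commute)
    then show ?thesis using s by (simp add: window_def)
  qed
  have "(LINT a|lborel. window s k0 a * fourier_char k a) =
      \<bar>1/s\<bar> ^ DIM('v) *\<^sub>R (LINT x|lborel. window s k0 (0 + (1/s) *\<^sub>R x) * fourier_char k (0 + (1/s) *\<^sub>R x))"
    by (rule lborel_integral_affine) (use s in auto)
  also have "\<dots> = \<bar>1/s\<bar> ^ DIM('v) *\<^sub>R complex_of_real (sqrt (2 * pi) ^ DIM('v) * gauss ((k - k0) /\<^sub>R s))"
    by (simp only: add_0_left eq gauss_fourier)
  also have "\<dots> = window_hat s k0 k"
    using s by (simp add: window_hat_def power_divide scaleR_conv_of_real)
  finally show ?thesis .
qed

text \<open>Inversion by calculation: after centring at \<open>k0\<close> and scaling by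
  \<open>s\<close> the integrand is again a standard Gaussian times a character, whose transform is
  already known.\<close>

lemma window_inversion:
  assumes s: "0 < s"
  shows "(LINT k|lborel. complex_of_real (window_hat s k0 k) * cnj (fourier_char k x))
     = (2 * pi) ^ DIM('v) * window s k0 (x :: 'v::euclidean_space)"
proof -
  have eq: "complex_of_real (window_hat s k0 (k0 + s *\<^sub>R q)) * cnj (fourier_char (k0 + s *\<^sub>R q) x)
     = ((sqrt (2 * pi) / s) ^ DIM('v) * cnj (fourier_char k0 x)) * (complex_of_real (gauss q) * fourier_char (- (s *\<^sub>R x)) q)" for q
  proof -
    have "cnj (fourier_char (k0 + s *\<^sub>R q) x) = cnj (fourier_char k0 x) * fourier_char (- (s *\<^sub>R x)) q"
      by (simp add: fourier_char_commute[of "k0 + s *\<^sub>R q"] fourier_char_add fourier_char_uminus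
          fourier_char_commute[of x] fourier_char_scale)
    then show ?thesis using s by (simp add: window_hat_def)
  qed
  define C where "C = complex_of_real ((sqrt (2 * pi) / s) ^ DIM('v)) * cnj (fourier_char k0 x)"
  define c where "c = complex_of_real (sqrt (2 * pi) ^ DIM('v))"
  have "(LINT q|lborel. complex_of_real (window_hat s k0 (k0 + s *\<^sub>R q)) * cnj (fourier_char (k0 + s *\<^sub>R q) x))
      = (LINT q|lborel. C * (complex_of_real (gauss q) * fourier_char (- (s *\<^sub>R x)) q))"
    unfolding C_def by (intro Bochner_Integration.integral_cong refl eq)
  also have "\<dots> = C * (LINT q|lborel. complex_of_real (gauss q) * fourier_char (- (s *\<^sub>R x)) q)"
    by (rule integral_mult_right_zero)
  also have "(LINT q|lborel. complex_of_real (gauss q) * fourier_char (- (s *\<^sub>R x)) q) = c * complex_of_real (gauss (s *\<^sub>R x))"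
    unfolding gauss_fourier(2)[of "- (s *\<^sub>R x)"] by (simp only: c_def of_real_mult gauss_uminus)
  finally have I: "(LINT q|lborel. complex_of_real (window_hat s k0 (k0 + s *\<^sub>R q)) * cnj (fourier_char (k0 + s *\<^sub>R q) x))
      = C * (c * complex_of_real (gauss (s *\<^sub>R x)))" .
  \<comment> \<open>One factor \<open>2 * pi\<close> per dimension: \<open>s\<close> is the
    Jacobian, \<open>sqrt (2 * pi) / s\<close> comes from \<open>window_hat\<close>, and the last
    root from the Gaussian transform.\<close>
  have "s * (sqrt (2 * pi) / s) * sqrt (2 * pi) = 2 * pi"
    using s by simp
  then have "s ^ DIM('v) * (sqrt (2 * pi) / s) ^ DIM('v) * sqrt (2 * pi) ^ DIM('v) = (2 * pi) ^ DIM('v)"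
    by (metis power_mult_distrib)
  then have p: "complex_of_real (s ^ DIM('v)) * complex_of_real ((sqrt (2 * pi) / s) ^ DIM('v)) * c = (2 * pi) ^ DIM('v)"
    unfolding c_def of_real_mult[symmetric] by simp
  have "(LINT k|lborel. complex_of_real (window_hat s k0 k) * cnj (fourier_char k x)) =
      \<bar>s\<bar> ^ DIM('v) *\<^sub>R (LINT q|lborel. complex_of_real (window_hat s k0 (k0 + s *\<^sub>R q)) * cnj (fourier_char (k0 + s *\<^sub>R q) x))"
    by (rule lborel_integral_affine) (use s in auto)
  also have "\<dots> = \<bar>s\<bar> ^ DIM('v) *\<^sub>R (C * (c * complex_of_real (gauss (s *\<^sub>R x))))"
    by (simp only: I)
  also have "\<dots> = (complex_of_real (s ^ DIM('v)) * complex_of_real ((sqrt (2 * pi) / s) ^ DIM('v)) * c) * window s k0 x"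
    using s by (simp add: C_def window_def scaleR_conv_of_real)
  finally show ?thesis unfolding p .
qed

section \<open>Test functions, correlations and smoothing by windows\<close>

lemma bounded_test_funE:
  assumes "bounded_test_fun f"
  obtains C R where "f \<in> borel_measurable borel" "0 \<le> C" "0 \<le> R" "\<And>x. \<bar>f x\<bar> \<le> C"
    "\<And>x. f x \<noteq> 0 \<Longrightarrow> norm x \<le> R"
proof -
  obtain C where "\<And>x. \<bar>f x\<bar> \<le> C"
    using assms unfolding bounded_test_fun_def bounded_iff by auto
  moreover obtain R where "\<And>x. f x \<noteq> 0 \<Longrightarrow> norm x \<le> R"
    using assms unfolding bounded_test_fun_def bounded_iff by auto
  ultimately show thesis
    using assms that[of "max 0 C" "max 0 R"] by (fastforce simp: bounded_test_fun_def intro: max.coboundedI2)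
qed

lemma bounded_test_funI:
  assumes "f \<in> borel_measurable borel" "\<And>x. \<bar>f x\<bar> \<le> C" "\<And>x. f x \<noteq> 0 \<Longrightarrow> norm x \<le> R"
  shows "bounded_test_fun f"
  using assms unfolding bounded_test_fun_def bounded_iff by auto

lemma integrable_indicator_cball: "integrable lborel (indicator (cball (0::'v::euclidean_space) R) :: 'v \<Rightarrow> real)"
  by (rule integrable_real_indicator) (simp, rule emeasure_bounded_finite, simp)

lemma bounded_test_fun_integrable:
  fixes f :: "'v::euclidean_space \<Rightarrow> real"
  assumes "bounded_test_fun f" shows "integrable lborel f"
proof -
  obtain C R where f: "f \<in> borel_measurable borel" "0 \<le> C" "\<And>x. \<bar>f x\<bar> \<le> C" "\<And>x. f x \<noteq> 0 \<Longrightarrow> norm x \<le> R"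
    using assms by (rule bounded_test_funE) blast
  show ?thesis
  proof (rule Bochner_Integration.integrable_bound)
    show "integrable lborel (\<lambda>x. C * indicator (cball (0::'v) R) x)"
      by (intro integrable_mult_right integrable_indicator_cball)
    show "AE x in lborel. norm (f x) \<le> norm (C * indicator (cball 0 R) x)"
      using f by (intro AE_I2) (force simp: indicator_def)
  qed (use f in auto)
qed

text \<open>If the product is nonzero, \<open>x\<close> and \<open>x - y\<close> lie in balls of
  radius \<open>R\<close> and \<open>R'\<close>, hence \<open>y\<close> lies in a ball of radius
  \<open>R + R'\<close>. The bound has the product form in \<open>x\<close> and \<open>y\<close>
  that the interchange of integrals requires.\<close>

lemma correlation_kernel_bound:
  fixes f g :: "'v::euclidean_space \<Rightarrow> real"
  assumes "\<And>x. \<bar>g x\<bar> \<le> C" "\<And>x. f x \<noteq> 0 \<Longrightarrow> norm x \<le> R" "\<And>x. g x \<noteq> 0 \<Longrightarrow> norm x \<le> R'"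
  shows "\<bar>f x * g (x - y)\<bar> \<le> \<bar>f x\<bar> * (C * indicator (cball 0 (R + R')) y)"
proof (cases "f x * g (x - y) = 0")
  case False
  then have "norm x \<le> R" "norm (x - y) \<le> R'" using assms by auto
  then have "norm y \<le> R + R'" using norm_triangle_ineq4[of x "x - y"] by simp
  then show ?thesis using assms(1)[of "x - y"] by (simp add: abs_mult mult_left_mono)
next
  case True
  have "0 \<le> C" using assms(1)[of 0] by linarith
  then show ?thesis unfolding True by simp
qed

lemma bounded_test_fun_correlation:
  fixes f g :: "'v::euclidean_space \<Rightarrow> real"
  assumes f: "bounded_test_fun f" and g: "bounded_test_fun g"
  shows "bounded_test_fun (correlation f g)"
proof -
  obtain C R where F: "f \<in> borel_measurable borel" "0 \<le> C" "\<And>x. \<bar>f x\<bar> \<le> C" "\<And>x. f x \<noteq> 0 \<Longrightarrow> norm x \<le> R"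
    using f by (rule bounded_test_funE) blast
  obtain C' R' where G: "g \<in> borel_measurable borel" "0 \<le> C'" "\<And>x. \<bar>g x\<bar> \<le> C'" "\<And>x. g x \<noteq> 0 \<Longrightarrow> norm x \<le> R'"
    using g by (rule bounded_test_funE) blast
  note [measurable] = F(1) G(1)
  note bound = correlation_kernel_bound[where f=f and g=g and C=C' and R=R and R'=R', OF G(3) F(4) G(4)]
  have fi: "integrable lborel f" using f by (rule bounded_test_fun_integrable)
  have le: "\<bar>f x * g (x - y)\<bar> \<le> C' * \<bar>f x\<bar>" for x y
    using mult_left_mono[OF G(3)[of "x - y"], of "\<bar>f x\<bar>"] by (simp add: abs_mult mult.commute)
  have int: "integrable lborel (\<lambda>x. f x * g (x - y))" for y
  proof (rule Bochner_Integration.integrable_bound)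
    show "integrable lborel (\<lambda>x. C' * f x)" using fi by simp
    show "AE x in lborel. norm (f x * g (x - y)) \<le> norm (C' * f x)"
      using G(2) le by (intro AE_I2) (simp add: abs_mult)
  qed auto
  show ?thesis
  proof (rule bounded_test_funI)
    show "correlation f g \<in> borel_measurable borel"
      unfolding correlation_def[abs_def] by measurable
    show "\<bar>correlation f g y\<bar> \<le> C' * (LINT x|lborel. \<bar>f x\<bar>)" for y
    proof -
      have "\<bar>correlation f g y\<bar> \<le> (LINT x|lborel. \<bar>f x * g (x - y)\<bar>)"
        unfolding correlation_def by (rule integral_abs_bound)
      also have "\<dots> \<le> (LINT x|lborel. C' * \<bar>f x\<bar>)"
        using int[of y] fi le by (intro integral_mono) auto
      finally show ?thesis by simp
    qed
    show "norm y \<le> R + R'" if "correlation f g y \<noteq> 0" for y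
    proof (rule ccontr)
      assume "\<not> norm y \<le> R + R'"
      then have z: "f x * g (x - y) = 0" for x using bound[of x y] by simp
      have "correlation f g y = 0" unfolding correlation_def z by simp
      with that show False by simp
    qed
  qed
qed

text \<open>Correlation is convolution with the reflection of \<open>g\<close>. Substituting
  \<open>x - y\<close> for \<open>y\<close> separates the two transforms, and the second one is
  conjugated because \<open>g\<close> is real.\<close>

lemma fourier_fun_correlation:
  fixes f g :: "'v::euclidean_space \<Rightarrow> real"
  assumes f: "bounded_test_fun f" and g: "bounded_test_fun g"
  shows "fourier_fun (correlation f g) k = fourier_fun f k * cnj (fourier_fun g k)"
proof -
  obtain C R where F: "f \<in> borel_measurable borel" "0 \<le> C" "\<And>x. \<bar>f x\<bar> \<le> C" "\<And>x. f x \<noteq> 0 \<Longrightarrow> norm x \<le> R"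
    using f by (rule bounded_test_funE) blast
  obtain C' R' where G: "g \<in> borel_measurable borel" "0 \<le> C'" "\<And>x. \<bar>g x\<bar> \<le> C'" "\<And>x. g x \<noteq> 0 \<Longrightarrow> norm x \<le> R'"
    using g by (rule bounded_test_funE) blast
  note [measurable] = F(1) G(1)
  note bound = correlation_kernel_bound[where f=f and g=g and C=C' and R=R and R'=R', OF G(3) F(4) G(4)]
  have "fourier_fun (correlation f g) k = (LINT y|lborel. LINT x|lborel. complex_of_real (f x * g (x - y)) * fourier_char k y)"
    unfolding fourier_fun_def correlation_def by (simp flip: integral_complex_of_real)
  also have "\<dots> = (LINT x|lborel. LINT y|lborel. complex_of_real (f x * g (x - y)) * fourier_char k y)"
  proof (rule integral_swap_bound[symmetric, OF _ _ _ bounded_test_fun_integrable[OF f] integrable_mult_right[where c=C', OF integrable_indicator_cball[of "R + R'"]]])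
    show "norm (complex_of_real (f x * g (x - y)) * fourier_char k y) \<le> norm (f x) * norm (C' * indicator (cball 0 (R + R')) y :: real)" for x y
      using bound[of x y] G(2) by (simp add: norm_mult abs_mult del: of_real_mult)
  qed (auto intro: sigma_finite_lborel)
  also have "\<dots> = (LINT x|lborel. complex_of_real (f x) * fourier_char k x * cnj (fourier_fun g k))"
  proof (intro Bochner_Integration.integral_cong refl)
    fix x :: 'v
    have "(LINT y|lborel. complex_of_real (f x * g (x - y)) * fourier_char k y)
        = (LINT y|lborel. complex_of_real (f x * g (x - (x - y))) * fourier_char k (x - y))"
      by (rule lborel_integral_reflect[symmetric]) measurable
    also have "\<dots> = (LINT y|lborel. (complex_of_real (f x) * fourier_char k x) * (cnj (complex_of_real (g y) * fourier_char k y)))"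
      by (intro Bochner_Integration.integral_cong refl) (simp add: fourier_char_diff)
    also have "\<dots> = (complex_of_real (f x) * fourier_char k x) * (LINT y|lborel. cnj (complex_of_real (g y) * fourier_char k y))"
      by (rule integral_mult_right_zero)
    also have "(LINT y|lborel. cnj (complex_of_real (g y) * fourier_char k y)) = cnj (fourier_fun g k)"
      unfolding fourier_fun_def by (rule Bochner_Integration.integral_cnj)
    finally show "(LINT y|lborel. complex_of_real (f x * g (x - y)) * fourier_char k y)
       = complex_of_real (f x) * fourier_char k x * cnj (fourier_fun g k)" .
  qed
  also have "\<dots> = fourier_fun f k * cnj (fourier_fun g k)"
    unfolding fourier_fun_def by (rule integral_mult_left_zero)
  finally show ?thesis .
qed

lemma correlation_translate: "correlation f (\<lambda>x. g (x + a)) y = correlation f g (y - a)"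
  by (simp add: correlation_def algebra_simps)

text \<open>Translating a test function multiplies its transform by a unimodular character and, by
  \<open>correlation_translate\<close>, shifts the correlation. Together these turn an identity for
  pairs of test functions into one for Fourier transforms of weighted measures.\<close>

lemma fourier_fun_translate:
  fixes g :: "'v::euclidean_space \<Rightarrow> real"
  assumes [measurable]: "g \<in> borel_measurable borel"
  shows "fourier_fun (\<lambda>x. g (x + a)) k = cnj (fourier_char k a) * fourier_fun g k"
proof -
  have "fourier_fun g k = (LINT x|lborel. complex_of_real (g (x + a)) * fourier_char k (x + a))"
    unfolding fourier_fun_def by (rule lborel_integral_translate[symmetric]) measurable
  also have "\<dots> = (LINT x|lborel. fourier_char k a * (complex_of_real (g (x + a)) * fourier_char k x))"
    by (simp add: fourier_char_add ac_simps)
  also have "\<dots> = fourier_char k a * fourier_fun (\<lambda>x. g (x + a)) k"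
    unfolding fourier_fun_def by (rule integral_mult_right_zero)
  finally show ?thesis
    by (simp add: mult.assoc[symmetric] complex_norm_square[symmetric] mult.commute[of "cnj _"])
qed

lemma bounded_test_fun_translate:
  fixes g :: "'v::euclidean_space \<Rightarrow> real"
  assumes "bounded_test_fun g" shows "bounded_test_fun (\<lambda>x. g (x + a))"
proof -
  obtain C R where F: "g \<in> borel_measurable borel" "0 \<le> C" "\<And>x. \<bar>g x\<bar> \<le> C" "\<And>x. g x \<noteq> 0 \<Longrightarrow> norm x \<le> R"
    using assms by (rule bounded_test_funE) blast
  note [measurable] = F(1)
  show ?thesis
  proof (rule bounded_test_funI)
    show "norm x \<le> R + norm a" if "g (x + a) \<noteq> 0" for x
      using F(4)[OF that] norm_triangle_ineq4[of "x + a" a] by simp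
  qed (use F in auto)
qed

lemma fourier_fun_measurable:
  assumes [measurable]: "f \<in> borel_measurable borel"
  shows "fourier_fun f \<in> borel_measurable borel"
proof -
  have [measurable]: "(\<lambda>(k, x). complex_of_real (f x) * fourier_char k x) \<in> borel_measurable (borel \<Otimes>\<^sub>M lborel)"
    unfolding split_beta' by measurable
  show ?thesis unfolding fourier_fun_def[abs_def] by measurable
qed

lemma norm_fourier_fun_le:
  "norm (fourier_fun f k) \<le> (LINT x|lborel. \<bar>f x\<bar>)"
proof -
  have "norm (fourier_fun f k) \<le> (LINT x|lborel. norm (complex_of_real (f x) * fourier_char k x))"
    unfolding fourier_fun_def by (rule integral_norm_bound)
  then show ?thesis by (simp add: norm_mult)
qed

text \<open>The window is replaced by its inversion integral. The majorant \<open>window_hat\<close>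
  times \<open>c\<close> permits the interchange, and the inner integral is the transform of
  \<open>c\<close>. What remains in \<open>y\<close> is a conjugated character, which is where the
  conjugate in the spectral identity originates.\<close>

lemma window_smoothing:
  fixes c :: "'v::euclidean_space \<Rightarrow> real"
  assumes c: "bounded_test_fun c" and s: "0 < s"
  shows "(2 * pi) ^ DIM('v) * (LINT a|lborel. window s k0 a * complex_of_real (c (y - a)))
    = (LINT k|lborel. complex_of_real (window_hat s k0 k) * (fourier_fun c k * cnj (fourier_char k y)))"
proof -
  have ci: "integrable lborel c" using c by (rule bounded_test_fun_integrable)
  then have [measurable]: "c \<in> borel_measurable borel" by auto
  have "(LINT a|lborel. window s k0 a * complex_of_real (c (y - a)))
      = (LINT z|lborel. window s k0 (y - z) * complex_of_real (c (y - (y - z))))"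
    by (rule lborel_integral_reflect[symmetric]) measurable
  then have "(2 * pi) ^ DIM('v) * (LINT a|lborel. window s k0 a * complex_of_real (c (y - a)))
      = (LINT z|lborel. (2 * pi) ^ DIM('v) * window s k0 (y - z) * complex_of_real (c z))"
    by (simp add: mult.assoc)
  also have "\<dots> = (LINT z|lborel. LINT k|lborel. complex_of_real (window_hat s k0 k) * cnj (fourier_char k (y - z)) * complex_of_real (c z))"
    by (intro Bochner_Integration.integral_cong refl)
      (simp only: window_inversion[OF s, symmetric] integral_mult_left_zero)
  also have "\<dots> = (LINT k|lborel. LINT z|lborel. complex_of_real (window_hat s k0 k) * cnj (fourier_char k (y - z)) * complex_of_real (c z))"
  proof (rule integral_swap_bound[OF _ _ _ ci window_integrable(2)[OF s, of k0]])
    show "(\<lambda>(z, k). complex_of_real (window_hat s k0 k) * cnj (fourier_char k (y - z)) * complex_of_real (c z))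
        \<in> borel_measurable (lborel \<Otimes>\<^sub>M lborel)"
      unfolding split_beta' by measurable
  qed (auto simp: norm_mult sigma_finite_lborel mult.commute)
  also have "\<dots> = (LINT k|lborel. complex_of_real (window_hat s k0 k) * (fourier_fun c k * cnj (fourier_char k y)))"
  proof (intro Bochner_Integration.integral_cong refl)
    fix k :: 'v
    have "(LINT z|lborel. complex_of_real (window_hat s k0 k) * cnj (fourier_char k (y - z)) * complex_of_real (c z))
      = (LINT z|lborel. (complex_of_real (window_hat s k0 k) * cnj (fourier_char k y)) * (complex_of_real (c z) * fourier_char k z))"
      by (simp add: fourier_char_diff ac_simps)
    also have "\<dots> = (complex_of_real (window_hat s k0 k) * cnj (fourier_char k y)) * fourier_fun c k"
      unfolding fourier_fun_def by (rule integral_mult_right_zero)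
    finally show "(LINT z|lborel. complex_of_real (window_hat s k0 k) * cnj (fourier_char k (y - z)) * complex_of_real (c z))
      = complex_of_real (window_hat s k0 k) * (fourier_fun c k * cnj (fourier_char k y))" by (simp add: ac_simps)
  qed
  finally show ?thesis .
qed

text \<open>Smoothing at the origin bounds the Gaussian-weighted integrals of \<open>u\<close> by a
  constant that does not depend on the width, and Fatou removes the weight. For an autocorrelation,
  \<open>u\<close> is the squared modulus of the transform of a test function, and the conclusion is
  square integrability of that transform.\<close>

lemma integrable_nonneg_fourier_fun:
  fixes c u :: "'v::euclidean_space \<Rightarrow> real"
  assumes c: "bounded_test_fun c" and u: "\<And>k. fourier_fun c k = complex_of_real (u k)" "\<And>k. 0 \<le> u k"
  shows "integrable lborel u"
proof -
  obtain C R where C: "c \<in> borel_measurable borel" "0 \<le> C" "\<And>x. \<bar>c x\<bar> \<le> C"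
    using c by (rule bounded_test_funE) blast
  note [measurable] = C(1)
  have "(\<lambda>k. Re (fourier_fun c k)) \<in> borel_measurable borel"
    using fourier_fun_measurable[OF C(1)] by measurable
  then have [measurable]: "u \<in> borel_measurable borel" by (simp add: u)
  have ub: "u k \<le> (LINT x|lborel. \<bar>c x\<bar>)" for k
    using norm_fourier_fun_le[of c k] u by simp
  have bound: "(\<integral>\<^sup>+k. ennreal (gauss (k /\<^sub>R s) * u k) \<partial>lborel) \<le> ennreal (C * (2 * pi) ^ DIM('v))" if s: "0 < s" for s
  proof -
    have wi: "integrable lborel (\<lambda>k. window_hat s 0 k * u k)"
      by (rule Bochner_Integration.integrable_bound[OF integrable_mult_right[OF window_integrable(2)[OF s, of 0], of "LINT x|lborel. \<bar>c x\<bar>"]])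
        (use mult_left_mono[OF ub window_hat_nonneg[OF s]] u(2) window_hat_nonneg[OF s] in
          \<open>auto intro!: AE_I2 simp: abs_mult mult.commute abs_of_nonneg[OF window_hat_nonneg[OF s]]\<close>)
    have "complex_of_real (LINT k|lborel. window_hat s 0 k * u k)
        = (2 * pi) ^ DIM('v) * (LINT a|lborel. window s 0 a * complex_of_real (c (0 - a)))"
      unfolding window_smoothing[OF c s] u(1) by (simp flip: integral_complex_of_real)
    also have "(LINT a|lborel. window s 0 a * complex_of_real (c (0 - a))) = complex_of_real (LINT a|lborel. gauss (s *\<^sub>R a) * c (- a))"
      by (simp add: window_def flip: integral_complex_of_real)
    finally have "complex_of_real (LINT k|lborel. window_hat s 0 k * u k)
        = complex_of_real ((2 * pi) ^ DIM('v) * (LINT a|lborel. gauss (s *\<^sub>R a) * c (- a)))"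
      by simp
    then have "(LINT k|lborel. window_hat s 0 k * u k) = (2 * pi) ^ DIM('v) * (LINT a|lborel. gauss (s *\<^sub>R a) * c (- a))"
      by (simp only: of_real_eq_iff)
    also have "\<dots> \<le> (2 * pi) ^ DIM('v) * (LINT a::'v|lborel. gauss (s *\<^sub>R a) * C)"
    proof (rule mult_left_mono, rule integral_mono)
      have gi: "integrable lborel (\<lambda>a::'v. gauss (s *\<^sub>R a))"
        using lborel_integrable_affine[OF _ integrable_gauss, of s 0] s by simp
      then show "integrable lborel (\<lambda>a::'v. gauss (s *\<^sub>R a) * C)" by simp
      then show "integrable lborel (\<lambda>a::'v. gauss (s *\<^sub>R a) * c (- a))"
        by (rule Bochner_Integration.integrable_bound)
          (use C in \<open>auto intro!: AE_I2 mult_mono simp: abs_mult\<close>)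
      show "gauss (s *\<^sub>R a) * c (- a) \<le> gauss (s *\<^sub>R a) * C" for a :: 'v
        using C(3)[of "- a"] gauss_pos[of "s *\<^sub>R a"] by (intro mult_left_mono) auto
    qed auto
    \<comment> \<open>The integral of the dilated Gaussian carries the same power of
      \<open>sqrt (2 * pi) / s\<close> as \<open>window_hat\<close>. The two cancel, and the bound
      loses its dependence on \<open>s\<close>.\<close>
    also have "(LINT a::'v|lborel. gauss (s *\<^sub>R a) * C) = (sqrt (2 * pi) / s) ^ DIM('v) * C"
    proof -
      have "(LINT a::'v|lborel. gauss a) = \<bar>s\<bar> ^ DIM('v) *\<^sub>R (LINT a::'v|lborel. gauss (0 + s *\<^sub>R a))"
        by (rule lborel_integral_affine) (use s in auto)
      then show ?thesis using s by (simp add: integral_gauss power_divide field_simps)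
    qed
    also have "(LINT k|lborel. window_hat s 0 k * u k) = (sqrt (2 * pi) / s) ^ DIM('v) * (LINT k|lborel. gauss (k /\<^sub>R s) * u k)"
      by (simp only: window_hat_def diff_zero mult.assoc integral_mult_right_zero)
    finally have "(sqrt (2 * pi) / s) ^ DIM('v) * (LINT k|lborel. gauss (k /\<^sub>R s) * u k) \<le> (sqrt (2 * pi) / s) ^ DIM('v) * (C * (2 * pi) ^ DIM('v))"
      by (simp only: ac_simps)
    moreover have "0 < (sqrt (2 * pi) / s) ^ DIM('v)" using s by simp
    ultimately have le: "(LINT k|lborel. gauss (k /\<^sub>R s) * u k) \<le> C * (2 * pi) ^ DIM('v)"
      by (rule mult_left_le_imp_le)
    have "integrable lborel (\<lambda>k. (s / sqrt (2 * pi)) ^ DIM('v) * (window_hat s 0 k * u k))"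
      using wi by simp
    moreover have "(s / sqrt (2 * pi)) ^ DIM('v) * (window_hat s 0 k * u k) = gauss (k /\<^sub>R s) * u k" for k :: 'v
      using s by (simp add: window_hat_def power_divide)
    ultimately have "integrable lborel (\<lambda>k. gauss (k /\<^sub>R s) * u k)" by simp
    then have "(\<integral>\<^sup>+k. ennreal (gauss (k /\<^sub>R s) * u k) \<partial>lborel) = ennreal (LINT k|lborel. gauss (k /\<^sub>R s) * u k)"
      by (rule nn_integral_eq_integral) (simp add: u(2) less_imp_le[OF gauss_pos])
    then show ?thesis using le by (simp add: ennreal_leI)
  qed
  \<comment> \<open>The widths \<open>Suc n\<close> tend to infinity, so the weights tend to
    \<open>1\<close> pointwise.\<close>
  have lim: "(\<lambda>n. ennreal (gauss (k /\<^sub>R real (Suc n)) * u k)) \<longlonglongrightarrow> ennreal (u k)" for k :: 'v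
  proof -
    have L: "(\<lambda>n. inverse (real (Suc n)) *\<^sub>R k) \<longlonglongrightarrow> 0 *\<^sub>R k"
      by (intro tendsto_intros LIMSEQ_inverse_real_of_nat)
    have "(\<lambda>n. exp (- ((k /\<^sub>R real (Suc n)) \<bullet> (k /\<^sub>R real (Suc n))) / 2) * u k) \<longlonglongrightarrow> exp (- ((0 *\<^sub>R k) \<bullet> (0 *\<^sub>R k)) / 2) * u k"
      by (rule tendsto_mult[OF tendsto_exp[OF tendsto_divide[OF tendsto_minus[OF tendsto_inner[OF L L]] tendsto_const]] tendsto_const]) simp
    then show ?thesis unfolding gauss_def by (intro tendsto_ennrealI) simp
  qed
  have "(\<integral>\<^sup>+k. ennreal (u k) \<partial>lborel) = (\<integral>\<^sup>+k. liminf (\<lambda>n. ennreal (gauss (k /\<^sub>R real (Suc n)) * u k)) \<partial>lborel)"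
    by (intro nn_integral_cong) (rule lim_imp_Liminf[OF trivial_limit_sequentially lim, symmetric])
  also have "\<dots> \<le> liminf (\<lambda>n. \<integral>\<^sup>+k. ennreal (gauss (k /\<^sub>R real (Suc n)) * u k) \<partial>lborel)"
    by (rule nn_integral_liminf) measurable
  also have "\<dots> \<le> liminf (\<lambda>n::nat. ennreal (C * (2 * pi) ^ DIM('v)))"
    by (intro Liminf_mono always_eventually allI bound) auto
  also have "\<dots> < \<infinity>" by (simp add: Liminf_const)
  finally show ?thesis
    using u(2) by (intro integrableI_bounded) (auto simp: abs_of_nonneg)
qed

section \<open>Uniqueness of measures from Gaussian averages\<close>

text \<open>Closed sets form a generator stable under intersections, and the indicator of a nonempty
  closed set is the pointwise limit of the continuous functions
  \<open>max 0 (1 - real n * infdist x A)\<close>.\<close>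

lemma finite_measure_eqI_continuous:
  fixes M N :: "'v::metric_space measure"
  assumes fin: "finite_measure M" "finite_measure N" and sets: "sets M = sets borel" "sets N = sets borel"
    and eq: "\<And>h. continuous_on UNIV h \<Longrightarrow> (\<And>x. 0 \<le> h x) \<Longrightarrow> (\<And>x. h x \<le> 1) \<Longrightarrow>
      (LINT x|M. h x) = (LINT x|N. h x :: real)"
  shows "M = N"
proof -
  interpret M: finite_measure M by fact
  interpret N: finite_measure N by fact
  note [measurable_cong] = sets
  have closed: "emeasure M A = emeasure N A" if "closed A" for A
  \<comment> \<open>The empty set is split off because \<open>infdist x {}\<close> is
    \<open>0\<close> by convention, which would make every \<open>h n\<close> constantly
    \<open>1\<close>.\<close>
  proof (cases "A = {}")
    case False
    define h where "h n x = max 0 (1 - real n * infdist x A)" for n x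
    have h: "continuous_on UNIV (h n)" "0 \<le> h n x" "h n x \<le> 1" for n x
      unfolding h_def[abs_def] by (auto intro!: continuous_intros infdist_nonneg mult_nonneg_nonneg)
    have [measurable]: "h n \<in> borel_measurable borel" for n
      using h by (intro borel_measurable_continuous_onI)
    have lim: "(\<lambda>n. h n x) \<longlonglongrightarrow> indicator A x" for x
    proof (cases "x \<in> A")
      case True
      then show ?thesis by (simp add: h_def)
    next
      case False
      then have pos: "0 < infdist x A"
        using \<open>A \<noteq> {}\<close> \<open>closed A\<close> by (metis in_closed_iff_infdist_zero infdist_nonneg less_eq_real_def)
      obtain n0 :: nat where "1 < real n0 * infdist x A"
        using reals_Archimedean3[OF pos] by blast
      then have "1 - real n * infdist x A \<le> 0" if "n0 \<le> n" for n
      proof -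
        have "real n0 * infdist x A \<le> real n * infdist x A"
          using that pos by (intro mult_right_mono) auto
        with \<open>1 < real n0 * infdist x A\<close> show ?thesis by simp
      qed
      then have "eventually (\<lambda>n. h n x = 0) sequentially"
        unfolding eventually_sequentially h_def by (intro exI[of _ n0]) (auto simp: max_def intro: antisym)
      then show ?thesis
        using False by (simp add: tendsto_eventually)
    qed
    have A: "A \<in> sets borel" using that by auto
    have "(\<lambda>n. LINT x|R. h n x) \<longlonglongrightarrow> (LINT x|R. indicator A x)"
      if R: "finite_measure R" "sets R = sets borel" for R
    proof (rule integral_dominated_convergence[where w="\<lambda>_. 1"])
      show "integrable R (\<lambda>_. 1 :: real)" using R(1) by (simp add: finite_measure.integrable_const)
    qed (use lim h A R(2) in \<open>auto simp: measurable_cong_sets[OF R(2) refl]\<close>)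
    from this[OF fin(1) sets(1)] this[OF fin(2) sets(2)] eq[OF h]
    have "(LINT x|M. indicator A x :: real) = (LINT x|N. indicator A x)"
      by (simp add: LIMSEQ_unique)
    then show ?thesis
      using A sets sets_eq_imp_space_eq[OF sets(1)] sets_eq_imp_space_eq[OF sets(2)]
      by (simp add: M.emeasure_eq_measure N.emeasure_eq_measure)
  qed simp
  show ?thesis
  proof (rule measure_eqI_generator_eq)
    show "Int_stable (Collect closed :: 'v set set)" by (auto simp: Int_stable_def)
    show "range (\<lambda>_::nat. UNIV :: 'v set) \<subseteq> Collect closed" "(\<Union>i::nat. UNIV :: 'v set) = UNIV" by auto
    show "sets M = sigma_sets UNIV (Collect closed)" "sets N = sigma_sets UNIV (Collect closed)"
      by (simp_all add: sets borel_eq_closed)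
  qed (use closed in \<open>auto simp: M.emeasure_eq_measure\<close>)
qed

lemma lborel_nn_integral_affine:
  fixes f :: "'v::euclidean_space \<Rightarrow> ennreal"
  assumes [measurable]: "f \<in> borel_measurable borel" and c: "c \<noteq> 0"
  shows "(\<integral>\<^sup>+x. f x \<partial>lborel) = ennreal (\<bar>c\<bar> ^ DIM('v)) * (\<integral>\<^sup>+x. f (t + c *\<^sub>R x) \<partial>lborel)"
  by (subst lborel_affine[OF c, of t]) (simp add: nn_integral_density nn_integral_distr nn_integral_cmult)

text \<open>A continuous \<open>h\<close> with values between \<open>0\<close> and \<open>1\<close>
  is averaged by a Gaussian of width \<open>s\<close>. By Tonelli, the integral of this average
  depends on the measure only through the Gaussian averages in the hypothesis; as \<open>s\<close>
  tends to \<open>0\<close> the average tends to a fixed positive multiple of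
  \<open>h\<close>.\<close>

lemma finite_measure_eqI_gauss:
  fixes M N :: "'v::euclidean_space measure"
  assumes fin: "finite_measure M" "finite_measure N" and sets: "sets M = sets borel" "sets N = sets borel"
    and eq: "\<And>s k0. 0 < s \<Longrightarrow> (LINT k|M. gauss ((k - k0) /\<^sub>R s)) = (LINT k|N. gauss ((k - k0) /\<^sub>R s))"
  shows "M = N"
proof (rule finite_measure_eqI_continuous[OF fin sets])
  fix h :: "'v \<Rightarrow> real"
  assume hc: "continuous_on UNIV h" and h: "\<And>x. 0 \<le> h x" "\<And>x. h x \<le> 1"
  have [measurable]: "h \<in> borel_measurable borel" using hc by (rule borel_measurable_continuous_onI)
  \<comment> \<open>The Gaussian is kept fixed and the argument of \<open>h\<close> is scaled, so
    continuity of \<open>h\<close> gives the limit for small \<open>s\<close> with the majorant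
    \<open>gauss\<close>.\<close>
  define H where "H s k = (LINT q|lborel. gauss q * h (k + s *\<^sub>R q))" for s k
  define Z where "Z = (LINT q|lborel. gauss (q :: 'v))"
  have Zpos: "0 < Z" by (simp add: Z_def integral_gauss)
  have gh: "\<bar>gauss q * h x\<bar> \<le> gauss q" for q x :: 'v
    by (simp add: abs_mult abs_of_nonneg[OF h(1)] abs_of_pos[OF gauss_pos] mult_left_le h less_imp_le[OF gauss_pos])
  have gi: "integrable lborel (\<lambda>q. gauss q * h (k + s *\<^sub>R q))" for s k
    by (rule Bochner_Integration.integrable_bound[OF integrable_gauss])
      (use gh in \<open>auto intro!: AE_I2 intro: order_trans[OF _ abs_ge_self]\<close>)
  have H_meas [measurable]: "H s \<in> borel_measurable borel" for s
    unfolding H_def[abs_def] by measurable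
  have H0: "0 \<le> H s k" for s k
    unfolding H_def by (intro integral_nonneg_AE AE_I2) (simp add: h(1) less_imp_le[OF gauss_pos])
  have H1: "H s k \<le> Z" for s k
    unfolding H_def Z_def using gi integrable_gauss h gauss_pos
    by (intro integral_mono) (auto intro!: mult_left_le simp: less_imp_le[OF gauss_pos])
  \<comment> \<open>Substituting \<open>q = (x - k) / s\<close> moves \<open>k\<close> out of
    \<open>h\<close> into the Gaussian, which is even, so its argument may be written as
    \<open>(k - x) / s\<close>.\<close>
  have smooth: "ennreal (H s k) = ennreal (\<bar>1/s\<bar> ^ DIM('v)) * (\<integral>\<^sup>+x. ennreal (gauss ((k - x) /\<^sub>R s)) * ennreal (h x) \<partial>lborel)"
    if s: "0 < s" for s k
  proof -
    have "ennreal (H s k) = (\<integral>\<^sup>+q. ennreal (gauss q * h (k + s *\<^sub>R q)) \<partial>lborel)"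
      unfolding H_def by (rule nn_integral_eq_integral[symmetric]) (auto simp: gi h less_imp_le[OF gauss_pos])
    also have "\<dots> = ennreal (\<bar>1/s\<bar> ^ DIM('v)) * (\<integral>\<^sup>+x. ennreal (gauss (- (k /\<^sub>R s) + (1/s) *\<^sub>R x) * h (k + s *\<^sub>R (- (k /\<^sub>R s) + (1/s) *\<^sub>R x))) \<partial>lborel)"
      by (rule lborel_nn_integral_affine) (use s in auto)
    also have "(\<integral>\<^sup>+x. ennreal (gauss (- (k /\<^sub>R s) + (1/s) *\<^sub>R x) * h (k + s *\<^sub>R (- (k /\<^sub>R s) + (1/s) *\<^sub>R x))) \<partial>lborel)
      = (\<integral>\<^sup>+x. ennreal (gauss ((k - x) /\<^sub>R s)) * ennreal (h x) \<partial>lborel)"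
    proof (intro nn_integral_cong)
      fix x :: 'v
      have "- (k /\<^sub>R s) + (1/s) *\<^sub>R x = - ((k - x) /\<^sub>R s)" "k + s *\<^sub>R (- ((k - x) /\<^sub>R s)) = x"
        using s by (simp_all add: algebra_simps divide_inverse)
      then show "ennreal (gauss (- (k /\<^sub>R s) + (1/s) *\<^sub>R x) * h (k + s *\<^sub>R (- (k /\<^sub>R s) + (1/s) *\<^sub>R x)))
        = ennreal (gauss ((k - x) /\<^sub>R s)) * ennreal (h x)"
        by (simp only: gauss_uminus) (simp add: ennreal_mult h less_imp_le[OF gauss_pos])
    qed
    finally show ?thesis .
  qed
  \<comment> \<open>The integrals are taken in \<open>ennreal\<close> because \<open>h\<close> may
    have infinite Lebesgue integral; Tonelli then exchanges them freely.\<close>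
  have HR: "ennreal (LINT k|R. H s k) = ennreal (\<bar>1/s\<bar> ^ DIM('v)) *
        (\<integral>\<^sup>+x. ennreal (LINT k|R. gauss ((k - x) /\<^sub>R s)) * ennreal (h x) \<partial>lborel)"
    if s: "0 < s" and R: "finite_measure R" and [measurable_cong]: "sets R = sets borel" for s R
  proof -
    interpret R: finite_measure R by fact
    interpret pair_sigma_finite R "lborel :: 'v measure" ..
    have "ennreal (LINT k|R. H s k) = (\<integral>\<^sup>+k. ennreal (H s k) \<partial>R)"
      using H0 H1 by (intro nn_integral_eq_integral[symmetric] R.integrable_const_bound[where B=Z] AE_I2) auto
    also have "\<dots> = ennreal (\<bar>1/s\<bar> ^ DIM('v)) * (\<integral>\<^sup>+k. \<integral>\<^sup>+x. ennreal (gauss ((k - x) /\<^sub>R s)) * ennreal (h x) \<partial>lborel \<partial>R)"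
      unfolding smooth[OF s] by (rule nn_integral_cmult) measurable
    also have "(\<integral>\<^sup>+k. \<integral>\<^sup>+x. ennreal (gauss ((k - x) /\<^sub>R s)) * ennreal (h x) \<partial>lborel \<partial>R)
       = (\<integral>\<^sup>+x. \<integral>\<^sup>+k. ennreal (gauss ((k - x) /\<^sub>R s)) * ennreal (h x) \<partial>R \<partial>lborel)"
      by (rule Fubini'[symmetric]) measurable
    also have "\<dots> = (\<integral>\<^sup>+x. ennreal (LINT k|R. gauss ((k - x) /\<^sub>R s)) * ennreal (h x) \<partial>lborel)"
    proof (intro nn_integral_cong)
      fix x :: 'v
      have "(\<integral>\<^sup>+k. ennreal (gauss ((k - x) /\<^sub>R s)) \<partial>R) = ennreal (LINT k|R. gauss ((k - x) /\<^sub>R s))"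
        using gauss_le_1 less_imp_le[OF gauss_pos]
        by (intro nn_integral_eq_integral R.integrable_const_bound[where B=1] AE_I2) auto
      then show "(\<integral>\<^sup>+k. ennreal (gauss ((k - x) /\<^sub>R s)) * ennreal (h x) \<partial>R) = ennreal (LINT k|R. gauss ((k - x) /\<^sub>R s)) * ennreal (h x)"
        by (simp add: nn_integral_multc)
    qed
    finally show ?thesis .
  qed
  have Heq: "(LINT k|M. H s k) = (LINT k|N. H s k)" if s: "0 < s" for s
  proof -
    have "ennreal (LINT k|M. H s k) = ennreal (LINT k|N. H s k)"
      unfolding HR[OF s fin(1) sets(1)] HR[OF s fin(2) sets(2)] eq[OF s] ..
    then show ?thesis using H0 by (subst (asm) ennreal_inj) (auto intro!: integral_nonneg_AE)
  qed
  have Hlim: "(\<lambda>n. H (inverse (real (Suc n))) k) \<longlonglongrightarrow> Z * h k" for k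
  proof -
    have "(\<lambda>n. LINT q|lborel. gauss q * h (k + inverse (real (Suc n)) *\<^sub>R q)) \<longlonglongrightarrow> (LINT q::'v|lborel. gauss q * h k)"
    proof (rule integral_dominated_convergence[where w=gauss])
      show "AE q::'v in lborel. (\<lambda>n. gauss q * h (k + inverse (real (Suc n)) *\<^sub>R q)) \<longlonglongrightarrow> gauss q * h k"
      proof (intro AE_I2 tendsto_mult_left)
        fix q :: 'v
        have "(\<lambda>n. k + inverse (real (Suc n)) *\<^sub>R q) \<longlonglongrightarrow> k + 0 *\<^sub>R q"
          by (intro tendsto_intros LIMSEQ_inverse_real_of_nat)
        then have "(\<lambda>n. k + inverse (real (Suc n)) *\<^sub>R q) \<longlonglongrightarrow> k" by simp
        moreover have "isCont h k" using hc by (simp add: continuous_on_eq_continuous_at)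
        ultimately show "(\<lambda>n. h (k + inverse (real (Suc n)) *\<^sub>R q)) \<longlonglongrightarrow> h k"
          by (rule isCont_tendsto_compose[rotated])
      qed
      show "AE q in lborel. norm (gauss q * h (k + inverse (real (Suc n)) *\<^sub>R q)) \<le> gauss q" for n
        using gh by (intro AE_I2) simp
    qed (auto simp: integrable_gauss)
    then show ?thesis by (simp add: H_def Z_def)
  qed
  have "(\<lambda>n. LINT k|R. H (inverse (real (Suc n))) k) \<longlonglongrightarrow> (LINT k|R. Z * h k)"
    if R: "finite_measure R" and [measurable_cong]: "sets R = sets borel" for R
  proof (rule integral_dominated_convergence[where w="\<lambda>_. Z"])
    show "integrable R (\<lambda>_. Z)" using R by (simp add: finite_measure.integrable_const)
  qed (use Hlim H0 H1 in \<open>auto intro!: AE_I2\<close>)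
  note L = this[OF fin(1) sets(1)] this[OF fin(2) sets(2)]
  have "(LINT k|M. Z * h k) = (LINT k|N. Z * h k)"
    using L(1) by (rule LIMSEQ_unique) (subst Heq, simp, rule L(2))
  then show "(LINT k|M. h k) = (LINT k|N. h k)"
    using Zpos by simp
qed

text \<open>The signed density is split into \<open>max 0 (w k)\<close> and
  \<open>max 0 (- w k)\<close>. Moving the negative terms across leaves two finite measures with
  equal Gaussian averages.\<close>

lemma gauss_determines_real_density:
  fixes M1 M2 :: "'v::euclidean_space measure" and w :: "'v \<Rightarrow> real"
  assumes fin: "finite_measure M1" "finite_measure M2" and sets: "sets M1 = sets borel" "sets M2 = sets borel"
    and w: "integrable lborel w"
    and eq: "\<And>s k0. 0 < s \<Longrightarrow> (LINT k|M1. gauss ((k - k0) /\<^sub>R s)) - (LINT k|M2. gauss ((k - k0) /\<^sub>R s))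
        = (LINT k|lborel. gauss ((k - k0) /\<^sub>R s) * w k)"
    and B: "B \<in> sets borel"
  shows "measure M1 B - measure M2 B = (LINT k|lborel. indicator B k * w k)"
proof -
  define D where "D v = density lborel (\<lambda>k::'v. ennreal (max 0 (v k)))" for v :: "'v \<Rightarrow> real"
  have D: "finite_measure (D v)" "sets (D v) = sets borel"
    "\<And>g. g \<in> borel_measurable borel \<Longrightarrow> (LINT k|D v. g k) = (LINT k|lborel. max 0 (v k) * g k :: real)"
    if v: "integrable lborel v" for v
  proof -
    have [measurable]: "v \<in> borel_measurable borel" using v by auto
    show "sets (D v) = sets borel" by (simp add: D_def)
    have i: "integrable lborel (\<lambda>k. max 0 (v k))"
      using v by (intro integrable_max) auto
    have "(\<integral>\<^sup>+k. ennreal (max 0 (v k)) \<partial>lborel) < \<infinity>"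
      using i by (subst nn_integral_eq_integral) auto
    then show "finite_measure (D v)"
      by (intro finite_measureI) (simp add: D_def emeasure_density)
    show "(LINT k|D v. g k) = (LINT k|lborel. max 0 (v k) * g k)" if "g \<in> borel_measurable borel" for g :: "'v \<Rightarrow> real"
      using that unfolding D_def by (subst integral_density) auto
  qed
  have mw: "integrable lborel (\<lambda>k. - w k)" using w by simp
  have [measurable]: "w \<in> borel_measurable borel" using w by auto
  have split: "(LINT k|D w. g k) - (LINT k|D (\<lambda>k. - w k). g k) = (LINT k|lborel. g k * w k)"
    if [measurable]: "g \<in> borel_measurable borel" and g: "\<And>k. \<bar>g k\<bar> \<le> 1" for g
  proof -
    have i: "integrable lborel (\<lambda>k. max 0 (v k) * g k)" if "integrable lborel v" for v
    proof (rule Bochner_Integration.integrable_bound[OF that])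
      have [measurable]: "v \<in> borel_measurable borel" using that by auto
      show "(\<lambda>k. max 0 (v k) * g k) \<in> borel_measurable lborel" by measurable
      show "AE k in lborel. norm (max 0 (v k) * g k) \<le> norm (v k)"
        using mult_mono[of "max 0 (v _)" "\<bar>v _\<bar>" "\<bar>g _\<bar>" 1] g by (intro AE_I2) (simp add: abs_mult)
    qed
    have "(LINT k|D w. g k) - (LINT k|D (\<lambda>k. - w k). g k)
        = (LINT k|lborel. max 0 (w k) * g k - max 0 (- w k) * g k)"
      using D(3)[OF w that(1)] D(3)[OF mw that(1)] i[OF w] i[OF mw] by simp
    also have "\<dots> = (LINT k|lborel. g k * w k)"
      by (intro Bochner_Integration.integral_cong refl) (auto simp: max_def)
    finally show ?thesis .
  qed
  have add: "(LINT k|sum_measure R S. g k) = (LINT k|R. g k) + (LINT k|S. g k)"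
    if "finite_measure R" "finite_measure S" "sets R = sets borel" "sets S = sets borel"
      "g \<in> borel_measurable borel" "\<And>k. \<bar>g k\<bar> \<le> 1" for R S and g :: "'v \<Rightarrow> real"
  proof (rule integral_sum_measure)
    have m: "borel_measurable (sum_measure R S) = borel_measurable borel"
      by (rule measurable_cong_sets) (simp_all add: that)
    show "integrable (sum_measure R S) g"
      by (rule integrable_bounded_finite[where C=1])
        (simp_all add: that m finite_measure_sum_measure)
  qed (simp add: that)
  have ga: "\<bar>gauss k\<bar> \<le> 1" for k :: 'v using gauss_pos[of k] gauss_le_1[of k] by simp
  have "sum_measure M1 (D (\<lambda>k. - w k)) = sum_measure M2 (D w)"
  proof (rule finite_measure_eqI_gauss)
    fix s :: real and k0 :: 'v assume s: "0 < s"
    show "(LINT k|sum_measure M1 (D (\<lambda>k. - w k)). gauss ((k - k0) /\<^sub>R s)) = (LINT k|sum_measure M2 (D w). gauss ((k - k0) /\<^sub>R s))"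
      using eq[OF s, of k0] split[of "\<lambda>k. gauss ((k - k0) /\<^sub>R s)"] ga
      by (simp add: add D[OF w] D[OF mw] fin sets del: add.commute)
  qed (use fin sets D[OF w] D[OF mw] in \<open>auto intro!: finite_measure_sum_measure\<close>)
  then have "(LINT k|sum_measure M1 (D (\<lambda>k. - w k)). indicator B k :: real) = (LINT k|sum_measure M2 (D w). indicator B k)"
    by simp
  moreover have "(LINT k|sum_measure M1 (D (\<lambda>k. - w k)). indicator B k :: real) = measure M1 B + (LINT k|D (\<lambda>k. - w k). indicator B k)"
    using B sets sets_eq_imp_space_eq[OF sets(1)] by (subst add) (auto simp: fin D(1,2)[OF mw] indicator_def)
  moreover have "(LINT k|sum_measure M2 (D w). indicator B k :: real) = measure M2 B + (LINT k|D w. indicator B k)"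
    using B sets sets_eq_imp_space_eq[OF sets(2)] by (subst add) (auto simp: fin D(1,2)[OF w] indicator_def)
  ultimately show ?thesis
    using split[of "indicator B"] B by (simp add: indicator_def)
qed

lemma gauss_determines_density:
  fixes M1 M2 :: "'v::euclidean_space measure" and w :: "'v \<Rightarrow> complex"
  assumes fin: "finite_measure M1" "finite_measure M2" and sets: "sets M1 = sets borel" "sets M2 = sets borel"
    and w: "integrable lborel w"
    and eq: "\<And>s k0. 0 < s \<Longrightarrow>
      complex_of_real ((LINT k|M1. gauss ((k - k0) /\<^sub>R s)) - (LINT k|M2. gauss ((k - k0) /\<^sub>R s)))
        = (LINT k|lborel. complex_of_real (gauss ((k - k0) /\<^sub>R s)) * w k)"
    and B: "B \<in> sets borel"
  shows "complex_of_real (measure M1 B - measure M2 B) = (LINT k:B|lborel. w k)"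
proof -
  have [measurable]: "w \<in> borel_measurable borel" using w by auto
  have i: "integrable lborel (\<lambda>k. complex_of_real (g k) * w k)"
    if [measurable]: "g \<in> borel_measurable borel" and g: "\<And>k. \<bar>g k\<bar> \<le> 1" for g
    by (rule Bochner_Integration.integrable_bound[OF w])
      (use mult_mono[of "\<bar>g _\<bar>" 1 "norm (w _)" "norm (w _)"] g in \<open>auto simp: norm_mult intro!: AE_I2\<close>)
  have ga: "\<bar>gauss k\<bar> \<le> 1" for k :: 'v using gauss_pos[of k] gauss_le_1[of k] by simp
  have ReI: "Re (LINT k|lborel. complex_of_real (g k) * w k) = (LINT k|lborel. g k * Re (w k))"
    and ImI: "Im (LINT k|lborel. complex_of_real (g k) * w k) = (LINT k|lborel. g k * Im (w k))"
    if "g \<in> borel_measurable borel" and "\<And>k. \<bar>g k\<bar> \<le> 1" for g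
    using integral_Re[OF i[OF that]] integral_Im[OF i[OF that]] by simp_all
  have "measure M1 B - measure M2 B = (LINT k|lborel. indicator B k * Re (w k))"
  proof (rule gauss_determines_real_density[OF fin sets _ _ B])
    show "integrable lborel (\<lambda>k. Re (w k))" using w by simp
    show "(LINT k|M1. gauss ((k - k0) /\<^sub>R s)) - (LINT k|M2. gauss ((k - k0) /\<^sub>R s))
        = (LINT k|lborel. gauss ((k - k0) /\<^sub>R s) * Re (w k))" if "0 < s" for s k0
      using eq[OF that, of k0, THEN arg_cong[where f=Re]] ReI[of "\<lambda>k. gauss ((k - k0) /\<^sub>R s)"] ga by simp
  qed
  \<comment> \<open>The difference of the two measures is real, so the imaginary part of
    \<open>w\<close> is the density of a zero difference, represented here as \<open>M1\<close>
    minus \<open>M1\<close>.\<close>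
  moreover have "measure M1 B - measure M1 B = (LINT k|lborel. indicator B k * Im (w k))"
  proof (rule gauss_determines_real_density[OF fin(1) fin(1) sets(1) sets(1) _ _ B])
    show "integrable lborel (\<lambda>k. Im (w k))" using w by simp
    show "(LINT k|M1. gauss ((k - k0) /\<^sub>R s)) - (LINT k|M1. gauss ((k - k0) /\<^sub>R s))
        = (LINT k|lborel. gauss ((k - k0) /\<^sub>R s) * Im (w k))" if "0 < s" for s k0
      using eq[OF that, of k0, THEN arg_cong[where f=Im]] ImI[of "\<lambda>k. gauss ((k - k0) /\<^sub>R s)"] ga by simp
  qed
  moreover have "(LINT k:B|lborel. w k) = (LINT k|lborel. complex_of_real (indicator B k) * w k)"
    by (simp add: set_lebesgue_integral_def scaleR_conv_of_real)
  ultimately show ?thesis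
    using ReI[of "indicator B"] ImI[of "indicator B"] B by (intro complex_eqI) (auto simp: indicator_def)
qed

section \<open>The spectral density of a difference of covariance measures\<close>

lemma fourier_measure_measurable:
  fixes J :: "'v::euclidean_space measure"
  assumes "finite_measure J" and [measurable_cong]: "sets J = sets borel"
  shows "fourier_measure J \<in> borel_measurable borel"
proof -
  interpret finite_measure J by fact
  have "(\<lambda>(k, x). fourier_char k x) \<in> borel_measurable (borel \<Otimes>\<^sub>M J)"
    unfolding split_beta' by measurable
  then show ?thesis unfolding fourier_measure_def[abs_def] by measurable
qed

lemma norm_fourier_measure_le:
  assumes "finite_measure J"
  shows "norm (fourier_measure J k) \<le> measure J (space J)"
proof -
  interpret finite_measure J by fact
  have "norm (fourier_measure J k) \<le> (LINT x|J. norm (fourier_char k x))"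
    unfolding fourier_measure_def by (rule integral_norm_bound)
  then show ?thesis by simp
qed

lemma cnj_fourier_measure: "(LINT y|J. cnj (fourier_char k y)) = cnj (fourier_measure J k)"
  unfolding fourier_measure_def by (rule Bochner_Integration.integral_cnj)

text \<open>In the application \<open>c\<close> is an autocorrelation and \<open>u\<close> its
  transform. The identity for the transforms at all points \<open>a\<close> is integrated against
  \<open>window s k0 a\<close>: the left side becomes a difference of Gaussian averages of
  \<open>M1\<close> and \<open>M2\<close>, the right side, by smoothing, a Gaussian average of a
  Lebesgue density. Such averages determine the difference of the two measures.\<close>

lemma spectral_identity:
  fixes M1 M2 Jp Jn :: "'v::euclidean_space measure" and c u :: "'v \<Rightarrow> real"
  assumes fin: "finite_measure M1" "finite_measure M2" "finite_measure Jp" "finite_measure Jn"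
    and sets: "sets M1 = sets borel" "sets M2 = sets borel" "sets Jp = sets borel" "sets Jn = sets borel"
    and c: "bounded_test_fun c" and u: "\<And>k. fourier_fun c k = complex_of_real (u k)" "\<And>k. 0 \<le> u k"
    and eq: "\<And>a. (LINT k|M1. fourier_char k a) - (LINT k|M2. fourier_char k a)
      = (2 * pi) ^ DIM('v) * ((LINT y|Jp. complex_of_real (c (y - a))) - (LINT y|Jn. complex_of_real (c (y - a))))"
    and B: "B \<in> sets borel"
  shows "complex_of_real (measure M1 B - measure M2 B)
    = (LINT k:B|lborel. complex_of_real (u k) * cnj (fourier_measure Jp k - fourier_measure Jn k))"
proof (rule gauss_determines_density[OF fin(1,2) sets(1,2) _ _ B])
  have ui: "integrable lborel u" using c u by (rule integrable_nonneg_fourier_fun)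
  then have [measurable]: "u \<in> borel_measurable borel" by auto
  obtain C R where C: "c \<in> borel_measurable borel" "0 \<le> C" "\<And>x. \<bar>c x\<bar> \<le> C"
    using c by (rule bounded_test_funE) blast
  note [measurable] = C(1)
  have uJ: "integrable lborel (\<lambda>k. complex_of_real (u k) * cnj (fourier_measure J k))"
    if J: "finite_measure J" "sets J = sets borel" for J :: "'v measure"
  proof (rule Bochner_Integration.integrable_bound)
    show "integrable lborel (\<lambda>k. measure J (space J) * u k)" using ui by simp
    show "(\<lambda>k. complex_of_real (u k) * cnj (fourier_measure J k)) \<in> borel_measurable lborel"
      using fourier_measure_measurable[OF J] by measurable
    show "AE k in lborel. norm (complex_of_real (u k) * cnj (fourier_measure J k)) \<le> norm (measure J (space J) * u k)"
      using mult_left_mono[OF norm_fourier_measure_le[OF J(1)] u(2)]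
      by (intro AE_I2) (simp add: norm_mult abs_mult abs_of_nonneg[OF u(2)] mult.commute)
  qed
  show "integrable lborel (\<lambda>k. complex_of_real (u k) * cnj (fourier_measure Jp k - fourier_measure Jn k))"
    using uJ[OF fin(3) sets(3)] uJ[OF fin(4) sets(4)] by (simp add: right_diff_distrib)
  fix s :: real and k0 :: 'v
  assume s: "0 < s"
  define W where "W = window s k0"
  define H where "H = window_hat s k0"
  have Wi: "integrable lborel W" and Hi: "integrable lborel H"
    using window_integrable[OF s] by (auto simp: W_def H_def)
  have [measurable]: "W \<in> borel_measurable borel" "H \<in> borel_measurable borel" by (auto simp: W_def H_def)
  have H0: "0 \<le> H k" for k unfolding H_def using s by (rule window_hat_nonneg)
  have HuJ: "integrable lborel (\<lambda>k. complex_of_real (H k) * (complex_of_real (u k) * cnj (fourier_measure J k)))"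
    if J: "finite_measure J" "sets J = sets borel" for J :: "'v measure"
  proof (rule Bochner_Integration.integrable_bound)
    show "integrable lborel (\<lambda>k. complex_of_real ((sqrt (2 * pi) / s) ^ DIM('v)) * (complex_of_real (u k) * cnj (fourier_measure J k)))"
      using uJ[OF J] by (rule integrable_mult_right)
    show "(\<lambda>k. complex_of_real (H k) * (complex_of_real (u k) * cnj (fourier_measure J k))) \<in> borel_measurable lborel"
      using fourier_measure_measurable[OF J] by measurable
    have "norm (complex_of_real (H k) * z) \<le> norm (complex_of_real ((sqrt (2 * pi) / s) ^ DIM('v)) * z)" for k z
    proof -
      have "\<bar>H k\<bar> \<le> \<bar>(sqrt (2 * pi) / s) ^ DIM('v)\<bar>"
        using window_hat_le[OF s, of k0 k] H0[of k] by (simp add: H_def)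
      then show ?thesis unfolding norm_mult norm_of_real by (rule mult_right_mono) simp
    qed
    then show "AE k in lborel. norm (complex_of_real (H k) * (complex_of_real (u k) * cnj (fourier_measure J k))) \<le>
        norm (complex_of_real ((sqrt (2 * pi) / s) ^ DIM('v)) * (complex_of_real (u k) * cnj (fourier_measure J k)))"
      by (intro AE_I2)
  qed
  \<comment> \<open>The window is integrable and \<open>M\<close> is finite, so the order may be
    changed; integrating over \<open>a\<close> first produces \<open>window_hat\<close>.\<close>
  have lhs: "integrable lborel (\<lambda>a. W a * (LINT k|M. fourier_char k a))"
    "(LINT a|lborel. W a * (LINT k|M. fourier_char k a)) = complex_of_real (LINT k|M. H k)"
    if M: "finite_measure M" and [measurable_cong]: "sets M = sets borel" for M :: "'v measure"
  proof -
    interpret finite_measure M by fact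
    interpret lp: pair_sigma_finite lborel M ..
    have m: "(\<lambda>(a, k). W a * fourier_char k a) \<in> borel_measurable (lborel \<Otimes>\<^sub>M M)"
      unfolding split_beta' by measurable
    have one: "integrable M (\<lambda>_. 1 :: real)" by simp
    have "integrable (lborel \<Otimes>\<^sub>M M) (\<lambda>(a, k). W a * fourier_char k a)"
      by (rule integrable_product_bound[OF lborel.sigma_finite_measure_axioms sigma_finite_measure_axioms m integrable_norm[OF Wi] one])
        (simp add: norm_mult)
    from lp.integrable_fst[OF this] show "integrable lborel (\<lambda>a. W a * (LINT k|M. fourier_char k a))" by simp
    have "(LINT a|lborel. W a * (LINT k|M. fourier_char k a)) = (LINT a|lborel. LINT k|M. W a * fourier_char k a)"
      by simp
    also have "\<dots> = (LINT k|M. LINT a|lborel. W a * fourier_char k a)"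
      by (rule integral_swap_bound[OF lborel.sigma_finite_measure_axioms sigma_finite_measure_axioms m integrable_norm[OF Wi] one])
        (simp add: norm_mult)
    also have "\<dots> = (LINT k|M. complex_of_real (H k))"
      unfolding W_def H_def window_fourier[OF s] ..
    finally show "(LINT a|lborel. W a * (LINT k|M. fourier_char k a)) = complex_of_real (LINT k|M. H k)"
      by simp
  qed
  have rhs: "integrable lborel (\<lambda>a. W a * (LINT y|J. complex_of_real (c (y - a))))"
    "(2 * pi) ^ DIM('v) * (LINT a|lborel. W a * (LINT y|J. complex_of_real (c (y - a))))
      = (LINT k|lborel. complex_of_real (H k) * (complex_of_real (u k) * cnj (fourier_measure J k)))"
    if J: "finite_measure J" and [measurable_cong]: "sets J = sets borel" for J :: "'v measure"
  proof -
    interpret finite_measure J by fact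
    interpret lp: pair_sigma_finite lborel J ..
    have m: "(\<lambda>(a, y). W a * complex_of_real (c (y - a))) \<in> borel_measurable (lborel \<Otimes>\<^sub>M J)"
      unfolding split_beta' by measurable
    have cC: "integrable J (\<lambda>_. C)" by simp
    have bd: "norm (W a * complex_of_real (c (y - a))) \<le> norm (norm (W a)) * norm C" for a y
      using C(2,3) by (simp add: norm_mult mult_left_mono)
    have "integrable (lborel \<Otimes>\<^sub>M J) (\<lambda>(a, y). W a * complex_of_real (c (y - a)))"
      by (rule integrable_product_bound[OF lborel.sigma_finite_measure_axioms sigma_finite_measure_axioms m integrable_norm[OF Wi] cC])
        (use bd in simp)
    from lp.integrable_fst[OF this] show "integrable lborel (\<lambda>a. W a * (LINT y|J. complex_of_real (c (y - a))))" by simp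
    have "(LINT a|lborel. W a * (LINT y|J. complex_of_real (c (y - a)))) = (LINT a|lborel. LINT y|J. W a * complex_of_real (c (y - a)))"
      by (simp only: integral_mult_right_zero)
    also have "\<dots> = (LINT y|J. LINT a|lborel. W a * complex_of_real (c (y - a)))"
      by (rule integral_swap_bound[OF lborel.sigma_finite_measure_axioms sigma_finite_measure_axioms m integrable_norm[OF Wi] cC])
        (use bd in simp)
    finally have "(2 * pi) ^ DIM('v) * (LINT a|lborel. W a * (LINT y|J. complex_of_real (c (y - a))))
        = (LINT y|J. (2 * pi) ^ DIM('v) * (LINT a|lborel. W a * complex_of_real (c (y - a))))"
      by (simp only: integral_mult_right_zero)
    also have "\<dots> = (LINT y|J. LINT k|lborel. complex_of_real (H k) * (complex_of_real (u k) * cnj (fourier_char k y)))"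
      unfolding W_def H_def window_smoothing[OF c s] u(1) ..
    \<comment> \<open>The bounded factor \<open>H\<close> is charged to the finite measure
      \<open>J\<close>, and \<open>u\<close> is the integrable majorant in the frequency variable;
      this is the use of its integrability.\<close>
    also have "\<dots> = (LINT k|lborel. LINT y|J. complex_of_real (H k) * (complex_of_real (u k) * cnj (fourier_char k y)))"
    proof (rule integral_swap_bound[OF sigma_finite_measure_axioms lborel.sigma_finite_measure_axioms])
      show "(\<lambda>(y, k). complex_of_real (H k) * (complex_of_real (u k) * cnj (fourier_char k y))) \<in> borel_measurable (J \<Otimes>\<^sub>M lborel)"
        unfolding split_beta' by measurable
      show "integrable J (\<lambda>_. (sqrt (2 * pi) / s) ^ DIM('v))" by simp
      show "integrable lborel u" by fact
      show "norm (complex_of_real (H k) * (complex_of_real (u k) * cnj (fourier_char k y))) \<le> norm ((sqrt (2 * pi) / s) ^ DIM('v)) * norm (u k)" for k y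
      proof -
        have "\<bar>H k\<bar> \<le> \<bar>(sqrt (2 * pi) / s) ^ DIM('v)\<bar>"
          using window_hat_le[OF s, of k0 k] H0[of k] by (simp add: H_def)
        then show ?thesis
          unfolding norm_mult norm_of_real complex_mod_cnj norm_fourier_char mult_1_right real_norm_def
          by (rule mult_right_mono) simp
      qed
    qed
    also have "\<dots> = (LINT k|lborel. complex_of_real (H k) * (complex_of_real (u k) * cnj (fourier_measure J k)))"
      by (simp only: integral_mult_right_zero cnj_fourier_measure)
    finally show "(2 * pi) ^ DIM('v) * (LINT a|lborel. W a * (LINT y|J. complex_of_real (c (y - a))))
      = (LINT k|lborel. complex_of_real (H k) * (complex_of_real (u k) * cnj (fourier_measure J k)))" .
  qed
  define T where "T J a = (LINT y|J. complex_of_real (c (y - a)))" for J :: "'v measure" and a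
  note rhs' = rhs[folded T_def]
  have "complex_of_real (LINT k|M1. H k) - complex_of_real (LINT k|M2. H k)
      = (LINT a|lborel. W a * ((LINT k|M1. fourier_char k a) - (LINT k|M2. fourier_char k a)))"
    unfolding right_diff_distrib using lhs[OF fin(1) sets(1)] lhs[OF fin(2) sets(2)] by simp
  also have "\<dots> = (LINT a|lborel. (2 * pi) ^ DIM('v) * (W a * T Jp a - W a * T Jn a))"
    unfolding eq T_def by (simp add: algebra_simps)
  also have "\<dots> = (2 * pi) ^ DIM('v) * ((LINT a|lborel. W a * T Jp a) - (LINT a|lborel. W a * T Jn a))"
    using rhs'(1)[OF fin(3) sets(3)] rhs'(1)[OF fin(4) sets(4)] by simp
  also have "\<dots> = (LINT k|lborel. complex_of_real (H k) * (complex_of_real (u k) * cnj (fourier_measure Jp k)))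
      - (LINT k|lborel. complex_of_real (H k) * (complex_of_real (u k) * cnj (fourier_measure Jn k)))"
    unfolding right_diff_distrib rhs'(2)[OF fin(3) sets(3)] rhs'(2)[OF fin(4) sets(4)] ..
  also have "\<dots> = (LINT k|lborel. complex_of_real (H k) * (complex_of_real (u k) * cnj (fourier_measure Jp k - fourier_measure Jn k)))"
    using HuJ[OF fin(3) sets(3)] HuJ[OF fin(4) sets(4)]
    by (simp add: right_diff_distrib)
  finally have main: "complex_of_real (LINT k|M1. H k) - complex_of_real (LINT k|M2. H k) = \<dots>" .
  \<comment> \<open>\<open>window_hat\<close> is this constant times the Gaussian. It occurs on both
    sides and is nonzero, so it divides out.\<close>
  define p where "p = (sqrt (2 * pi) / s) ^ DIM('v)"
  have p: "p \<noteq> 0" using s by (simp add: p_def)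
  have Hp: "H k = p * gauss ((k - k0) /\<^sub>R s)" for k by (simp add: H_def window_hat_def p_def)
  have "complex_of_real p * complex_of_real ((LINT k|M1. gauss ((k - k0) /\<^sub>R s)) - (LINT k|M2. gauss ((k - k0) /\<^sub>R s)))
      = complex_of_real p * (LINT k|lborel. complex_of_real (gauss ((k - k0) /\<^sub>R s)) * (complex_of_real (u k) * cnj (fourier_measure Jp k - fourier_measure Jn k)))"
    using main unfolding Hp of_real_mult mult.assoc integral_mult_right_zero of_real_diff right_diff_distrib
    by simp
  then show "complex_of_real ((LINT k|M1. gauss ((k - k0) /\<^sub>R s)) - (LINT k|M2. gauss ((k - k0) /\<^sub>R s)))
      = (LINT k|lborel. complex_of_real (gauss ((k - k0) /\<^sub>R s)) * (complex_of_real (u k) * cnj (fourier_measure Jp k - fourier_measure Jn k)))"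
    using p by simp
qed

lemma locally_finite_measure_sigma_finite:
  assumes "locally_finite_measure (\<mu> :: 'v::euclidean_space measure)"
  shows "sigma_finite_measure \<mu>"
proof
  have sets: "sets \<mu> = sets borel" and sp: "space \<mu> = UNIV"
    using assms sets_eq_imp_space_eq[of \<mu> borel] by (auto simp: locally_finite_measure_def)
  have "(\<Union>n::nat. ball 0 (real n)) = (UNIV :: 'v set)"
    using reals_Archimedean2 by auto
  moreover have "emeasure \<mu> (ball 0 (real n)) \<noteq> \<infinity>" for n
    using assms by (auto simp: locally_finite_measure_def less_top)
  ultimately show "\<exists>A. countable A \<and> A \<subseteq> sets \<mu> \<and> \<Union> A = space \<mu> \<and> (\<forall>a\<in>A. emeasure \<mu> a \<noteq> \<infinity>)"
    by (intro exI[of _ "range (\<lambda>n::nat. ball 0 (real n))"]) (auto simp: sets sp)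
qed

text \<open>An approximate unit: for positive radius it has total mass \<open>1\<close>, and its
  transform tends to \<open>1\<close> as the ball shrinks.\<close>

definition normalized_ball :: "real \<Rightarrow> 'v::euclidean_space \<Rightarrow> real" where
  "normalized_ball \<epsilon> x = indicator (ball 0 \<epsilon>) x / measure lborel (ball (0 :: 'v) \<epsilon>)"

lemma bounded_test_fun_normalized_ball: "bounded_test_fun (normalized_ball \<epsilon> :: 'v::euclidean_space \<Rightarrow> real)"
  by (rule bounded_test_funI[where C="1 / measure lborel (ball (0 :: 'v) \<epsilon>)" and R=\<epsilon>])
    (auto simp: normalized_ball_def[abs_def] indicator_def)

lemma normalized_ball_measurable [measurable]: "normalized_ball \<epsilon> \<in> borel_measurable borel"
  using bounded_test_fun_normalized_ball unfolding bounded_test_fun_def by blast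

text \<open>As the mass is \<open>1\<close>, the transform minus \<open>1\<close> is the mean of
  \<open>fourier_char k x - 1\<close> over the ball, whose modulus is at most
  \<open>norm k * norm x\<close>.\<close>

lemma fourier_normalized_ball:
  fixes k :: "'v::euclidean_space"
  assumes \<epsilon>: "0 < \<epsilon>"
  shows "norm (fourier_fun (normalized_ball \<epsilon>) k) \<le> 1"
    and "norm (fourier_fun (normalized_ball \<epsilon>) k - 1) \<le> norm k * \<epsilon>"
proof -
  define V where "V = measure lborel (ball (0 :: 'v) \<epsilon>)"
  have V: "0 < V"
    unfolding V_def using \<epsilon> by (simp add: content_ball_pos)
  have fin: "emeasure lborel (ball (0 :: 'v) \<epsilon>) < \<infinity>"
    by (rule emeasure_bounded_finite) simp
  have n: "integrable lborel (normalized_ball \<epsilon> :: 'v \<Rightarrow> real)"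
    by (rule bounded_test_fun_integrable[OF bounded_test_fun_normalized_ball])
  have i: "(LINT x::'v|lborel. normalized_ball \<epsilon> x) = 1"
    using V fin by (simp add: normalized_ball_def V_def[symmetric])
  have nn: "0 \<le> normalized_ball \<epsilon> x" for x :: 'v
    by (simp add: normalized_ball_def)
  show "norm (fourier_fun (normalized_ball \<epsilon>) k) \<le> 1"
    using norm_fourier_fun_le[of "normalized_ball \<epsilon>" k] by (simp add: nn i)
  have fi: "integrable lborel (\<lambda>x. complex_of_real (normalized_ball \<epsilon> x) * fourier_char k x)"
    by (rule Bochner_Integration.integrable_bound[OF n]) (use n in \<open>auto simp: norm_mult\<close>)
  have ci: "integrable lborel (\<lambda>x::'v. complex_of_real (normalized_ball \<epsilon> x))" using n by simp
  have "complex_of_real 1 = (LINT x::'v|lborel. complex_of_real (normalized_ball \<epsilon> x))"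
    unfolding i[symmetric] by simp
  then have "fourier_fun (normalized_ball \<epsilon>) k - 1 = (LINT x|lborel. complex_of_real (normalized_ball \<epsilon> x) * fourier_char k x - complex_of_real (normalized_ball \<epsilon> x))"
    unfolding fourier_fun_def using fi ci by simp
  then have "norm (fourier_fun (normalized_ball \<epsilon>) k - 1) \<le> (LINT x|lborel. norm (complex_of_real (normalized_ball \<epsilon> x) * fourier_char k x - complex_of_real (normalized_ball \<epsilon> x)))"
    by (simp only: integral_norm_bound)
  also have "\<dots> \<le> (LINT x::'v|lborel. (norm k * \<epsilon>) * normalized_ball \<epsilon> x)"
  proof (rule integral_mono)
    show "integrable lborel (\<lambda>x. norm (complex_of_real (normalized_ball \<epsilon> x) * fourier_char k x - complex_of_real (normalized_ball \<epsilon> x)))"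
      using fi ci by (intro integrable_norm Bochner_Integration.integrable_diff)
    show "integrable lborel (\<lambda>x::'v. (norm k * \<epsilon>) * normalized_ball \<epsilon> x)" using n by simp
    fix x :: 'v
    have "norm (complex_of_real (normalized_ball \<epsilon> x) * fourier_char k x - complex_of_real (normalized_ball \<epsilon> x))
        = normalized_ball \<epsilon> x * norm (fourier_char k x - 1)"
    proof -
      have "complex_of_real (normalized_ball \<epsilon> x) * fourier_char k x - complex_of_real (normalized_ball \<epsilon> x)
          = complex_of_real (normalized_ball \<epsilon> x) * (fourier_char k x - 1)"
        by (simp add: algebra_simps)
      then show ?thesis using nn[of x] by (simp add: norm_mult)
    qed
    also have "\<dots> \<le> (norm k * \<epsilon>) * normalized_ball \<epsilon> x"
    proof (cases "x \<in> ball 0 \<epsilon>")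
      case True
      have "norm (fourier_char k x - 1) \<le> \<bar>k \<bullet> x\<bar>"
        using iexp_approx1[of "- (k \<bullet> x)" 0] by (simp add: fourier_char_def)
      also have "\<dots> \<le> norm k * norm x" by (rule Cauchy_Schwarz_ineq2)
      also have "\<dots> \<le> norm k * \<epsilon>" using True by (intro mult_left_mono) auto
      finally show ?thesis using nn[of x] by (simp add: mult.commute mult_left_mono)
    qed (simp add: normalized_ball_def)
    finally show "norm (complex_of_real (normalized_ball \<epsilon> x) * fourier_char k x - complex_of_real (normalized_ball \<epsilon> x))
        \<le> (norm k * \<epsilon>) * normalized_ball \<epsilon> x" .
  qed
  also have "\<dots> = norm k * \<epsilon>" by (simp add: i)
  finally show "norm (fourier_fun (normalized_ball \<epsilon>) k - 1) \<le> norm k * \<epsilon>" .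
qed

text \<open>The spectral measures weighted by \<open>u n\<close>, the squared modulus of the
  transform of a small normalised ball, are finite, so \<open>spectral_identity\<close> applies to
  them. On the bounded set \<open>B\<close> the unweighted measures are finite as well, and the
  weights lie between \<open>0\<close> and \<open>1\<close>; dominated convergence therefore removes
  them.\<close>

lemma spectral_density:
  fixes \<sigma>1 \<sigma>2 Jp Jn :: "'v::euclidean_space measure"
  assumes lf: "locally_finite_measure \<sigma>1" "locally_finite_measure \<sigma>2"
    and fin: "finite_measure Jp" "finite_measure Jn" and sets: "sets Jp = sets borel" "sets Jn = sets borel"
    and int: "\<And>f g. bounded_test_fun f \<Longrightarrow> bounded_test_fun g \<Longrightarrow> integrable \<sigma>1 (\<lambda>k. fourier_fun f k * cnj (fourier_fun g k))"
      "\<And>f g. bounded_test_fun f \<Longrightarrow> bounded_test_fun g \<Longrightarrow> integrable \<sigma>2 (\<lambda>k. fourier_fun f k * cnj (fourier_fun g k))"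
    and eq: "\<And>f g. bounded_test_fun f \<Longrightarrow> bounded_test_fun g \<Longrightarrow>
      (LINT k|\<sigma>1. fourier_fun f k * cnj (fourier_fun g k)) - (LINT k|\<sigma>2. fourier_fun f k * cnj (fourier_fun g k))
      = (2 * pi) ^ DIM('v) * complex_of_real ((LINT y|Jp. correlation f g y) - (LINT y|Jn. correlation f g y))"
    and B: "B \<in> sets borel" "bounded B"
  shows "complex_of_real (measure \<sigma>1 B) = complex_of_real (measure \<sigma>2 B)
      + (LINT k:B|lborel. fourier_measure Jp k - fourier_measure Jn k)"
proof -
  define e where "e k = cnj (fourier_measure Jp k - fourier_measure Jn k)" for k
  have [measurable]: "e \<in> borel_measurable borel"
    unfolding e_def[abs_def]
    using fourier_measure_measurable[OF fin(1) sets(1)] fourier_measure_measurable[OF fin(2) sets(2)] by measurable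
  have e_le: "norm (e k) \<le> measure Jp (space Jp) + measure Jn (space Jn)" for k
    unfolding e_def complex_mod_cnj using norm_triangle_ineq4[of "fourier_measure Jp k" "fourier_measure Jn k"]
      norm_fourier_measure_le[OF fin(1), of k] norm_fourier_measure_le[OF fin(2), of k] by simp
  define u where "u n k = (norm (fourier_fun (normalized_ball (inverse (real (Suc n)))) k))\<^sup>2" for n and k :: 'v
  have u_sq: "complex_of_real (u n k) = fourier_fun (normalized_ball (inverse (real (Suc n)))) k
      * cnj (fourier_fun (normalized_ball (inverse (real (Suc n)))) k)" for n k
    unfolding u_def by (simp add: complex_norm_square[symmetric] del: of_nat_Suc)
  have u0: "0 \<le> u n k" for n k by (simp add: u_def)
  have u1: "u n k \<le> 1" for n k
    unfolding u_def using fourier_normalized_ball(1)[of "inverse (real (Suc n))" k] by (intro power_le_one) auto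
  have [measurable]: "u n \<in> borel_measurable borel" for n
    unfolding u_def[abs_def]
    using fourier_fun_measurable[OF normalized_ball_measurable] by measurable
  have ulim: "(\<lambda>n. u n k) \<longlonglongrightarrow> 1" for k
  proof -
    have "(\<lambda>n. fourier_fun (normalized_ball (inverse (real (Suc n)))) k - 1) \<longlonglongrightarrow> 0"
    proof (rule Lim_null_comparison)
      show "eventually (\<lambda>n. norm (fourier_fun (normalized_ball (inverse (real (Suc n)))) k - 1) \<le> norm k * inverse (real (Suc n))) sequentially"
        by (intro always_eventually allI fourier_normalized_ball) auto
      show "(\<lambda>n. norm k * inverse (real (Suc n))) \<longlonglongrightarrow> 0"
        using tendsto_mult_left[OF LIMSEQ_inverse_real_of_nat, of "norm k"] by simp
    qed
    then have "(\<lambda>n. fourier_fun (normalized_ball (inverse (real (Suc n)))) k) \<longlonglongrightarrow> 1"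
      by (rule LIM_zero_cancel)
    from tendsto_power[OF tendsto_norm[OF this], of 2] show ?thesis by (simp add: u_def)
  qed
  \<comment> \<open>Integrability for a test function paired with itself makes the weighted measure
    finite. Pairing it with its translate by \<open>a\<close> yields the same weight times the
    character at \<open>a\<close>.\<close>
  have dens: "finite_measure (density \<sigma> (\<lambda>k. ennreal (u n k)))"
      "(LINT k|density \<sigma> (\<lambda>k. ennreal (u n k)). fourier_char k a)
         = (LINT k|\<sigma>. fourier_fun (normalized_ball (inverse (real (Suc n)))) k
             * cnj (fourier_fun (\<lambda>x. normalized_ball (inverse (real (Suc n))) (x + a)) k))"
      "measure (density \<sigma> (\<lambda>k. ennreal (u n k))) B = (LINT k|\<sigma>. indicator B k * u n k)"
    if \<sigma>: "\<sigma> = \<sigma>1 \<or> \<sigma> = \<sigma>2" for \<sigma> n a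
  proof -
    have lf: "locally_finite_measure \<sigma>"
      and int: "\<And>f g. bounded_test_fun f \<Longrightarrow> bounded_test_fun g \<Longrightarrow> integrable \<sigma> (\<lambda>k. fourier_fun f k * cnj (fourier_fun g k))"
      using \<sigma> lf int by auto
    have sets\<sigma> [measurable_cong]: "sets \<sigma> = sets borel" using lf by (simp add: locally_finite_measure_def)
    have sp: "space \<sigma> = UNIV" using sets_eq_imp_space_eq[OF sets\<sigma>] by simp
    have "integrable \<sigma> (\<lambda>k. complex_of_real (u n k))"
      unfolding u_sq by (intro int bounded_test_fun_normalized_ball)
    then have ui: "integrable \<sigma> (u n)" by (simp add: complex_of_real_integrable_eq)
    have "(\<integral>\<^sup>+k. ennreal (u n k) \<partial>\<sigma>) < \<infinity>"
      using ui u0 by (subst nn_integral_eq_integral) auto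
    then show fm: "finite_measure (density \<sigma> (\<lambda>k. ennreal (u n k)))"
      by (intro finite_measureI) (simp add: emeasure_density sp)
    have nbm: "normalized_ball (inverse (real (Suc n))) \<in> borel_measurable (borel :: 'v measure)"
      by (rule normalized_ball_measurable)
    have "(LINT k|density \<sigma> (\<lambda>k. ennreal (u n k)). fourier_char k a) = (LINT k|\<sigma>. complex_of_real (u n k) * fourier_char k a)"
      using u0 by (subst integral_density) (auto simp: scaleR_conv_of_real)
    also have "\<dots> = (LINT k|\<sigma>. fourier_fun (normalized_ball (inverse (real (Suc n)))) k
             * cnj (fourier_fun (\<lambda>x. normalized_ball (inverse (real (Suc n))) (x + a)) k))"
      unfolding u_sq fourier_fun_translate[OF nbm] by (simp add: ac_simps)
    finally show "(LINT k|density \<sigma> (\<lambda>k. ennreal (u n k)). fourier_char k a)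
         = (LINT k|\<sigma>. fourier_fun (normalized_ball (inverse (real (Suc n)))) k
             * cnj (fourier_fun (\<lambda>x. normalized_ball (inverse (real (Suc n))) (x + a)) k))" .
    have "measure (density \<sigma> (\<lambda>k. ennreal (u n k))) B = (LINT k|density \<sigma> (\<lambda>k. ennreal (u n k)). indicator B k)"
      using B(1) sp by simp
    also have "\<dots> = (LINT k|\<sigma>. indicator B k * u n k)"
      using u0 B(1) by (subst integral_density) (auto simp: mult.commute)
    finally show "measure (density \<sigma> (\<lambda>k. ennreal (u n k))) B = (LINT k|\<sigma>. indicator B k * u n k)" .
  qed
  have step: "complex_of_real ((LINT k|\<sigma>1. indicator B k * u n k) - (LINT k|\<sigma>2. indicator B k * u n k))
      = (LINT k|lborel. indicator B k *\<^sub>R (complex_of_real (u n k) * e k))" for n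
  proof -
    define f where "f = (normalized_ball (inverse (real (Suc n))) :: 'v \<Rightarrow> real)"
    have f: "bounded_test_fun f" unfolding f_def by (rule bounded_test_fun_normalized_ball)
    have "complex_of_real (measure (density \<sigma>1 (\<lambda>k. ennreal (u n k))) B - measure (density \<sigma>2 (\<lambda>k. ennreal (u n k))) B)
      = (LINT k:B|lborel. complex_of_real (u n k) * cnj (fourier_measure Jp k - fourier_measure Jn k))"
    proof (rule spectral_identity[OF dens(1)[OF disjI1[OF refl]] dens(1)[OF disjI2[OF refl]] fin _ _ sets bounded_test_fun_correlation[OF f f] _ u0 _ B(1)])
      show "fourier_fun (correlation f f) k = complex_of_real (u n k)" for k
        using fourier_fun_correlation[OF f f] u_sq by (simp only: f_def)
      fix a :: 'v
      have fa: "bounded_test_fun (\<lambda>x. f (x + a))" using f by (rule bounded_test_fun_translate)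
      show "(LINT k|density \<sigma>1 (\<lambda>k. ennreal (u n k)). fourier_char k a) - (LINT k|density \<sigma>2 (\<lambda>k. ennreal (u n k)). fourier_char k a)
        = (2 * pi) ^ DIM('v) * ((LINT y|Jp. complex_of_real (correlation f f (y - a))) - (LINT y|Jn. complex_of_real (correlation f f (y - a))))"
        unfolding dens(2)[OF disjI1[OF refl]] dens(2)[OF disjI2[OF refl]] f_def[symmetric] eq[OF f fa] correlation_translate
        by simp
    qed (use lf in \<open>auto simp: locally_finite_measure_def\<close>)
    then show ?thesis
      unfolding dens(3)[OF disjI1[OF refl]] dens(3)[OF disjI2[OF refl]] set_lebesgue_integral_def e_def .
  qed
  have lim\<sigma>: "(\<lambda>n. LINT k|\<sigma>. indicator B k * u n k) \<longlonglongrightarrow> measure \<sigma> B" if lf: "locally_finite_measure \<sigma>" for \<sigma>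
  proof -
    have sets\<sigma> [measurable_cong]: "sets \<sigma> = sets borel" using lf by (simp add: locally_finite_measure_def)
    have sp: "space \<sigma> = UNIV" using sets_eq_imp_space_eq[OF sets\<sigma>] by simp
    have Bi: "integrable \<sigma> (indicator B :: 'v \<Rightarrow> real)"
      using lf B by (intro integrable_real_indicator) (auto simp: locally_finite_measure_def)
    have "(\<lambda>n. LINT k|\<sigma>. indicator B k * u n k) \<longlonglongrightarrow> (LINT k|\<sigma>. indicator B k * 1)"
    proof (rule integral_dominated_convergence[OF _ _ Bi])
      show "AE k in \<sigma>. (\<lambda>n. indicator B k * u n k) \<longlonglongrightarrow> indicator B k * 1"
        by (intro AE_I2 tendsto_mult_left ulim)
      show "AE k in \<sigma>. norm (indicator B k * u n k) \<le> indicator B k" for n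
        using u0 u1 by (intro AE_I2) (simp add: indicator_def)
    qed (use B(1) in measurable)
    then show ?thesis using sp by simp
  qed
  have Bl: "integrable lborel (indicator B :: 'v \<Rightarrow> real)"
    using B by (intro integrable_real_indicator emeasure_bounded_finite) auto
  define E where "E = measure Jp (space Jp) + measure Jn (space Jn)"
  have "(\<lambda>n. LINT k|lborel. indicator B k *\<^sub>R (complex_of_real (u n k) * e k)) \<longlonglongrightarrow> (LINT k|lborel. indicator B k *\<^sub>R (complex_of_real 1 * e k))"
  proof (rule integral_dominated_convergence[OF _ _ integrable_mult_right[OF Bl, of E]])
    show "AE k in lborel. (\<lambda>n. indicator B k *\<^sub>R (complex_of_real (u n k) * e k)) \<longlonglongrightarrow> indicator B k *\<^sub>R (complex_of_real 1 * e k)"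
      by (intro AE_I2 tendsto_scaleR[OF tendsto_const] tendsto_mult_right tendsto_of_real ulim)
    show "AE k in lborel. norm (indicator B k *\<^sub>R (complex_of_real (u n k) * e k)) \<le> E * indicator B k" for n
    proof (intro AE_I2)
      fix k
      have "norm (complex_of_real (u n k) * e k) \<le> 1 * E"
        unfolding norm_mult using u0 u1 e_le by (intro mult_mono) (auto simp: E_def)
      then show "norm (indicator B k *\<^sub>R (complex_of_real (u n k) * e k)) \<le> E * indicator B k"
        by (simp add: indicator_def)
    qed
  qed (use B(1) in measurable)
  moreover have "(\<lambda>n. complex_of_real ((LINT k|\<sigma>1. indicator B k * u n k) - (LINT k|\<sigma>2. indicator B k * u n k)))
      \<longlonglongrightarrow> complex_of_real (measure \<sigma>1 B - measure \<sigma>2 B)"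
    by (intro tendsto_of_real tendsto_diff lim\<sigma> lf)
  ultimately have lim_eq: "complex_of_real (measure \<sigma>1 B - measure \<sigma>2 B) = (LINT k|lborel. indicator B k *\<^sub>R e k)"
    unfolding step by (simp add: LIMSEQ_unique)
  \<comment> \<open>The left side equals its own conjugate, so conjugating the integral turns
    \<open>e\<close> back into the unconjugated transform.\<close>
  have "complex_of_real (measure \<sigma>1 B - measure \<sigma>2 B) = cnj (complex_of_real (measure \<sigma>1 B - measure \<sigma>2 B))"
    by simp
  also have "\<dots> = (LINT k|lborel. cnj (indicator B k *\<^sub>R e k))"
    unfolding lim_eq by (rule Bochner_Integration.integral_cnj[symmetric])
  also have "\<dots> = (LINT k:B|lborel. fourier_measure Jp k - fourier_measure Jn k)"
    unfolding set_lebesgue_integral_def by (simp add: e_def)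
  finally show ?thesis by (simp add: algebra_simps)
qed

section \<open>Transported random measures\<close>

lemma random_measureD:
  assumes "random_measure P \<Phi>" "\<omega> \<in> space P"
  shows "sets (\<Phi> \<omega>) = sets borel" "space (\<Phi> \<omega>) = UNIV" "sigma_finite_measure (\<Phi> \<omega>)"
    "locally_finite_measure (\<Phi> \<omega>)"
proof -
  show lf: "locally_finite_measure (\<Phi> \<omega>)" using assms by (simp add: random_measure_def)
  then show s: "sets (\<Phi> \<omega>) = sets borel" by (simp add: locally_finite_measure_def)
  show "space (\<Phi> \<omega>) = UNIV" using sets_eq_imp_space_eq[OF s] by simp
  show "sigma_finite_measure (\<Phi> \<omega>)" using lf by (rule locally_finite_measure_sigma_finite)
qed

text \<open>\<open>\<Phi> \<omega>\<close> may have infinite mass, and is then not a point of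
  \<open>subprob_algebra\<close>. On each ball it is scaled to mass at most \<open>1\<close>, where
  measurability of kernel integrals is available; undoing the scaling and letting the balls grow
  gives the integral as a supremum.\<close>

lemma nn_integral_random_measure_measurable:
  fixes \<Phi> :: "'w \<Rightarrow> 'v::euclidean_space measure"
  assumes \<Phi>: "random_measure P \<Phi>" and f [measurable]: "(\<lambda>(\<omega>, x). f \<omega> x) \<in> borel_measurable (P \<Otimes>\<^sub>M borel)"
  shows "(\<lambda>\<omega>. \<integral>\<^sup>+x. f \<omega> x \<partial>\<Phi> \<omega>) \<in> borel_measurable P"
proof -
  \<comment> \<open>The summand \<open>1\<close> keeps the divisor positive on balls of mass
    \<open>0\<close>, while the scaled mass stays at most \<open>1\<close>.\<close>
  define c where "c n \<omega> = 1 / (1 + emeasure (\<Phi> \<omega>) (ball 0 (real n)))" for n \<omega>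
  define N where "N n \<omega> = density (\<Phi> \<omega>) (\<lambda>x. c n \<omega> * indicator (ball 0 (real n)) x)" for n \<omega>
  note D = random_measureD[OF \<Phi>]
  have fin: "emeasure (\<Phi> \<omega>) (ball 0 (real n)) < \<infinity>" if "\<omega> \<in> space P" for n \<omega>
    using D(4)[OF that] by (simp add: locally_finite_measure_def)
  have c1: "c n \<omega> * (1 + emeasure (\<Phi> \<omega>) (ball 0 (real n))) = 1" if "\<omega> \<in> space P" for n \<omega>
    unfolding c_def using fin[OF that, of n]
    by (intro ennreal_divide_times[THEN trans] ennreal_divide_self) (auto simp: ennreal_add_eq_top)
  have meas_f: "f \<omega> \<in> borel_measurable (\<Phi> \<omega>)" if "\<omega> \<in> space P" for \<omega>
    using measurable_Pair2[OF f that] by (simp add: measurable_cong_sets[OF D(1)[OF that] refl])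
  have [measurable]: "(\<lambda>\<omega>. emeasure (\<Phi> \<omega>) B) \<in> borel_measurable P" if "B \<in> sets borel" for B
    using \<Phi> that by (simp add: random_measure_def)
  have cm [measurable]: "c n \<in> borel_measurable P" for n
    unfolding c_def[abs_def] by measurable
  have Ne: "emeasure (N n \<omega>) B = c n \<omega> * emeasure (\<Phi> \<omega>) (ball 0 (real n) \<inter> B)" if "\<omega> \<in> space P" "B \<in> sets borel" for n \<omega> B
  proof -
    have "emeasure (N n \<omega>) B = (\<integral>\<^sup>+x. c n \<omega> * indicator (ball 0 (real n) \<inter> B) x \<partial>\<Phi> \<omega>)"
      unfolding N_def using that D(1)[OF that(1)]
      by (subst emeasure_density) (auto simp: indicator_def measurable_cong_sets[OF D(1)[OF that(1)] refl] intro!: nn_integral_cong)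
    then show ?thesis using that D(1)[OF that(1)] by (simp add: nn_integral_cmult_indicator)
  qed
  have N: "N n \<in> P \<rightarrow>\<^sub>M subprob_algebra borel" for n
  proof (rule measurable_subprob_algebra)
    fix \<omega> assume \<omega>: "\<omega> \<in> space P"
    show sN: "sets (N n \<omega>) = sets borel" using D(1)[OF \<omega>] by (simp add: N_def)
    show "subprob_space (N n \<omega>)"
    proof
      have sp: "space (N n \<omega>) = UNIV" using sets_eq_imp_space_eq[OF sN] by simp
      then show "space (N n \<omega>) \<noteq> {}" by simp
      have "emeasure (N n \<omega>) UNIV \<le> c n \<omega> * (1 + emeasure (\<Phi> \<omega>) (ball 0 (real n)))"
        using Ne[OF \<omega>, of UNIV n] by (auto intro!: mult_left_mono)
      then show "emeasure (N n \<omega>) (space (N n \<omega>)) \<le> 1" using c1[OF \<omega>, of n] sp by simp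
    qed
  next
    fix B :: "'v set" assume B: "B \<in> sets borel"
    then have [measurable]: "(\<lambda>\<omega>. emeasure (\<Phi> \<omega>) (ball 0 (real n) \<inter> B)) \<in> borel_measurable P"
      using \<Phi> by (simp add: random_measure_def)
    show "(\<lambda>\<omega>. emeasure (N n \<omega>) B) \<in> borel_measurable P"
      by (subst measurable_cong[OF Ne[OF _ B]]) measurable
  qed
  have eq: "(\<integral>\<^sup>+x. f \<omega> x * indicator (ball 0 (real n)) x \<partial>\<Phi> \<omega>)
      = (1 + emeasure (\<Phi> \<omega>) (ball 0 (real n))) * (\<integral>\<^sup>+x. f \<omega> x \<partial>N n \<omega>)" if \<omega>: "\<omega> \<in> space P" for n \<omega>
  proof -
    have m: "(\<lambda>x. c n \<omega> * indicator (ball 0 (real n)) x) \<in> borel_measurable (\<Phi> \<omega>)"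
      by (rule borel_measurable_times_ennreal[OF borel_measurable_const borel_measurable_indicator])
        (simp add: D(1)[OF \<omega>])
    have m2: "(\<lambda>x. f \<omega> x * indicator (ball 0 (real n)) x) \<in> borel_measurable (\<Phi> \<omega>)"
      by (rule borel_measurable_times_ennreal[OF meas_f[OF \<omega>] borel_measurable_indicator])
        (simp add: D(1)[OF \<omega>])
    have "(\<integral>\<^sup>+x. f \<omega> x \<partial>N n \<omega>) = (\<integral>\<^sup>+x. c n \<omega> * (f \<omega> x * indicator (ball 0 (real n)) x) \<partial>\<Phi> \<omega>)"
      unfolding N_def by (subst nn_integral_density[OF m meas_f[OF \<omega>]]) (simp add: ac_simps)
    also have "\<dots> = c n \<omega> * (\<integral>\<^sup>+x. f \<omega> x * indicator (ball 0 (real n)) x \<partial>\<Phi> \<omega>)"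
      by (rule nn_integral_cmult[OF m2])
    finally have "(1 + emeasure (\<Phi> \<omega>) (ball 0 (real n))) * (\<integral>\<^sup>+x. f \<omega> x \<partial>N n \<omega>)
        = (c n \<omega> * (1 + emeasure (\<Phi> \<omega>) (ball 0 (real n)))) * (\<integral>\<^sup>+x. f \<omega> x * indicator (ball 0 (real n)) x \<partial>\<Phi> \<omega>)"
      by (simp only: ac_simps)
    then show ?thesis unfolding c1[OF \<omega>] mult_1 by (rule sym)
  qed
  have SUP: "(\<integral>\<^sup>+x. f \<omega> x \<partial>\<Phi> \<omega>) = (SUP n. (1 + emeasure (\<Phi> \<omega>) (ball 0 (real n))) * (\<integral>\<^sup>+x. f \<omega> x \<partial>N n \<omega>))"
    if \<omega>: "\<omega> \<in> space P" for \<omega>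
  proof -
    have "(SUP n. f \<omega> x * indicator (ball 0 (real n)) x) = f \<omega> x" for x
    proof (rule antisym)
      obtain n where "norm x < real n" using reals_Archimedean2 by blast
      then show "f \<omega> x \<le> (SUP n. f \<omega> x * indicator (ball 0 (real n)) x)"
        by (intro SUP_upper2[of n]) auto
    qed (auto intro!: SUP_least simp: indicator_def)
    then have "(\<integral>\<^sup>+x. f \<omega> x \<partial>\<Phi> \<omega>) = (\<integral>\<^sup>+x. (SUP n. f \<omega> x * indicator (ball 0 (real n)) x) \<partial>\<Phi> \<omega>)" by simp
    also have "\<dots> = (SUP n. \<integral>\<^sup>+x. f \<omega> x * indicator (ball 0 (real n)) x \<partial>\<Phi> \<omega>)"
    proof (rule nn_integral_monotone_convergence_SUP)
      show "incseq (\<lambda>n x. f \<omega> x * indicator (ball 0 (real n)) x)"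
        by (auto simp: incseq_def le_fun_def indicator_def)
      show "(\<lambda>x. f \<omega> x * indicator (ball 0 (real n)) x) \<in> borel_measurable (\<Phi> \<omega>)" for n
        by (rule borel_measurable_times_ennreal[OF meas_f[OF \<omega>] borel_measurable_indicator])
          (simp add: D(1)[OF \<omega>])
    qed
    finally show ?thesis by (simp add: eq[OF \<omega>])
  qed
  have "(\<lambda>\<omega>. (SUP n. (1 + emeasure (\<Phi> \<omega>) (ball 0 (real n))) * (\<integral>\<^sup>+x. f \<omega> x \<partial>N n \<omega>))) \<in> borel_measurable P"
    using nn_integral_measurable_subprob_algebra2[OF f N] by measurable
  then show ?thesis by (subst measurable_cong[OF SUP])
qed

lemma probability_kernelD:
  assumes K: "probability_kernel P K"
  shows "\<omega> \<in> space P \<Longrightarrow> prob_space (K \<omega> x)" "\<omega> \<in> space P \<Longrightarrow> sets (K \<omega> x) = sets borel"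
    "\<omega> \<in> space P \<Longrightarrow> space (K \<omega> x) = UNIV" "\<omega> \<in> space P \<Longrightarrow> K \<omega> \<in> borel \<rightarrow>\<^sub>M prob_algebra borel"
proof -
  note m = K[unfolded probability_kernel_def]
  show *: "K \<omega> \<in> borel \<rightarrow>\<^sub>M prob_algebra borel" if "\<omega> \<in> space P" for \<omega>
    using measurable_Pair2[OF m that] by simp
  show "prob_space (K \<omega> x)" "sets (K \<omega> x) = sets borel" if "\<omega> \<in> space P"
    using measurable_space[OF *[OF that], of x] by (auto simp: space_prob_algebra)
  from sets_eq_imp_space_eq[OF this(2)] show "space (K \<omega> x) = UNIV" if "\<omega> \<in> space P"
    using that by simp
qed

lemma kernel_measurable_random_measure:
  assumes \<Phi>: "random_measure P \<Phi>" and K: "probability_kernel P K" and \<omega>: "\<omega> \<in> space P"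
  shows "K \<omega> \<in> \<Phi> \<omega> \<rightarrow>\<^sub>M subprob_algebra borel"
  using measurable_prob_algebraD[OF probability_kernelD(4)[OF K \<omega>]]
  by (simp add: measurable_cong_sets[OF random_measureD(1)[OF \<Phi> \<omega>] refl])

lemma sets_transport:
  assumes \<Phi>: "random_measure P \<Phi>" and K: "probability_kernel P K" and \<omega>: "\<omega> \<in> space P"
  shows "sets (transport K \<Phi> \<omega>) = sets borel" "space (transport K \<Phi> \<omega>) = UNIV"
proof -
  show *: "sets (transport K \<Phi> \<omega>) = sets borel"
    unfolding transport_def
    by (rule sets_bind) (simp_all add: probability_kernelD[OF K \<omega>] random_measureD[OF \<Phi> \<omega>])
  show "space (transport K \<Phi> \<omega>) = UNIV" using sets_eq_imp_space_eq[OF *] by simp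
qed

lemma nn_integral_transport:
  assumes \<Phi>: "random_measure P \<Phi>" and K: "probability_kernel P K" and \<omega>: "\<omega> \<in> space P"
    and f: "f \<in> borel_measurable borel"
  shows "(\<integral>\<^sup>+x. f x \<partial>transport K \<Phi> \<omega>) = (\<integral>\<^sup>+s. \<integral>\<^sup>+x. f x \<partial>K \<omega> s \<partial>\<Phi> \<omega>)"
  unfolding transport_def by (rule nn_integral_bind[OF f kernel_measurable_random_measure[OF \<Phi> K \<omega>]])

lemma emeasure_transport:
  assumes \<Phi>: "random_measure P \<Phi>" and K: "probability_kernel P K" and \<omega>: "\<omega> \<in> space P"
    and B: "B \<in> sets borel"
  shows "emeasure (transport K \<Phi> \<omega>) B = (\<integral>\<^sup>+s. emeasure (K \<omega> s) B \<partial>\<Phi> \<omega>)"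
  unfolding transport_def
  by (rule emeasure_bind[OF _ kernel_measurable_random_measure[OF \<Phi> K \<omega>] B])
    (simp add: random_measureD[OF \<Phi> \<omega>])

lemma emeasure_transport_measurable:
  assumes \<Phi>: "random_measure P \<Phi>" and K: "probability_kernel P K" and B: "B \<in> sets borel"
  shows "(\<lambda>\<omega>. emeasure (transport K \<Phi> \<omega>) B) \<in> borel_measurable P"
proof -
  have "(\<lambda>(\<omega>, s). K \<omega> s) \<in> P \<Otimes>\<^sub>M borel \<rightarrow>\<^sub>M subprob_algebra borel"
    using K unfolding probability_kernel_def by (rule measurable_prob_algebraD)
  from measurable_compose[OF this measurable_emeasure_subprob_algebra[OF B]]
  have "(\<lambda>(\<omega>, s). emeasure (K \<omega> s) B) \<in> borel_measurable (P \<Otimes>\<^sub>M borel)"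
    by (simp add: split_beta')
  from nn_integral_random_measure_measurable[OF \<Phi> this] show ?thesis
    by (subst measurable_cong[OF emeasure_transport[OF \<Phi> K _ B]])
qed

section \<open>Palm laws of pairs of transported points\<close>

abbreviation borel3 :: "('a::topological_space \<times> 'b::topological_space \<times> 'c::topological_space) measure" where
  "borel3 \<equiv> borel \<Otimes>\<^sub>M (borel \<Otimes>\<^sub>M borel)"

text \<open>The mean of \<open>K\<^sub>y \<otimes> K\<^sub>0\<close> under the two-point Palm measure.\<close>

definition palm_law ::
    "('v \<Rightarrow> 'w measure) \<Rightarrow> ('w \<Rightarrow> 'v::euclidean_space \<Rightarrow> 'v measure) \<Rightarrow> 'v \<Rightarrow> ('v \<times> 'v) measure" where
  "palm_law Q K y = Giry_Monad.bind (Q y) (\<lambda>\<omega>. K \<omega> y \<Otimes>\<^sub>M K \<omega> 0)"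

text \<open>The coordinate \<open>y\<close> is retained next to the pair. For probability laws
  \<open>N y\<close> a strip over \<open>B\<close> then has mass \<open>\<alpha> B\<close>, so the
  measure is \<sigma>-finite even when the image under \<open>u - v\<close> fails to be locally
  finite, and truncation in \<open>y\<close> is a restriction of it.\<close>

definition moment_law ::
    "'v measure \<Rightarrow> ('v \<Rightarrow> ('v::euclidean_space \<times> 'v) measure) \<Rightarrow> ('v \<times> 'v \<times> 'v) measure" where
  "moment_law \<alpha> N = Giry_Monad.bind \<alpha> (\<lambda>y. distr (N y) borel3 (Pair y))"

lemma palm_law_measurable:
  assumes Q: "Q \<in> borel \<rightarrow>\<^sub>M prob_algebra P" and K: "probability_kernel P K"
  shows "palm_law Q K \<in> borel \<rightarrow>\<^sub>M prob_algebra (borel \<Otimes>\<^sub>M borel)"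
proof -
  have m: "(\<lambda>(\<omega>, x). K \<omega> x) \<in> P \<Otimes>\<^sub>M borel \<rightarrow>\<^sub>M prob_algebra borel"
    using K by (simp add: probability_kernel_def)
  have "(\<lambda>z. K (snd z) (fst z)) \<in> borel \<Otimes>\<^sub>M P \<rightarrow>\<^sub>M prob_algebra borel"
    "(\<lambda>z. K (snd z) 0) \<in> borel \<Otimes>\<^sub>M P \<rightarrow>\<^sub>M prob_algebra borel"
    using measurable_compose[OF measurable_Pair[OF measurable_snd measurable_fst] m]
      measurable_compose[OF measurable_Pair[OF measurable_snd measurable_const[of 0]] m] by simp_all
  then have "(\<lambda>(y, \<omega>). K \<omega> y \<Otimes>\<^sub>M K \<omega> 0) \<in> borel \<Otimes>\<^sub>M P \<rightarrow>\<^sub>M prob_algebra (borel \<Otimes>\<^sub>M borel)"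
    unfolding split_beta' by (rule measurable_pair_prob)
  with Q show ?thesis unfolding palm_law_def[abs_def] by (rule measurable_bind_prob_space2)
qed

lemma palm_law_kernel:
  assumes Q: "Q \<in> borel \<rightarrow>\<^sub>M prob_algebra P" and K: "probability_kernel P K"
  shows "(\<lambda>\<omega>. K \<omega> y \<Otimes>\<^sub>M K \<omega> 0) \<in> Q y \<rightarrow>\<^sub>M subprob_algebra (borel \<Otimes>\<^sub>M borel)"
proof -
  have m: "(\<lambda>(\<omega>, x). K \<omega> x) \<in> P \<Otimes>\<^sub>M borel \<rightarrow>\<^sub>M prob_algebra borel"
    using K by (simp add: probability_kernel_def)
  have "(\<lambda>\<omega>. K \<omega> x) \<in> P \<rightarrow>\<^sub>M prob_algebra borel" for x
    using measurable_Pair1[OF m, of x] by simp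
  from measurable_prob_algebraD[OF measurable_pair_prob[OF this this]]
  have "(\<lambda>\<omega>. K \<omega> y \<Otimes>\<^sub>M K \<omega> 0) \<in> P \<rightarrow>\<^sub>M subprob_algebra (borel \<Otimes>\<^sub>M borel)" .
  moreover have "sets (Q y) = sets P"
    using measurable_space[OF Q, of y] by (simp add: space_prob_algebra)
  ultimately show ?thesis by (simp add: measurable_cong_sets[of "Q y" P])
qed

lemma moment_law_kernel:
  assumes N: "N \<in> borel \<rightarrow>\<^sub>M prob_algebra (borel \<Otimes>\<^sub>M borel)" and \<alpha>: "sets \<alpha> = sets borel"
  shows "(\<lambda>y. distr (N y) borel3 (Pair y)) \<in> \<alpha> \<rightarrow>\<^sub>M subprob_algebra borel3"
proof -
  have "(\<lambda>y. distr (N y) borel3 (Pair y)) \<in> borel \<rightarrow>\<^sub>M subprob_algebra borel3"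
    by (rule measurable_prob_algebraD[OF measurable_distr_prob_space2[OF N]]) measurable
  then show ?thesis by (simp add: measurable_cong_sets[OF \<alpha> refl])
qed

lemma sets_moment_law:
  assumes "sets \<alpha> = sets borel"
  shows "sets (moment_law \<alpha> N) = sets borel3"
  unfolding moment_law_def using sets_eq_imp_space_eq[OF assms] by (intro sets_bind) auto

lemma nn_integral_moment_law:
  assumes N: "N \<in> borel \<rightarrow>\<^sub>M prob_algebra (borel \<Otimes>\<^sub>M borel)" and \<alpha>: "sets \<alpha> = sets borel"
    and f: "f \<in> borel_measurable borel3"
  shows "(\<integral>\<^sup>+z. f z \<partial>moment_law \<alpha> N) = (\<integral>\<^sup>+y. \<integral>\<^sup>+p. f (y, p) \<partial>N y \<partial>\<alpha>)"
proof -
  have "(\<integral>\<^sup>+z. f z \<partial>moment_law \<alpha> N) = (\<integral>\<^sup>+y. \<integral>\<^sup>+z. f z \<partial>distr (N y) borel3 (Pair y) \<partial>\<alpha>)"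
    unfolding moment_law_def by (rule nn_integral_bind[OF f moment_law_kernel[OF N \<alpha>]])
  also have "\<dots> = (\<integral>\<^sup>+y. \<integral>\<^sup>+p. f (y, p) \<partial>N y \<partial>\<alpha>)"
  proof (intro nn_integral_cong nn_integral_distr)
    fix y
    have "sets (N y) = sets (borel \<Otimes>\<^sub>M borel)"
      using measurable_space[OF N, of y] by (simp add: space_prob_algebra)
    from measurable_cong_sets[OF this refl]
    show "Pair y \<in> N y \<rightarrow>\<^sub>M borel3"
      by (rule ssubst) measurable
  qed (simp add: f)
  finally show ?thesis .
qed

lemma emeasure_moment_law_strip:
  assumes N: "N \<in> borel \<rightarrow>\<^sub>M prob_algebra (borel \<Otimes>\<^sub>M borel)" and \<alpha>: "sets \<alpha> = sets borel"
    and B: "B \<in> sets borel"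
  shows "emeasure (moment_law \<alpha> N) (B \<times> UNIV) = emeasure \<alpha> B"
proof -
  have BU: "B \<times> UNIV \<in> sets borel3"
    using B by (intro pair_measureI) (auto simp: sets.top[of "borel \<Otimes>\<^sub>M borel", simplified space_pair_measure space_borel UNIV_Times_UNIV])
  have "emeasure (moment_law \<alpha> N) (B \<times> UNIV) = (\<integral>\<^sup>+z. indicator (B \<times> UNIV) z \<partial>moment_law \<alpha> N)"
    using BU by (intro nn_integral_indicator[symmetric]) (simp add: sets_moment_law[OF \<alpha>])
  also have "\<dots> = (\<integral>\<^sup>+y. \<integral>\<^sup>+p. indicator (B \<times> UNIV) (y, p) \<partial>N y \<partial>\<alpha>)"
    by (rule nn_integral_moment_law[OF N \<alpha> borel_measurable_indicator[OF BU]])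
  also have "\<dots> = (\<integral>\<^sup>+y. indicator B y \<partial>\<alpha>)"
  proof (intro nn_integral_cong)
    fix y
    interpret prob_space "N y"
      using measurable_space[OF N, of y] by (simp add: space_prob_algebra)
    have "(\<integral>\<^sup>+p. indicator (B \<times> UNIV) (y, p) \<partial>N y) = (\<integral>\<^sup>+p. indicator B y \<partial>N y)"
      by (intro nn_integral_cong) (simp add: indicator_def)
    then show "(\<integral>\<^sup>+p. indicator (B \<times> UNIV) (y, p) \<partial>N y) = indicator B y"
      by (simp add: emeasure_space_1)
  qed
  also have "\<dots> = emeasure \<alpha> B" using B \<alpha> by simp
  finally show ?thesis .
qed

lemma sigma_finite_moment_law:
  assumes N: "N \<in> borel \<rightarrow>\<^sub>M prob_algebra (borel \<Otimes>\<^sub>M borel)" and \<alpha>: "locally_finite_measure (\<alpha> :: 'v::euclidean_space measure)"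
  shows "sigma_finite_measure (moment_law \<alpha> N)"
proof
  have s: "sets \<alpha> = sets borel" using \<alpha> by (simp add: locally_finite_measure_def)
  have sp: "space (moment_law \<alpha> N) = UNIV"
    using sets_eq_imp_space_eq[OF sets_moment_law[OF s, of N]] by (simp add: space_pair_measure)
  have "ball 0 (real n) \<times> UNIV \<in> sets borel3" for n
    by (intro pair_measureI) (auto simp: sets.top[of "borel \<Otimes>\<^sub>M borel", simplified space_pair_measure space_borel UNIV_Times_UNIV])
  moreover have "(\<Union>n::nat. ball 0 (real n) \<times> UNIV) = (UNIV :: ('v \<times> 'v \<times> 'v) set)"
    using reals_Archimedean2 by auto
  moreover have "emeasure (moment_law \<alpha> N) (ball 0 (real n) \<times> UNIV) \<noteq> \<infinity>" for n
    using \<alpha> by (simp add: emeasure_moment_law_strip[OF N s] locally_finite_measure_def less_top)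
  ultimately show "\<exists>A. countable A \<and> A \<subseteq> sets (moment_law \<alpha> N) \<and> \<Union> A = space (moment_law \<alpha> N) \<and> (\<forall>a\<in>A. emeasure (moment_law \<alpha> N) a \<noteq> \<infinity>)"
    by (intro exI[of _ "range (\<lambda>n::nat. ball 0 (real n) \<times> UNIV)"]) (auto simp: sets_moment_law[OF s] sp)
qed

section \<open>Second moments and intensities of transported random measures\<close>

lemma emeasure_lborel_unit_cube: "emeasure lborel (cbox 0 One :: 'v::euclidean_space set) = 1"
  by (simp add: emeasure_lborel_cbox_eq)

lemma bounded_unit_cube: obtains r where "0 \<le> r" "\<And>x. x \<in> cbox 0 (One :: 'v::euclidean_space) \<Longrightarrow> norm x \<le> r"
  using bounded_cbox[of 0 "One :: 'v"] unfolding bounded_pos by (metis less_imp_le)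

lemma nn_integral_lborel_translate:
  fixes f :: "'v::euclidean_space \<Rightarrow> ennreal"
  assumes "f \<in> borel_measurable borel"
  shows "(\<integral>\<^sup>+x. f (x + t) \<partial>lborel) = (\<integral>\<^sup>+x. f x \<partial>lborel)"
  using lborel_nn_integral_affine[OF assms, of 1 t] by (simp add: add.commute)

lemma nn_integral_lborel_reflect:
  fixes f :: "'v::euclidean_space \<Rightarrow> ennreal"
  assumes "f \<in> borel_measurable borel"
  shows "(\<integral>\<^sup>+x. f (t - x) \<partial>lborel) = (\<integral>\<^sup>+x. f x \<partial>lborel)"
  using lborel_nn_integral_affine[OF assms, of "-1" t] by simp

section \<open>The flow and the reduced second moment measure of \<Phi>\<close>

locale palm_setting = stationary_setting P \<theta>
  for P :: "'w measure" and \<theta> :: "'v::euclidean_space \<Rightarrow> 'w \<Rightarrow> 'w" +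
  fixes \<Phi> :: "'w \<Rightarrow> 'v measure" and Q :: "'v \<Rightarrow> 'w measure"
  assumes random: "random_measure P \<Phi>"
    and invariant: "invariant_measure P \<theta> \<Phi>"
    and square_integrable: "locally_square_integrable P \<Phi>"
    and palm: "two_point_palm P \<theta> \<Phi> Q"
begin

abbreviation \<alpha> :: "'v measure" where "\<alpha> \<equiv> reduced_second_moment P \<Phi>"
abbreviation \<Phi>2 :: "'w \<Rightarrow> ('v \<times> 'v) measure" where "\<Phi>2 \<omega> \<equiv> \<Phi> \<omega> \<Otimes>\<^sub>M \<Phi> \<omega>"

lemma flow_space: "\<omega> \<in> space P \<Longrightarrow> \<theta> x \<omega> \<in> space P"
  using measurable_space[OF flow_measurable, of "(\<omega>, x)"] by (simp add: space_pair_measure)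

lemma flow_measurable1: "\<theta> x \<in> P \<rightarrow>\<^sub>M P"
  using measurable_compose[OF measurable_Pair[OF measurable_ident measurable_const[of x]] flow_measurable] by simp

text \<open>Invariance of \<open>P\<close> is given for forward images. Since
  \<open>\<theta> x\<close> is a bijection with inverse \<open>\<theta> (- x)\<close>, preimages
  under one are images under the other.\<close>

lemma distr_flow: "distr P P (\<theta> x) = P"
proof (rule measure_eqI)
  fix A assume "A \<in> sets (distr P P (\<theta> x))"
  then have A: "A \<in> sets P" by simp
  have "\<theta> x -` A \<inter> space P = \<theta> (- x) ` A"
  proof (intro equalityI subsetI)
    fix \<omega> assume w: "\<omega> \<in> \<theta> x -` A \<inter> space P"
    then have "\<omega> = \<theta> (- x) (\<theta> x \<omega>)" by (simp add: flow_add flow_zero)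
    with w show "\<omega> \<in> \<theta> (- x) ` A" by blast
  next
    fix \<omega> assume "\<omega> \<in> \<theta> (- x) ` A"
    then obtain a where a: "a \<in> A" "\<omega> = \<theta> (- x) a" by blast
    then have "a \<in> space P" using sets.sets_into_space[OF A] by blast
    with a show "\<omega> \<in> \<theta> x -` A \<inter> space P" by (simp add: flow_add flow_zero flow_space)
  qed
  then show "emeasure (distr P P (\<theta> x)) A = emeasure P A"
    using A by (simp add: emeasure_distr[OF flow_measurable1 A] flow_preserves)
qed simp

lemma nn_integral_flow:
  assumes "f \<in> borel_measurable P"
  shows "(\<integral>\<^sup>+\<omega>. f (\<theta> x \<omega>) \<partial>P) = (\<integral>\<^sup>+\<omega>. f \<omega> \<partial>P)"
  using nn_integral_distr[OF flow_measurable1[of x], of f] assms by (simp add: distr_flow)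

lemma Q_measurable: "Q \<in> borel \<rightarrow>\<^sub>M prob_algebra P"
  using palm by (simp add: two_point_palm_def)

lemma palm_formula:
  assumes "f \<in> borel_measurable (borel \<Otimes>\<^sub>M borel \<Otimes>\<^sub>M P)"
  shows "(\<integral>\<^sup>+\<omega>. (\<integral>\<^sup>+(x, y). f (x, y - x, \<theta> x \<omega>) \<partial>(\<Phi>2 \<omega>)) \<partial>P) =
        (\<integral>\<^sup>+x. (\<integral>\<^sup>+y. (\<integral>\<^sup>+\<omega>. f (x, y, \<omega>) \<partial>Q y) \<partial>\<alpha>) \<partial>lborel)"
  using palm assms by (simp add: two_point_palm_def)

lemma sets_alpha: "sets \<alpha> = sets borel"
  by (simp add: reduced_second_moment_def sets.sigma_sets_eq[of borel, simplified])

text \<open>A measure built by \<open>measure_of\<close> has the values of its set function only if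
  that function is a measure. The Palm formula settles this: applied to a function that does not
  depend on \<omega>, its right side already contains \<open>\<alpha>\<close> as a measure, while
  the unit cube has volume \<open>1\<close> and \<open>Q y\<close> has mass
  \<open>1\<close>.\<close>

lemma emeasure_alpha:
  assumes [measurable]: "B \<in> sets borel"
  shows "emeasure \<alpha> B = (\<integral>\<^sup>+\<omega>. (\<integral>\<^sup>+(x, y). indicator (cbox 0 One) x * indicator B (y - x) \<partial>(\<Phi>2 \<omega>)) \<partial>P)"
proof -
  define f :: "'v \<times> 'v \<times> 'w \<Rightarrow> ennreal" where "f z = indicator (cbox 0 One) (fst z) * indicator B (fst (snd z))" for z
  have "f \<in> borel_measurable (borel \<Otimes>\<^sub>M borel \<Otimes>\<^sub>M P)"
    unfolding f_def[abs_def] by measurable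
  from palm_formula[OF this]
  have "(\<integral>\<^sup>+\<omega>. (\<integral>\<^sup>+(x, y). indicator (cbox 0 One) x * indicator B (y - x) \<partial>(\<Phi>2 \<omega>)) \<partial>P)
    = (\<integral>\<^sup>+x. (\<integral>\<^sup>+y. (\<integral>\<^sup>+\<omega>. indicator (cbox 0 (One::'v)) x * indicator B y \<partial>Q y) \<partial>\<alpha>) \<partial>lborel)"
    by (simp add: f_def del: nn_integral_const)
  also have "\<dots> = (\<integral>\<^sup>+x. (\<integral>\<^sup>+y. indicator (cbox 0 (One::'v)) x * indicator B y \<partial>\<alpha>) \<partial>lborel)"
  proof (intro nn_integral_cong)
    fix x y :: 'v
    interpret Q: prob_space "Q y"
      using measurable_space[OF Q_measurable, of y] by (simp add: space_prob_algebra)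
    show "(\<integral>\<^sup>+\<omega>. indicator (cbox 0 One) x * indicator B y \<partial>Q y) = (indicator (cbox 0 One) x * indicator B y :: ennreal)"
      by (simp add: Q.emeasure_space_1)
  qed
  also have "\<dots> = (\<integral>\<^sup>+x. indicator (cbox 0 (One::'v)) x * emeasure \<alpha> B \<partial>lborel)"
    by (intro nn_integral_cong) (simp add: nn_integral_cmult_indicator sets_alpha)
  also have "\<dots> = emeasure \<alpha> B"
    by (simp add: nn_integral_multc emeasure_lborel_unit_cube)
  finally show ?thesis by simp
qed

text \<open>If \<open>x\<close> lies in the unit cube and \<open>y - x\<close> in \<open>B\<close>,
  both points lie in one ball \<open>D\<close>. The integrand is then at most the indicator of
  \<open>D \<times> D\<close>, and the mean squared mass of \<open>D\<close> is finite.\<close>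

lemma locally_finite_alpha: "locally_finite_measure \<alpha>"
  unfolding locally_finite_measure_def
proof (intro conjI ballI impI sets_alpha)
  fix B :: "'v set" assume B: "B \<in> sets borel" "bounded B"
  obtain r where r: "0 \<le> r" "\<And>x. x \<in> cbox 0 (One :: 'v) \<Longrightarrow> norm x \<le> r" by (rule bounded_unit_cube) blast
  obtain b where b: "0 < b" "\<And>x. x \<in> B \<Longrightarrow> norm x \<le> b" using B(2) unfolding bounded_pos by blast
  define D where "D = cball (0 :: 'v) (r + b)"
  have D: "D \<in> sets borel" "bounded D" by (auto simp: D_def)
  have "emeasure \<alpha> B \<le> (\<integral>\<^sup>+\<omega>. (emeasure (\<Phi> \<omega>) D)\<^sup>2 \<partial>P)"
    unfolding emeasure_alpha[OF B(1)]
  proof (intro nn_integral_mono)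
    fix \<omega> assume \<omega>: "\<omega> \<in> space P"
    note S = random_measureD[OF random \<omega>]
    have "(\<integral>\<^sup>+(x, y). indicator (cbox 0 One) x * indicator B (y - x) \<partial>(\<Phi>2 \<omega>))
        \<le> (\<integral>\<^sup>+z. indicator (D \<times> D) z \<partial>(\<Phi>2 \<omega>))"
    proof (intro nn_integral_mono)
      fix z :: "'v \<times> 'v"
      obtain x y where z: "z = (x, y)" by (cases z)
      have "x \<in> D" "y \<in> D" if "x \<in> cbox 0 One" "y - x \<in> B"
        using r(2)[OF that(1)] b(2)[OF that(2)] b(1) norm_triangle_ineq[of x "y - x"] by (simp_all add: D_def)
      then show "(case z of (x, y) \<Rightarrow> indicator (cbox 0 One) x * indicator B (y - x)) \<le> (indicator (D \<times> D) z :: ennreal)"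
        unfolding z by (simp add: indicator_def)
    qed
    also have "\<dots> = emeasure (\<Phi>2 \<omega>) (D \<times> D)"
      using D S(1) by (intro nn_integral_indicator pair_measureI) auto
    also have "\<dots> = (emeasure (\<Phi> \<omega>) D)\<^sup>2"
      using D S(1) sigma_finite_measure.emeasure_pair_measure_Times[OF S(3), of D "\<Phi> \<omega>" D] by (simp add: power2_eq_square)
    finally show "(\<integral>\<^sup>+(x, y). indicator (cbox 0 One) x * indicator B (y - x) \<partial>(\<Phi>2 \<omega>)) \<le> (emeasure (\<Phi> \<omega>) D)\<^sup>2" .
  qed
  also have "\<dots> < \<infinity>" using square_integrable D unfolding locally_square_integrable_def by blast
  finally show "emeasure \<alpha> B < \<infinity>" .
qed

end

section \<open>Recentring a kernel and the second moment formula\<close>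

locale palm_kernel = palm_setting P \<theta> \<Phi> Q
  for P :: "'w measure" and \<theta> :: "'v::euclidean_space \<Rightarrow> 'w \<Rightarrow> 'w" and \<Phi> Q +
  fixes K :: "'w \<Rightarrow> 'v \<Rightarrow> 'v measure"
  assumes kernel: "probability_kernel P K"
    and invariant_kernel: "invariant_kernel P \<theta> K"
begin

abbreviation N :: "'v \<Rightarrow> ('v \<times> 'v) measure" where "N \<equiv> palm_law Q K"
abbreviation K2 :: "'w \<Rightarrow> 'v \<Rightarrow> 'v \<Rightarrow> ('v \<times> 'v) measure" where "K2 \<omega> t s \<equiv> K \<omega> t \<Otimes>\<^sub>M K \<omega> s"
abbreviation M :: "('v \<times> 'v \<times> 'v) measure" where "M \<equiv> moment_law \<alpha> N"

lemmas kernelD = probability_kernelD[OF kernel]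
lemmas N_measurable = palm_law_measurable[OF Q_measurable kernel]
lemmas sets_M = sets_moment_law[OF sets_alpha, of N]
lemmas nn_integral_M = nn_integral_moment_law[OF N_measurable sets_alpha]
lemmas sigma_finite_M = sigma_finite_moment_law[OF N_measurable locally_finite_alpha]

lemma space_M: "space M = UNIV"
  using sets_eq_imp_space_eq[OF sets_M] by (simp add: space_pair_measure)

text \<open>Invariance compares a kernel only with its value at the origin. It is used twice, at
  \<open>\<theta> s \<omega>\<close> with shift \<open>t - s\<close> and at \<omega> with shift
  \<open>t\<close>; both lead to \<open>K (\<theta> t \<omega>) 0\<close>.\<close>

lemma kernel_shift:
  assumes \<omega>: "\<omega> \<in> space P"
  shows "K \<omega> t = distr (K (\<theta> s \<omega>) (t - s)) borel (\<lambda>v. v + s)"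
proof (rule measure_eqI)
  note \<omega>' = flow_space[OF \<omega>, of s]
  show "sets (K \<omega> t) = sets (distr (K (\<theta> s \<omega>) (t - s)) borel (\<lambda>v. v + s))"
    by (simp add: kernelD[OF \<omega>])
  fix B assume "B \<in> sets (K \<omega> t)"
  then have B: "B \<in> sets borel" by (simp add: kernelD[OF \<omega>])
  \<comment> \<open>The set \<open>B\<close> as seen from \<open>t\<close>; this one set at the
    origin serves both uses of invariance.\<close>
  define B2 where "B2 = (\<lambda>b. b + t) -` B"
  have B2: "B2 \<in> sets borel"
    using measurable_sets[of "\<lambda>b. b + t" borel borel B] B by (simp add: B2_def)
  have e1: "(\<lambda>b. b + t) ` B2 = B"
    unfolding B2_def by (rule surj_image_vimage_eq) (rule surjI[of _ "\<lambda>b. b - t"], simp)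
  have e2: "(\<lambda>v. v + s) -` B = (\<lambda>b. b + (t - s)) ` B2"
  proof (intro equalityI subsetI)
    fix x assume "x \<in> (\<lambda>v. v + s) -` B"
    then show "x \<in> (\<lambda>b. b + (t - s)) ` B2"
      by (intro image_eqI[of _ _ "x - (t - s)"]) (simp_all add: B2_def)
  qed (auto simp: B2_def)
  have "emeasure (distr (K (\<theta> s \<omega>) (t - s)) borel (\<lambda>v. v + s)) B = emeasure (K (\<theta> s \<omega>) (t - s)) ((\<lambda>v. v + s) -` B)"
    using B by (subst emeasure_distr) (simp_all add: kernelD[OF \<omega>'] measurable_cong_sets[OF kernelD(2)[OF \<omega>'] refl])
  also have "\<dots> = emeasure (K (\<theta> (t - s) (\<theta> s \<omega>)) 0) B2"
    unfolding e2 using invariant_kernel \<omega>' B2 by (simp add: invariant_kernel_def)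
  also have "\<dots> = emeasure (K (\<theta> t \<omega>) 0) B2"
    by (simp add: flow_add[OF \<omega>])
  also have "\<dots> = emeasure (K \<omega> t) ((\<lambda>b. b + t) ` B2)"
    using invariant_kernel \<omega> B2 by (simp add: invariant_kernel_def)
  finally show "emeasure (K \<omega> t) B = emeasure (distr (K (\<theta> s \<omega>) (t - s)) borel (\<lambda>v. v + s)) B"
    unfolding e1 by simp
qed

lemma nn_integral_kernel_shift:
  assumes \<omega>: "\<omega> \<in> space P" and h: "h \<in> borel_measurable borel"
  shows "(\<integral>\<^sup>+v. h v \<partial>K \<omega> t) = (\<integral>\<^sup>+v. h (v + s) \<partial>K (\<theta> s \<omega>) (t - s))"
proof -
  have "(\<lambda>v. v + s) \<in> K (\<theta> s \<omega>) (t - s) \<rightarrow>\<^sub>M borel"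
    by (simp add: measurable_cong_sets[OF kernelD(2)[OF flow_space[OF \<omega>]] refl])
  then show ?thesis
    by (subst kernel_shift[OF \<omega>, of t s]) (simp add: nn_integral_distr h)
qed

lemma nn_integral_kernel_pair:
  assumes \<omega>: "\<omega> \<in> space P" and g: "g \<in> borel_measurable (borel \<Otimes>\<^sub>M borel)"
  shows "(\<integral>\<^sup>+p. g p \<partial>(K2 \<omega> t s)) = (\<integral>\<^sup>+u. \<integral>\<^sup>+v. g (u, v) \<partial>K \<omega> s \<partial>K \<omega> t)"
proof -
  interpret k: prob_space "K \<omega> s" by (rule kernelD(1)[OF \<omega>])
  have "g \<in> borel_measurable (K2 \<omega> t s)"
    using g by (simp add: measurable_cong_sets[OF sets_pair_measure_cong[OF kernelD(2)[OF \<omega>, of t] kernelD(2)[OF \<omega>, of s]] refl])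
  from k.nn_integral_fst[OF this] show ?thesis by simp
qed

text \<open>Recentring at \<open>s\<close> puts the second factor at the origin and leaves an
  expression in \<open>s\<close>, \<open>t - s\<close> and \<open>\<theta> s \<omega>\<close>, which
  is the shape of the Palm formula.\<close>

lemma nn_integral_kernel_pair_shift:
  assumes \<omega>: "\<omega> \<in> space P" and g [measurable]: "g \<in> borel_measurable (borel \<Otimes>\<^sub>M borel)"
  shows "(\<integral>\<^sup>+p. g p \<partial>(K2 \<omega> t s))
    = (\<integral>\<^sup>+(u, v). g (u + s, v + s) \<partial>(K (\<theta> s \<omega>) (t - s) \<Otimes>\<^sub>M K (\<theta> s \<omega>) 0))"
proof -
  note \<omega>' = flow_space[OF \<omega>, of s]
  have "(\<integral>\<^sup>+p. g p \<partial>(K2 \<omega> t s)) = (\<integral>\<^sup>+u. \<integral>\<^sup>+v. g (u, v) \<partial>K \<omega> s \<partial>K \<omega> t)"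
    by (rule nn_integral_kernel_pair[OF \<omega> g])
  also have "\<dots> = (\<integral>\<^sup>+u. \<integral>\<^sup>+v. g (u, v + s) \<partial>K (\<theta> s \<omega>) 0 \<partial>K \<omega> t)"
    by (intro nn_integral_cong, subst nn_integral_kernel_shift[OF \<omega>, of _ s s]) simp_all
  also have "\<dots> = (\<integral>\<^sup>+u. \<integral>\<^sup>+v. g (u + s, v + s) \<partial>K (\<theta> s \<omega>) 0 \<partial>K (\<theta> s \<omega>) (t - s))"
  proof (rule nn_integral_kernel_shift[OF \<omega>])
    interpret k: prob_space "K (\<theta> s \<omega>) 0" by (rule kernelD(1)[OF \<omega>'])
    have "(\<lambda>(u, v). g (u, v + s)) \<in> borel_measurable (borel \<Otimes>\<^sub>M K (\<theta> s \<omega>) 0)"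
      unfolding split_beta' measurable_cong_sets[OF sets_pair_measure_cong[OF refl kernelD(2)[OF \<omega>', of 0]] refl] by measurable
    then show "(\<lambda>u. \<integral>\<^sup>+v. g (u, v + s) \<partial>K (\<theta> s \<omega>) 0) \<in> borel_measurable borel"
      using k.borel_measurable_nn_integral_fst by fastforce
  qed
  also have "\<dots> = (\<integral>\<^sup>+(u, v). g (u + s, v + s) \<partial>(K (\<theta> s \<omega>) (t - s) \<Otimes>\<^sub>M K (\<theta> s \<omega>) 0))"
    by (subst nn_integral_kernel_pair[OF \<omega>']) (simp_all add: split_beta')
  finally show ?thesis .
qed

lemma pair_kernel_measurable:
  "(\<lambda>z. K (snd (snd z)) (fst (snd z)) \<Otimes>\<^sub>M K (snd (snd z)) 0) \<in> borel \<Otimes>\<^sub>M borel \<Otimes>\<^sub>M P \<rightarrow>\<^sub>M subprob_algebra (borel \<Otimes>\<^sub>M borel)"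
proof -
  have m: "(\<lambda>(\<omega>, x). K \<omega> x) \<in> P \<Otimes>\<^sub>M borel \<rightarrow>\<^sub>M subprob_algebra borel"
    using kernel unfolding probability_kernel_def by (rule measurable_prob_algebraD)
  have "(\<lambda>z. K (snd (snd z)) (fst (snd z))) \<in> borel \<Otimes>\<^sub>M borel \<Otimes>\<^sub>M P \<rightarrow>\<^sub>M subprob_algebra borel"
    "(\<lambda>z. K (snd (snd z)) 0) \<in> borel \<Otimes>\<^sub>M borel \<Otimes>\<^sub>M P \<rightarrow>\<^sub>M subprob_algebra borel"
    using measurable_compose[OF measurable_Pair[OF measurable_compose[OF measurable_snd measurable_snd] measurable_compose[OF measurable_snd measurable_fst]] m]
      measurable_compose[OF measurable_Pair[OF measurable_compose[OF measurable_snd measurable_snd] measurable_const[of 0]] m]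
    by simp_all
  then show ?thesis by (rule measurable_pair_measure)
qed

text \<open>After recentring at \<open>s\<close>, the Palm formula replaces the double integral over
  \<Phi> by Lebesgue measure in \<open>x = s\<close> and \<open>\<alpha>\<close> in
  \<open>y = t - s\<close>. Tonelli moves the Lebesgue integral inside, where translation invariance
  absorbs the displacement \<open>v\<close>. The point \<open>u\<close> is sent from
  \<open>t\<close> and \<open>v\<close> from \<open>s\<close>, so \<open>u - v\<close> has the
  orientation of \<open>y - x\<close> in the reduced second moment measure.\<close>

lemma second_moment_formula:
  assumes h [measurable]: "h \<in> borel_measurable (borel \<Otimes>\<^sub>M borel)"
  shows "(\<integral>\<^sup>+\<omega>. (\<integral>\<^sup>+(s, t). (\<integral>\<^sup>+(u, v). h (v, u - v) \<partial>(K2 \<omega> t s)) \<partial>(\<Phi>2 \<omega>)) \<partial>P)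
    = (\<integral>\<^sup>+(y, u, v). (\<integral>\<^sup>+x. h (x, u - v) \<partial>lborel) \<partial>M)"
proof -
  \<comment> \<open>In recentred coordinates \<open>fst z\<close> is the position of
    \<open>s\<close>, so \<open>fst z + snd p\<close> is the original position of the point sent
    from \<open>s\<close>.\<close>
  define F where "F z = (\<integral>\<^sup>+p. h (fst z + snd p, fst p - snd p) \<partial>(K (snd (snd z)) (fst (snd z)) \<Otimes>\<^sub>M K (snd (snd z)) 0))" for z
  have "(\<lambda>(z, p). h (fst z + snd p, fst p - snd p)) \<in> borel_measurable ((borel \<Otimes>\<^sub>M borel \<Otimes>\<^sub>M P) \<Otimes>\<^sub>M (borel \<Otimes>\<^sub>M borel))"
    unfolding split_beta' by measurable
  then have F: "F \<in> borel_measurable (borel \<Otimes>\<^sub>M borel \<Otimes>\<^sub>M P)"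
    unfolding F_def[abs_def] using pair_kernel_measurable by (rule nn_integral_measurable_subprob_algebra2)
  have "(\<integral>\<^sup>+\<omega>. (\<integral>\<^sup>+(s, t). (\<integral>\<^sup>+(u, v). h (v, u - v) \<partial>(K2 \<omega> t s)) \<partial>(\<Phi>2 \<omega>)) \<partial>P)
      = (\<integral>\<^sup>+\<omega>. (\<integral>\<^sup>+(s, t). F (s, t - s, \<theta> s \<omega>) \<partial>(\<Phi>2 \<omega>)) \<partial>P)"
  proof (intro nn_integral_cong)
    fix \<omega> and z :: "'v \<times> 'v" assume \<omega>: "\<omega> \<in> space P"
    obtain s t where z: "z = (s, t)" by (cases z)
    have "(\<integral>\<^sup>+(u, v). h (v, u - v) \<partial>(K2 \<omega> t s)) = F (s, t - s, \<theta> s \<omega>)"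
      by (subst nn_integral_kernel_pair_shift[OF \<omega>]) (simp_all add: F_def split_beta' add.commute)
    then show "(case z of (s, t) \<Rightarrow> \<integral>\<^sup>+(u, v). h (v, u - v) \<partial>(K2 \<omega> t s)) = (case z of (s, t) \<Rightarrow> F (s, t - s, \<theta> s \<omega>))"
      by (simp add: z)
  qed
  also have "\<dots> = (\<integral>\<^sup>+x. (\<integral>\<^sup>+y. (\<integral>\<^sup>+\<omega>. F (x, y, \<omega>) \<partial>Q y) \<partial>\<alpha>) \<partial>lborel)"
    by (rule palm_formula[OF F])
  also have "\<dots> = (\<integral>\<^sup>+x. (\<integral>\<^sup>+z. h (x + snd (snd z), fst (snd z) - snd (snd z)) \<partial>M) \<partial>lborel)"
  proof (intro nn_integral_cong)
    fix x :: 'v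
    have "(\<integral>\<^sup>+y. (\<integral>\<^sup>+\<omega>. F (x, y, \<omega>) \<partial>Q y) \<partial>\<alpha>) = (\<integral>\<^sup>+y. (\<integral>\<^sup>+p. h (x + snd p, fst p - snd p) \<partial>N y) \<partial>\<alpha>)"
      unfolding F_def palm_law_def
      by (intro nn_integral_cong, subst nn_integral_bind[OF _ palm_law_kernel[OF Q_measurable kernel]]) simp_all
    also have "\<dots> = (\<integral>\<^sup>+z. h (x + snd (snd z), fst (snd z) - snd (snd z)) \<partial>M)"
      by (subst nn_integral_M) simp_all
    finally show "(\<integral>\<^sup>+y. (\<integral>\<^sup>+\<omega>. F (x, y, \<omega>) \<partial>Q y) \<partial>\<alpha>) = (\<integral>\<^sup>+z. h (x + snd (snd z), fst (snd z) - snd (snd z)) \<partial>M)" .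
  qed
  \<comment> \<open>The exchange rests on \<sigma>-finiteness of the law on triples, which retaining
    \<open>y\<close> guarantees.\<close>
  also have "\<dots> = (\<integral>\<^sup>+z. (\<integral>\<^sup>+x. h (x + snd (snd z), fst (snd z) - snd (snd z)) \<partial>lborel) \<partial>M)"
  proof -
    interpret MM: sigma_finite_measure M by (rule sigma_finite_M)
    interpret pair_sigma_finite "lborel :: 'v measure" M ..
    have "(\<lambda>(x, z). h (x + snd (snd z), fst (snd z) - snd (snd z))) \<in> borel_measurable (lborel \<Otimes>\<^sub>M M)"
      unfolding split_beta' measurable_cong_sets[OF sets_pair_measure_cong[OF sets_lborel sets_M] refl] by measurable
    from Fubini'[OF this] show ?thesis by simp
  qed
  also have "\<dots> = (\<integral>\<^sup>+(y, u, v). (\<integral>\<^sup>+x. h (x, u - v) \<partial>lborel) \<partial>M)"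
    by (intro nn_integral_cong) (simp add: split_beta' nn_integral_lborel_translate[of "\<lambda>x. h (x, _)"])
  finally show ?thesis .
qed

section \<open>Displacements of transported points and local square integrability\<close>

text \<open>The law of the displacement between two transported points, available before anything is
  known about the transport. Under local square integrability it turns out to be the reduced second
  moment measure of the transport.\<close>

definition \<delta> :: "'v measure" where
  "\<delta> = distr M borel (\<lambda>(y, u, v). u - v)"

lemma difference_measurable: "(\<lambda>(y, u, v). u - v) \<in> M \<rightarrow>\<^sub>M borel"
  unfolding measurable_cong_sets[OF sets_M refl] split_beta' by measurable

lemma sets_delta: "sets \<delta> = sets borel" by (simp add: \<delta>_def)

lemma nn_integral_delta:
  assumes "f \<in> borel_measurable borel"
  shows "(\<integral>\<^sup>+z. f z \<partial>\<delta>) = (\<integral>\<^sup>+(y, u, v). f (u - v) \<partial>M)"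
  unfolding \<delta>_def using nn_integral_distr[OF difference_measurable, of f] assms by (simp add: split_beta')

text \<open>Tonelli is used only for \<open>\<Phi> \<omega>\<close> and the probability measures
  \<open>K \<omega> s\<close>, which are \<sigma>-finite; the identity thus covers transports that
  give infinite mass to \<open>B\<close>.\<close>

lemma square_transport:
  assumes \<omega>: "\<omega> \<in> space P" and B: "B \<in> sets borel"
  shows "(emeasure (transport K \<Phi> \<omega>) B)\<^sup>2
    = (\<integral>\<^sup>+(s, t). (\<integral>\<^sup>+(u, v). indicator B u * indicator B v \<partial>(K2 \<omega> t s)) \<partial>(\<Phi>2 \<omega>))"
proof -
  note S = random_measureD[OF random \<omega>]
  interpret sigma_finite_measure "\<Phi> \<omega>" by (rule S(3))
  have km: "(\<lambda>s. emeasure (K \<omega> s) B) \<in> borel_measurable (\<Phi> \<omega>)"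
    using measurable_compose[OF kernel_measurable_random_measure[OF random kernel \<omega>] measurable_emeasure_subprob_algebra[OF B]] .
  have inner: "(\<integral>\<^sup>+(u, v). indicator B u * indicator B v \<partial>(K2 \<omega> t s)) = emeasure (K \<omega> t) B * emeasure (K \<omega> s) B" for s t
  proof -
    interpret k: prob_space "K \<omega> s" by (rule kernelD(1)[OF \<omega>])
    have "(\<integral>\<^sup>+(u, v). indicator B u * indicator B v \<partial>(K2 \<omega> t s)) = (\<integral>\<^sup>+p. indicator (B \<times> B) p \<partial>(K2 \<omega> t s))"
      by (intro nn_integral_cong) (auto simp: indicator_def)
    also have "\<dots> = emeasure (K2 \<omega> t s) (B \<times> B)"
      by (intro nn_integral_indicator pair_measureI) (simp_all add: kernelD[OF \<omega>] B)
    also have "\<dots> = emeasure (K \<omega> t) B * emeasure (K \<omega> s) B"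
      by (rule k.emeasure_pair_measure_Times) (simp_all add: kernelD[OF \<omega>] B)
    finally show ?thesis .
  qed
  have "(\<integral>\<^sup>+(s, t). (\<integral>\<^sup>+(u, v). indicator B u * indicator B v \<partial>(K2 \<omega> t s)) \<partial>(\<Phi>2 \<omega>))
      = (\<integral>\<^sup>+z. emeasure (K \<omega> (snd z)) B * emeasure (K \<omega> (fst z)) B \<partial>(\<Phi>2 \<omega>))"
    by (simp only: inner[unfolded split_beta'] split_beta')
  also have "\<dots> = (\<integral>\<^sup>+s. \<integral>\<^sup>+t. emeasure (K \<omega> t) B * emeasure (K \<omega> s) B \<partial>\<Phi> \<omega> \<partial>\<Phi> \<omega>)"
    using km by (subst nn_integral_fst[symmetric]) simp_all
  also have "\<dots> = (\<integral>\<^sup>+s. emeasure (transport K \<Phi> \<omega>) B * emeasure (K \<omega> s) B \<partial>\<Phi> \<omega>)"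
    by (simp add: nn_integral_multc[OF km] emeasure_transport[OF random kernel \<omega> B])
  also have "\<dots> = (emeasure (transport K \<Phi> \<omega>) B)\<^sup>2"
    by (simp add: nn_integral_cmult[OF km] emeasure_transport[OF random kernel \<omega> B, symmetric] power2_eq_square)
  finally show ?thesis by simp
qed

text \<open>Two choices of \<open>h\<close> in the second moment formula. The unit cube in the
  position and \<open>B\<close> in the displacement bound \<open>\<delta>\<close> of
  \<open>B\<close> by a mean squared mass. Requiring both points to lie in \<open>B\<close> bounds
  the mean squared mass by the volume of \<open>B\<close> times \<open>\<delta>\<close> of a
  ball.\<close>

lemma locally_square_integrable_iff:
  "locally_square_integrable P (transport K \<Phi>) \<longleftrightarrow> locally_finite_measure \<delta>"
proof
  assume lsi: "locally_square_integrable P (transport K \<Phi>)"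
  show "locally_finite_measure \<delta>"
    unfolding locally_finite_measure_def
  proof (intro conjI ballI impI sets_delta)
    fix B :: "'v set" assume B: "B \<in> sets borel" "bounded B"
    obtain r where r: "0 \<le> r" "\<And>x. x \<in> cbox 0 (One :: 'v) \<Longrightarrow> norm x \<le> r" by (rule bounded_unit_cube) blast
    obtain b where b: "0 < b" "\<And>x. x \<in> B \<Longrightarrow> norm x \<le> b" using B(2) unfolding bounded_pos by blast
    define D where "D = cball (0 :: 'v) (r + b)"
    have D: "D \<in> sets borel" "bounded D" by (auto simp: D_def)
    define h :: "'v \<times> 'v \<Rightarrow> ennreal" where "h p = indicator (cbox 0 One) (fst p) * indicator B (snd p)" for p
    have h: "h \<in> borel_measurable (borel \<Otimes>\<^sub>M borel)"
      unfolding h_def[abs_def] using B(1) by measurable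
    have "emeasure \<delta> B = (\<integral>\<^sup>+(y, u, v). indicator B (u - v) \<partial>M)"
      using nn_integral_delta[of "indicator B"] B(1) by (simp add: sets_delta)
    also have "\<dots> = (\<integral>\<^sup>+(y, u, v). (\<integral>\<^sup>+x. h (x, u - v) \<partial>lborel) \<partial>M)"
      by (intro nn_integral_cong) (simp add: h_def split_beta' nn_integral_multc emeasure_lborel_unit_cube)
    also have "\<dots> = (\<integral>\<^sup>+\<omega>. (\<integral>\<^sup>+(s, t). (\<integral>\<^sup>+(u, v). h (v, u - v) \<partial>(K2 \<omega> t s)) \<partial>(\<Phi>2 \<omega>)) \<partial>P)"
      by (rule second_moment_formula[OF h, symmetric])
    also have "\<dots> \<le> (\<integral>\<^sup>+\<omega>. (emeasure (transport K \<Phi> \<omega>) D)\<^sup>2 \<partial>P)"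
    proof (intro nn_integral_mono)
      fix \<omega> assume \<omega>: "\<omega> \<in> space P"
      have hle: "h (v, u - v) \<le> indicator D u * indicator D v" for u v
      proof -
        have "u \<in> D" "v \<in> D" if "v \<in> cbox 0 One" "u - v \<in> B"
          using r(2)[OF that(1)] b(2)[OF that(2)] b(1) norm_triangle_ineq[of v "u - v"] by (simp_all add: D_def)
        then show ?thesis by (simp add: h_def indicator_def)
      qed
      show "(\<integral>\<^sup>+(s, t). (\<integral>\<^sup>+(u, v). h (v, u - v) \<partial>(K2 \<omega> t s)) \<partial>(\<Phi>2 \<omega>)) \<le> (emeasure (transport K \<Phi> \<omega>) D)\<^sup>2"
        unfolding square_transport[OF \<omega> D(1)] split_beta' using hle by (intro nn_integral_mono) simp
    qed
    also have "\<dots> < \<infinity>" using lsi D unfolding locally_square_integrable_def by blast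
    finally show "emeasure \<delta> B < \<infinity>" .
  qed
next
  assume lf: "locally_finite_measure \<delta>"
  show "locally_square_integrable P (transport K \<Phi>)"
    unfolding locally_square_integrable_def
  proof (intro ballI impI)
    fix B :: "'v set" assume B: "B \<in> sets borel" "bounded B"
    obtain b where b: "\<And>x. x \<in> B \<Longrightarrow> norm x \<le> b" using B(2) unfolding bounded_pos by blast
    define D where "D = cball (0 :: 'v) (b + b)"
    have D: "D \<in> sets borel" "bounded D" by (auto simp: D_def)
    \<comment> \<open>The position \<open>fst p\<close> is that of \<open>v\<close>, and
      \<open>fst p + snd p\<close> is that of \<open>u\<close>. If both lie in \<open>B\<close>, the
      displacement has norm at most \<open>b + b\<close>.\<close>
    define h :: "'v \<times> 'v \<Rightarrow> ennreal" where "h p = indicator B (fst p + snd p) * indicator B (fst p)" for p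
    have h: "h \<in> borel_measurable (borel \<Otimes>\<^sub>M borel)"
      unfolding h_def[abs_def] using B(1) by measurable
    have "(\<integral>\<^sup>+\<omega>. (emeasure (transport K \<Phi> \<omega>) B)\<^sup>2 \<partial>P)
        = (\<integral>\<^sup>+\<omega>. (\<integral>\<^sup>+(s, t). (\<integral>\<^sup>+(u, v). h (v, u - v) \<partial>(K2 \<omega> t s)) \<partial>(\<Phi>2 \<omega>)) \<partial>P)"
      by (intro nn_integral_cong) (simp add: square_transport B h_def)
    also have "\<dots> = (\<integral>\<^sup>+(y, u, v). (\<integral>\<^sup>+x. h (x, u - v) \<partial>lborel) \<partial>M)"
      by (rule second_moment_formula[OF h])
    also have "\<dots> \<le> (\<integral>\<^sup>+(y, u, v). emeasure lborel B * indicator D (u - v) \<partial>M)"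
    proof -
      have "(\<integral>\<^sup>+x. h (x, z) \<partial>lborel) \<le> emeasure lborel B * indicator D z" for z
      proof -
        have "h (x, z) \<le> indicator D z * indicator B x" for x
        proof -
          have "z \<in> D" if "x + z \<in> B" "x \<in> B"
            using b[OF that(1)] b[OF that(2)] norm_triangle_ineq4[of "x + z" x] by (simp add: D_def)
          then show ?thesis by (simp add: h_def indicator_def)
        qed
        then have "(\<integral>\<^sup>+x. h (x, z) \<partial>lborel) \<le> (\<integral>\<^sup>+x. indicator D z * indicator B x \<partial>lborel)"
          by (intro nn_integral_mono)
        also have "\<dots> = indicator D z * emeasure lborel B"
          using B(1) by (simp add: nn_integral_cmult_indicator)
        finally show ?thesis by (simp add: mult.commute)
      qed
      then show ?thesis unfolding split_beta' by (intro nn_integral_mono)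
    qed
    also have "\<dots> = (\<integral>\<^sup>+z. emeasure lborel B * indicator D z \<partial>\<delta>)"
      using D(1) by (subst nn_integral_delta) auto
    also have "\<dots> = emeasure lborel B * emeasure \<delta> D"
      using D(1) by (simp add: nn_integral_cmult_indicator sets_delta)
    also have "\<dots> < \<infinity>"
      using lf D emeasure_bounded_finite[OF B(2)] by (simp add: locally_finite_measure_def ennreal_mult_less_top)
    finally show "(\<integral>\<^sup>+\<omega>. (emeasure (transport K \<Phi> \<omega>) B)\<^sup>2 \<partial>P) < \<infinity>" .
  qed
qed

end

section \<open>The reduced second moment measure of a transport\<close>

context palm_kernel
begin

text \<open>The bind formula is used once for each factor, with a Tonelli exchange in between; that
  exchange is why the transported measure has to be \<sigma>-finite. The coordinates of
  \<open>G\<close> appear swapped because \<open>K2 \<omega> t s\<close> lists the point sent from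
  \<open>t\<close> first.\<close>

lemma nn_integral_transport_pair:
  assumes \<omega>: "\<omega> \<in> space P" and sf: "sigma_finite_measure (transport K \<Phi> \<omega>)"
    and G [measurable]: "G \<in> borel_measurable (borel \<Otimes>\<^sub>M borel)"
  shows "(\<integral>\<^sup>+z. G z \<partial>(transport K \<Phi> \<omega> \<Otimes>\<^sub>M transport K \<Phi> \<omega>))
    = (\<integral>\<^sup>+(s, t). (\<integral>\<^sup>+(u, v). G (v, u) \<partial>(K2 \<omega> t s)) \<partial>(\<Phi>2 \<omega>))"
proof -
  define T where "T = transport K \<Phi> \<omega>"
  note S = random_measureD[OF random \<omega>]
  have sT: "sets T = sets borel" unfolding T_def by (rule sets_transport[OF random kernel \<omega>])
  interpret T: sigma_finite_measure T unfolding T_def by (rule sf)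
  interpret F: sigma_finite_measure "\<Phi> \<omega>" by (rule S(3))
  have mTT: "G \<in> borel_measurable (T \<Otimes>\<^sub>M T)"
    by (simp add: measurable_cong_sets[OF sets_pair_measure_cong[OF sT sT] refl] G)
  have mbT: "G \<in> borel_measurable (borel \<Otimes>\<^sub>M T)"
    by (simp add: measurable_cong_sets[OF sets_pair_measure_cong[OF refl sT] refl] G)
  have "(\<integral>\<^sup>+z. G z \<partial>(T \<Otimes>\<^sub>M T)) = (\<integral>\<^sup>+x. \<integral>\<^sup>+y. G (x, y) \<partial>T \<partial>T)"
    by (rule T.nn_integral_fst[OF mTT, symmetric])
  also have "\<dots> = (\<integral>\<^sup>+s. \<integral>\<^sup>+x. \<integral>\<^sup>+y. G (x, y) \<partial>T \<partial>K \<omega> s \<partial>\<Phi> \<omega>)"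
    unfolding T_def
    by (rule nn_integral_transport[OF random kernel \<omega> T.borel_measurable_nn_integral_fst[OF mbT, unfolded T_def]])
  also have "\<dots> = (\<integral>\<^sup>+s. \<integral>\<^sup>+t. \<integral>\<^sup>+p. G (snd p, fst p) \<partial>(K2 \<omega> t s) \<partial>\<Phi> \<omega> \<partial>\<Phi> \<omega>)"
  proof (intro nn_integral_cong)
    fix s
    interpret k: prob_space "K \<omega> s" by (rule kernelD(1)[OF \<omega>])
    interpret pair_sigma_finite "K \<omega> s" T ..
    note sk = kernelD(2)[OF \<omega>, of s]
    have mkT: "case_prod (\<lambda>x y. G (x, y)) \<in> borel_measurable (K \<omega> s \<Otimes>\<^sub>M T)"
      by (simp add: measurable_cong_sets[OF sets_pair_measure_cong[OF sk sT] refl] G)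
    have mbk: "(\<lambda>(y, x). G (x, y)) \<in> borel_measurable (borel \<Otimes>\<^sub>M K \<omega> s)"
      unfolding measurable_cong_sets[OF sets_pair_measure_cong[OF refl sk] refl] split_beta' by measurable
    have "(\<integral>\<^sup>+x. \<integral>\<^sup>+y. G (x, y) \<partial>T \<partial>K \<omega> s) = (\<integral>\<^sup>+y. \<integral>\<^sup>+x. G (x, y) \<partial>K \<omega> s \<partial>T)"
      by (rule Fubini'[OF mkT, symmetric])
    also have "\<dots> = (\<integral>\<^sup>+t. \<integral>\<^sup>+y. \<integral>\<^sup>+x. G (x, y) \<partial>K \<omega> s \<partial>K \<omega> t \<partial>\<Phi> \<omega>)"
      unfolding T_def
      using k.borel_measurable_nn_integral_fst[OF mbk] by (intro nn_integral_transport[OF random kernel \<omega>]) simp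
    also have "\<dots> = (\<integral>\<^sup>+t. \<integral>\<^sup>+p. G (snd p, fst p) \<partial>(K2 \<omega> t s) \<partial>\<Phi> \<omega>)"
      by (intro nn_integral_cong, subst nn_integral_kernel_pair[OF \<omega>]) simp_all
    finally show "(\<integral>\<^sup>+x. \<integral>\<^sup>+y. G (x, y) \<partial>T \<partial>K \<omega> s) = (\<integral>\<^sup>+t. \<integral>\<^sup>+p. G (snd p, fst p) \<partial>(K2 \<omega> t s) \<partial>\<Phi> \<omega>)" .
  qed
  also have "\<dots> = (\<integral>\<^sup>+z. (\<integral>\<^sup>+p. G (snd p, fst p) \<partial>(K \<omega> (snd z) \<Otimes>\<^sub>M K \<omega> (fst z))) \<partial>(\<Phi>2 \<omega>))"
  proof -
    have km: "K \<omega> \<in> borel \<rightarrow>\<^sub>M subprob_algebra borel"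
      using kernelD(4)[OF \<omega>] by (rule measurable_prob_algebraD)
    have "(\<lambda>z. K \<omega> (snd z) \<Otimes>\<^sub>M K \<omega> (fst z)) \<in> borel \<Otimes>\<^sub>M borel \<rightarrow>\<^sub>M subprob_algebra (borel \<Otimes>\<^sub>M borel)"
      using measurable_compose[OF measurable_snd km] measurable_compose[OF measurable_fst km]
      by (rule measurable_pair_measure)
    then have "(\<lambda>z. (\<integral>\<^sup>+p. G (snd p, fst p) \<partial>(K \<omega> (snd z) \<Otimes>\<^sub>M K \<omega> (fst z)))) \<in> borel_measurable (borel \<Otimes>\<^sub>M borel)"
      by (rule nn_integral_measurable_subprob_algebra2[rotated]) measurable
    then have "(\<lambda>z. (\<integral>\<^sup>+p. G (snd p, fst p) \<partial>(K \<omega> (snd z) \<Otimes>\<^sub>M K \<omega> (fst z)))) \<in> borel_measurable (\<Phi>2 \<omega>)"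
      by (simp add: measurable_cong_sets[OF sets_pair_measure_cong[OF S(1) S(1)] refl])
    from F.nn_integral_fst[OF this] show ?thesis by simp
  qed
  finally show ?thesis by (simp add: T_def split_beta')
qed

text \<open>Finite mean squares make the mass of each ball of integer radius almost surely finite,
  and countably many balls can be treated simultaneously. The bound is one in mean, so the
  conclusion is only almost sure.\<close>

lemma AE_sigma_finite_transport:
  assumes "locally_square_integrable P (transport K \<Phi>)"
  shows "AE \<omega> in P. sigma_finite_measure (transport K \<Phi> \<omega>)"
proof -
  have ae: "AE \<omega> in P. \<forall>n::nat. (emeasure (transport K \<Phi> \<omega>) (ball 0 (real n)))\<^sup>2 \<noteq> \<infinity>"
    unfolding AE_all_countable
  proof
    fix n :: nat
    have m [measurable]: "(\<lambda>\<omega>. emeasure (transport K \<Phi> \<omega>) (ball 0 (real n))) \<in> borel_measurable P"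
      by (rule emeasure_transport_measurable[OF random kernel]) simp
    have "(\<integral>\<^sup>+\<omega>. (emeasure (transport K \<Phi> \<omega>) (ball 0 (real n)))\<^sup>2 \<partial>P) < \<infinity>"
      using assms by (simp add: locally_square_integrable_def)
    then show "AE \<omega> in P. (emeasure (transport K \<Phi> \<omega>) (ball 0 (real n)))\<^sup>2 \<noteq> \<infinity>"
      by (intro nn_integral_PInf_AE) (auto simp: less_top)
  qed
  have sf: "sigma_finite_measure (transport K \<Phi> \<omega>)"
    if "\<omega> \<in> space P" "\<forall>n::nat. (emeasure (transport K \<Phi> \<omega>) (ball 0 (real n)))\<^sup>2 \<noteq> \<infinity>" for \<omega>
  proof
    have "(\<Union>n::nat. ball 0 (real n)) = (UNIV :: 'v set)"
      using reals_Archimedean2 by auto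
    moreover have "emeasure (transport K \<Phi> \<omega>) (ball 0 (real n)) \<noteq> \<infinity>" for n
      using that(2)[rule_format, of n] by (auto simp: power2_eq_square ennreal_mult_eq_top_iff)
    ultimately show "\<exists>A. countable A \<and> A \<subseteq> sets (transport K \<Phi> \<omega>) \<and> \<Union> A = space (transport K \<Phi> \<omega>) \<and> (\<forall>a\<in>A. emeasure (transport K \<Phi> \<omega>) a \<noteq> \<infinity>)"
      by (intro exI[of _ "range (\<lambda>n::nat. ball 0 (real n))"]) (auto simp: sets_transport[OF random kernel that(1)])
  qed
  show ?thesis
    using ae AE_space
  proof eventually_elim
    case (elim \<omega>)
    from sf[OF elim(2,1)] show ?case .
  qed
qed

text \<open>The defining set function agrees on Borel sets with \<open>emeasure \<delta>\<close>,
  hence is a measure, and \<open>measure_of\<close> returns \<open>\<delta>\<close> itself. The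
  product integral is rewritten almost everywhere only, where the transport is
  \<sigma>-finite.\<close>

lemma reduced_second_moment_transport:
  assumes lsi: "locally_square_integrable P (transport K \<Phi>)"
  shows "reduced_second_moment P (transport K \<Phi>) = \<delta>"
proof -
  have eq: "(\<integral>\<^sup>+\<omega>. (\<integral>\<^sup>+(x, y). indicator (cbox 0 One) x * indicator B (y - x) \<partial>(transport K \<Phi> \<omega> \<Otimes>\<^sub>M transport K \<Phi> \<omega>)) \<partial>P) = emeasure \<delta> B"
    if B [measurable]: "B \<in> sets borel" for B :: "'v set"
  proof -
    define h :: "'v \<times> 'v \<Rightarrow> ennreal" where "h p = indicator (cbox 0 One) (fst p) * indicator B (snd p)" for p
    have h: "h \<in> borel_measurable (borel \<Otimes>\<^sub>M borel)"
      unfolding h_def[abs_def] by measurable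
    \<comment> \<open>The same condition as \<open>h\<close>, in terms of two positions instead of a
      position and a displacement.\<close>
    define G :: "'v \<times> 'v \<Rightarrow> ennreal" where "G p = indicator (cbox 0 One) (fst p) * indicator B (snd p - fst p)" for p
    have G: "G \<in> borel_measurable (borel \<Otimes>\<^sub>M borel)"
      unfolding G_def[abs_def] by measurable
    have "(\<integral>\<^sup>+\<omega>. (\<integral>\<^sup>+(x, y). indicator (cbox 0 One) x * indicator B (y - x) \<partial>(transport K \<Phi> \<omega> \<Otimes>\<^sub>M transport K \<Phi> \<omega>)) \<partial>P)
      = (\<integral>\<^sup>+\<omega>. (\<integral>\<^sup>+(s, t). (\<integral>\<^sup>+(u, v). h (v, u - v) \<partial>(K2 \<omega> t s)) \<partial>(\<Phi>2 \<omega>)) \<partial>P)"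
    proof (rule nn_integral_cong_AE)
      show "AE \<omega> in P. (\<integral>\<^sup>+(x, y). indicator (cbox 0 One) x * indicator B (y - x) \<partial>(transport K \<Phi> \<omega> \<Otimes>\<^sub>M transport K \<Phi> \<omega>))
        = (\<integral>\<^sup>+(s, t). (\<integral>\<^sup>+(u, v). h (v, u - v) \<partial>(K2 \<omega> t s)) \<partial>(\<Phi>2 \<omega>))"
        using AE_sigma_finite_transport[OF lsi] AE_space
      proof eventually_elim
        case (elim \<omega>)
        from nn_integral_transport_pair[OF elim(2,1) G] show ?case
          by (simp add: G_def h_def split_beta')
      qed
    qed
    also have "\<dots> = (\<integral>\<^sup>+(y, u, v). (\<integral>\<^sup>+x. h (x, u - v) \<partial>lborel) \<partial>M)"
      by (rule second_moment_formula[OF h])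
    also have "\<dots> = (\<integral>\<^sup>+(y, u, v). indicator B (u - v) \<partial>M)"
      by (intro nn_integral_cong) (simp add: h_def split_beta' nn_integral_multc emeasure_lborel_unit_cube)
    also have "\<dots> = emeasure \<delta> B"
      using nn_integral_delta[of "indicator B"] by (simp add: sets_delta)
    finally show ?thesis .
  qed
  have "reduced_second_moment P (transport K \<Phi>) = measure_of UNIV (sets borel) (emeasure \<delta>)"
    unfolding reduced_second_moment_def
    by (rule measure_of_eq) (auto simp: eq sets.sigma_sets_eq[of borel, simplified])
  also have "\<dots> = \<delta>"
    using measure_of_of_measure[of \<delta>] sets_eq_imp_space_eq[OF sets_delta] by (simp add: sets_delta)
  finally show ?thesis .
qed

section \<open>Mass transport and preservation of the intensity\<close>

lemma flow_random_measure:
  assumes \<omega>: "\<omega> \<in> space P"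
  shows "\<Phi> (\<theta> t \<omega>) = distr (\<Phi> \<omega>) borel (\<lambda>x. x - t)"
proof (rule measure_eqI)
  note S = random_measureD[OF random \<omega>] and S' = random_measureD[OF random flow_space[OF \<omega>]]
  show "sets (\<Phi> (\<theta> t \<omega>)) = sets (distr (\<Phi> \<omega>) borel (\<lambda>x. x - t))" by (simp add: S')
  fix B assume "B \<in> sets (\<Phi> (\<theta> t \<omega>))"
  then have B: "B \<in> sets borel" by (simp add: S')
  have "(\<lambda>x. x - t) -` B = (\<lambda>b. b + t) ` B"
    by (auto simp: image_iff intro!: bexI[of _ "_ - t"])
  then show "emeasure (\<Phi> (\<theta> t \<omega>)) B = emeasure (distr (\<Phi> \<omega>) borel (\<lambda>x. x - t)) B"
    using B invariant \<omega>
    by (subst emeasure_distr) (simp_all add: S measurable_cong_sets[OF S(1) refl] invariant_measure_def)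
qed

lemma nn_integral_flow_random_measure:
  assumes \<omega>: "\<omega> \<in> space P" and g: "g \<in> borel_measurable borel"
  shows "(\<integral>\<^sup>+x. g x \<partial>\<Phi> (\<theta> t \<omega>)) = (\<integral>\<^sup>+x. g (x - t) \<partial>\<Phi> \<omega>)"
  unfolding flow_random_measure[OF \<omega>]
  by (rule nn_integral_distr) (simp_all add: g measurable_cong_sets[OF random_measureD(1)[OF random \<omega>] refl])

text \<open>Regarding \<Phi> as a random measure over pairs \<open>(t, \<omega>)\<close> gives the
  joint measurability for the outer exchange. The inner exchange is made for fixed \<omega>, with
  the \<sigma>-finite measure \<open>\<Phi> \<omega>\<close>.\<close>

lemma nn_integral_lborel_random_measure_swap:
  fixes f :: "'v \<Rightarrow> 'w \<Rightarrow> 'v \<Rightarrow> ennreal"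
  assumes f: "(\<lambda>((t, \<omega>), s). f t \<omega> s) \<in> borel_measurable ((borel \<Otimes>\<^sub>M P) \<Otimes>\<^sub>M borel)"
  shows "(\<integral>\<^sup>+t. \<integral>\<^sup>+\<omega>. \<integral>\<^sup>+s. f t \<omega> s \<partial>\<Phi> \<omega> \<partial>P \<partial>lborel) = (\<integral>\<^sup>+\<omega>. \<integral>\<^sup>+s. \<integral>\<^sup>+t. f t \<omega> s \<partial>lborel \<partial>\<Phi> \<omega> \<partial>P)"
proof -
  interpret pp: pair_sigma_finite "lborel :: 'v measure" P ..
  have rm: "random_measure (borel \<Otimes>\<^sub>M P) (\<lambda>z. \<Phi> (snd z))"
    using random unfolding random_measure_def
    by (auto simp: space_pair_measure intro: measurable_compose[OF measurable_snd])
  have "(\<lambda>z. \<integral>\<^sup>+s. f (fst z) (snd z) s \<partial>\<Phi> (snd z)) \<in> borel_measurable (borel \<Otimes>\<^sub>M P)"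
    by (rule nn_integral_random_measure_measurable[OF rm]) (use f in \<open>simp add: split_beta'\<close>)
  then have "case_prod (\<lambda>t \<omega>. \<integral>\<^sup>+s. f t \<omega> s \<partial>\<Phi> \<omega>) \<in> borel_measurable (lborel \<Otimes>\<^sub>M P)"
    by (simp add: split_beta' measurable_cong_sets[OF sets_pair_measure_cong[OF sets_lborel refl] refl])
  from pp.Fubini'[OF this]
  have "(\<integral>\<^sup>+t. \<integral>\<^sup>+\<omega>. \<integral>\<^sup>+s. f t \<omega> s \<partial>\<Phi> \<omega> \<partial>P \<partial>lborel) = (\<integral>\<^sup>+\<omega>. \<integral>\<^sup>+t. \<integral>\<^sup>+s. f t \<omega> s \<partial>\<Phi> \<omega> \<partial>lborel \<partial>P)"
    by (rule sym)
  also have "\<dots> = (\<integral>\<^sup>+\<omega>. \<integral>\<^sup>+s. \<integral>\<^sup>+t. f t \<omega> s \<partial>lborel \<partial>\<Phi> \<omega> \<partial>P)"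
  proof (intro nn_integral_cong)
    fix \<omega> assume \<omega>: "\<omega> \<in> space P"
    interpret F: sigma_finite_measure "\<Phi> \<omega>" by (rule random_measureD(3)[OF random \<omega>])
    interpret qq: pair_sigma_finite "\<Phi> \<omega>" "lborel :: 'v measure" ..
    have "(\<lambda>p. ((snd p, \<omega>), fst p)) \<in> borel \<Otimes>\<^sub>M borel \<rightarrow>\<^sub>M (borel \<Otimes>\<^sub>M P) \<Otimes>\<^sub>M borel"
      using \<omega> by measurable
    from measurable_compose[OF this f]
    have "case_prod (\<lambda>s t. f t \<omega> s) \<in> borel_measurable (\<Phi> \<omega> \<Otimes>\<^sub>M lborel)"
      by (simp add: split_beta' measurable_cong_sets[OF sets_pair_measure_cong[OF random_measureD(1)[OF random \<omega>] sets_lborel] refl])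
    from qq.Fubini'[OF this] show "(\<integral>\<^sup>+t. \<integral>\<^sup>+s. f t \<omega> s \<partial>\<Phi> \<omega> \<partial>lborel) = (\<integral>\<^sup>+s. \<integral>\<^sup>+t. f t \<omega> s \<partial>lborel \<partial>\<Phi> \<omega>)" .
  qed
  finally show ?thesis .
qed

text \<open>A mass-transport argument: the factor \<open>1 = \<integral> indicator (cbox 0 One) (s + t) dt\<close> is inserted,
  the flow is used to move \<open>s + t\<close> to \<open>s\<close>, and the integral over \<open>t\<close> then removes the kernel.\<close>

lemma intensity_transport: "intensity P (transport K \<Phi>) = intensity P \<Phi>"
proof -
  define C where "C = cbox 0 (One :: 'v)"
  have C [measurable]: "C \<in> sets borel" by (simp add: C_def)
  have C1: "emeasure lborel C = 1" by (simp add: C_def emeasure_lborel_unit_cube)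
  have km: "(\<lambda>(\<omega>, x). K \<omega> x) \<in> P \<Otimes>\<^sub>M borel \<rightarrow>\<^sub>M subprob_algebra borel"
    using kernel unfolding probability_kernel_def by (rule measurable_prob_algebraD)
  have km': "(\<lambda>z. K (snd (fst z)) (snd z)) \<in> (borel \<Otimes>\<^sub>M P) \<Otimes>\<^sub>M borel \<rightarrow>\<^sub>M subprob_algebra borel"
    using measurable_compose[OF measurable_Pair[OF measurable_compose[OF measurable_fst measurable_snd] measurable_snd] km] by simp
  have K1: "K \<omega> \<in> borel \<rightarrow>\<^sub>M subprob_algebra borel" if "\<omega> \<in> space P" for \<omega>
    using kernelD(4)[OF that] by (rule measurable_prob_algebraD)
  have m1: "(\<lambda>((t, \<omega>), s). indicator C (s + t) * emeasure (K \<omega> s) C) \<in> borel_measurable ((borel \<Otimes>\<^sub>M P) \<Otimes>\<^sub>M borel)"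
    unfolding split_beta' using measurable_compose[OF km' measurable_emeasure_subprob_algebra[OF C]] by measurable
  have m2: "(\<lambda>((t, \<omega>), s). indicator C s * (\<integral>\<^sup>+v. indicator C (v - t) \<partial>K \<omega> s)) \<in> borel_measurable ((borel \<Otimes>\<^sub>M P) \<Otimes>\<^sub>M borel)"
  proof -
    have "(\<lambda>(z, v). indicator C (v - fst (fst z))) \<in> borel_measurable (((borel \<Otimes>\<^sub>M P) \<Otimes>\<^sub>M borel) \<Otimes>\<^sub>M borel)"
      unfolding split_beta' by measurable
    from nn_integral_measurable_subprob_algebra2[OF this km'] show ?thesis
      unfolding split_beta' by measurable
  qed
  have "intensity P (transport K \<Phi>) = (\<integral>\<^sup>+\<omega>. \<integral>\<^sup>+s. emeasure (K \<omega> s) C \<partial>\<Phi> \<omega> \<partial>P)"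
    unfolding intensity_def C_def by (intro nn_integral_cong emeasure_transport[OF random kernel]) auto
  also have "\<dots> = (\<integral>\<^sup>+\<omega>. \<integral>\<^sup>+s. \<integral>\<^sup>+t. indicator C (s + t) * emeasure (K \<omega> s) C \<partial>lborel \<partial>\<Phi> \<omega> \<partial>P)"
  proof (intro nn_integral_cong)
    fix \<omega> s
    have "(\<integral>\<^sup>+t. indicator C (s + t) \<partial>lborel) = (\<integral>\<^sup>+t. indicator C t \<partial>lborel)"
      using nn_integral_lborel_translate[of "indicator C" s] by (simp add: add.commute)
    then have "(\<integral>\<^sup>+t. indicator C (s + t) \<partial>lborel) = 1" by (simp add: C1)
    then show "emeasure (K \<omega> s) C = (\<integral>\<^sup>+t. indicator C (s + t) * emeasure (K \<omega> s) C \<partial>lborel)"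
      by (subst nn_integral_multc) simp_all
  qed
  also have "\<dots> = (\<integral>\<^sup>+t. \<integral>\<^sup>+\<omega>. \<integral>\<^sup>+s. indicator C (s + t) * emeasure (K \<omega> s) C \<partial>\<Phi> \<omega> \<partial>P \<partial>lborel)"
    by (rule nn_integral_lborel_random_measure_swap[OF m1, symmetric])
  also have "\<dots> = (\<integral>\<^sup>+t. \<integral>\<^sup>+\<omega>. \<integral>\<^sup>+s. indicator C s * (\<integral>\<^sup>+v. indicator C (v - t) \<partial>K \<omega> s) \<partial>\<Phi> \<omega> \<partial>P \<partial>lborel)"
  proof (rule nn_integral_cong)
    fix t :: 'v
    have f: "(\<lambda>\<omega>. \<integral>\<^sup>+s. indicator C (s + t) * emeasure (K \<omega> s) C \<partial>\<Phi> \<omega>) \<in> borel_measurable P"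
      by (rule nn_integral_random_measure_measurable[OF random])
        (use measurable_compose[OF km measurable_emeasure_subprob_algebra[OF C]] in \<open>simp add: split_beta'\<close>)
    have "(\<integral>\<^sup>+\<omega>. \<integral>\<^sup>+s. indicator C (s + t) * emeasure (K \<omega> s) C \<partial>\<Phi> \<omega> \<partial>P)
        = (\<integral>\<^sup>+\<omega>. \<integral>\<^sup>+s. indicator C (s + t) * emeasure (K (\<theta> t \<omega>) s) C \<partial>\<Phi> (\<theta> t \<omega>) \<partial>P)"
      by (rule nn_integral_flow[OF f, symmetric])
    also have "\<dots> = (\<integral>\<^sup>+\<omega>. \<integral>\<^sup>+s. indicator C s * (\<integral>\<^sup>+v. indicator C (v - t) \<partial>K \<omega> s) \<partial>\<Phi> \<omega> \<partial>P)"
    proof (rule nn_integral_cong)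
      fix \<omega> assume \<omega>: "\<omega> \<in> space P"
      note \<omega>' = flow_space[OF \<omega>, of t]
      have "(\<lambda>s. indicator C (s + t) * emeasure (K (\<theta> t \<omega>) s) C) \<in> borel_measurable borel"
        using measurable_compose[OF K1[OF \<omega>'] measurable_emeasure_subprob_algebra[OF C]] by measurable
      from nn_integral_flow_random_measure[OF \<omega> this, of t]
      have "(\<integral>\<^sup>+s. indicator C (s + t) * emeasure (K (\<theta> t \<omega>) s) C \<partial>\<Phi> (\<theta> t \<omega>))
          = (\<integral>\<^sup>+s. indicator C s * emeasure (K (\<theta> t \<omega>) (s - t)) C \<partial>\<Phi> \<omega>)" by simp
      also have "\<dots> = (\<integral>\<^sup>+s. indicator C s * (\<integral>\<^sup>+v. indicator C (v - t) \<partial>K \<omega> s) \<partial>\<Phi> \<omega>)"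
      proof (intro nn_integral_cong arg_cong2[where f=times] refl)
        fix s
        have "(\<integral>\<^sup>+v. indicator C (v - t) \<partial>K \<omega> s) = (\<integral>\<^sup>+v. indicator C v \<partial>K (\<theta> t \<omega>) (s - t))"
          by (subst nn_integral_kernel_shift[OF \<omega>, of _ _ t]) simp_all
        then show "emeasure (K (\<theta> t \<omega>) (s - t)) C = (\<integral>\<^sup>+v. indicator C (v - t) \<partial>K \<omega> s)"
          by (simp add: kernelD[OF \<omega>'])
      qed
      finally show "(\<integral>\<^sup>+s. indicator C (s + t) * emeasure (K (\<theta> t \<omega>) s) C \<partial>\<Phi> (\<theta> t \<omega>))
          = (\<integral>\<^sup>+s. indicator C s * (\<integral>\<^sup>+v. indicator C (v - t) \<partial>K \<omega> s) \<partial>\<Phi> \<omega>)" .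
    qed
    finally show "(\<integral>\<^sup>+\<omega>. \<integral>\<^sup>+s. indicator C (s + t) * emeasure (K \<omega> s) C \<partial>\<Phi> \<omega> \<partial>P)
      = (\<integral>\<^sup>+\<omega>. \<integral>\<^sup>+s. indicator C s * (\<integral>\<^sup>+v. indicator C (v - t) \<partial>K \<omega> s) \<partial>\<Phi> \<omega> \<partial>P)" .
  qed
  also have "\<dots> = (\<integral>\<^sup>+\<omega>. \<integral>\<^sup>+s. \<integral>\<^sup>+t. indicator C s * (\<integral>\<^sup>+v. indicator C (v - t) \<partial>K \<omega> s) \<partial>lborel \<partial>\<Phi> \<omega> \<partial>P)"
    by (rule nn_integral_lborel_random_measure_swap[OF m2])
  also have "\<dots> = (\<integral>\<^sup>+\<omega>. \<integral>\<^sup>+s. indicator C s \<partial>\<Phi> \<omega> \<partial>P)"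
  proof (intro nn_integral_cong)
    fix \<omega> s assume \<omega>: "\<omega> \<in> space P"
    interpret k: prob_space "K \<omega> s" by (rule kernelD(1)[OF \<omega>])
    interpret kl: pair_sigma_finite "K \<omega> s" "lborel :: 'v measure" ..
    note sk = kernelD(2)[OF \<omega>, of s]
    have m: "case_prod (\<lambda>v t. indicator C (v - t)) \<in> borel_measurable (K \<omega> s \<Otimes>\<^sub>M lborel)"
      unfolding measurable_cong_sets[OF sets_pair_measure_cong[OF sk sets_lborel] refl] split_beta' by measurable
    have "(\<lambda>(t, v). indicator C (v - t)) \<in> borel_measurable (lborel \<Otimes>\<^sub>M K \<omega> s)"
      unfolding measurable_cong_sets[OF sets_pair_measure_cong[OF sets_lborel sk] refl] split_beta' by measurable
    from k.borel_measurable_nn_integral_fst[OF this]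
    have "(\<lambda>t. \<integral>\<^sup>+v. indicator C (v - t) \<partial>K \<omega> s) \<in> borel_measurable lborel" by simp
    then have "(\<integral>\<^sup>+t. indicator C s * (\<integral>\<^sup>+v. indicator C (v - t) \<partial>K \<omega> s) \<partial>lborel)
        = indicator C s * (\<integral>\<^sup>+t. \<integral>\<^sup>+v. indicator C (v - t) \<partial>K \<omega> s \<partial>lborel)"
      by (rule nn_integral_cmult)
    also have "(\<integral>\<^sup>+t. \<integral>\<^sup>+v. indicator C (v - t) \<partial>K \<omega> s \<partial>lborel) = (\<integral>\<^sup>+v. \<integral>\<^sup>+t. indicator C (v - t) \<partial>lborel \<partial>K \<omega> s)"
      by (rule kl.Fubini'[OF m])
    also have "\<dots> = (\<integral>\<^sup>+v. 1 \<partial>K \<omega> s)"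
      using nn_integral_lborel_reflect[of "indicator C"] by (intro nn_integral_cong) (simp add: C1)
    also have "\<dots> = 1" by (simp add: k.emeasure_space_1)
    finally show "(\<integral>\<^sup>+t. indicator C s * (\<integral>\<^sup>+v. indicator C (v - t) \<partial>K \<omega> s) \<partial>lborel) = indicator C s" by simp
  qed
  also have "\<dots> = intensity P \<Phi>"
    unfolding intensity_def C_def[symmetric]
    by (intro nn_integral_cong nn_integral_indicator) (simp add: random_measureD[OF random])
  finally show ?thesis .
qed

end

section \<open>Comparison of two transports\<close>

text \<open>Restriction in the form of a density keeps \<open>space\<close> and \<open>sets\<close>,
  so restricted measures can still be added and compared.\<close>

definition cut :: "'a measure \<Rightarrow> 'a set \<Rightarrow> 'a measure" where
  "cut M S = density M (\<lambda>x. ennreal (indicator S x))"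

lemma sets_cut [simp]: "sets (cut M S) = sets M" and space_cut [simp]: "space (cut M S) = space M"
  by (simp_all add: cut_def)

lemma emeasure_cut:
  assumes "S \<in> sets M" "B \<in> sets M" shows "emeasure (cut M S) B = emeasure M (S \<inter> B)"
  using emeasure_restricted[OF assms] by (simp add: cut_def ennreal_indicator)

lemma finite_measure_cut:
  assumes "S \<in> sets M" "emeasure M S < \<infinity>" shows "finite_measure (cut M S)"
  using assms sets.sets_into_space[OF assms(1)]
  by (intro finite_measureI) (simp add: emeasure_cut Int_absorb2)

lemma measure_cut:
  assumes "S \<in> sets M" "B \<in> sets M" shows "measure (cut M S) B = measure M (S \<inter> B)"
  using emeasure_cut[OF assms] by (simp add: measure_def)

lemma integral_cut:
  fixes f :: "'a \<Rightarrow> 'b::{banach, second_countable_topology}"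
  assumes "S \<in> sets M" "f \<in> borel_measurable M"
  shows "(LINT x|cut M S. f x) = (LINT x|M. indicator S x *\<^sub>R f x)"
  unfolding cut_def using assms by (intro integral_density) auto

section \<open>Control of the moment laws by \<open>kappa\<close>\<close>

locale palm_comparison = K: palm_kernel P \<theta> \<Phi> Q K + L: palm_kernel P \<theta> \<Phi> Q L
  for P :: "'w measure" and \<theta> :: "'v::euclidean_space \<Rightarrow> 'w \<Rightarrow> 'w" and \<Phi> Q K L +
  assumes kappa_finite: "(\<integral>\<^sup>+y. kappa Q K L y \<partial>reduced_second_moment P \<Phi>) < \<infinity>"
begin

abbreviation "\<alpha> \<equiv> reduced_second_moment P \<Phi>"
abbreviation "\<kappa> \<equiv> (\<integral>\<^sup>+y. kappa Q K L y \<partial>\<alpha>)"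

lemma palm_law_prob:
  "prob_space (palm_law Q K y)" "prob_space (palm_law Q L y)"
  "sets (palm_law Q K y) = sets (borel \<Otimes>\<^sub>M borel)" "sets (palm_law Q L y) = sets (borel \<Otimes>\<^sub>M borel)"
  using measurable_space[OF K.N_measurable, of y] measurable_space[OF L.N_measurable, of y]
  by (simp_all add: space_prob_algebra)

text \<open>By the mixture formula for \<open>palm_law\<close> the expected difference is a
  difference of two probability measures, the kind of representation from which signed integrals can
  be evaluated.\<close>

lemma palm_difference_eq:
  assumes B: "B \<in> sets (borel \<Otimes>\<^sub>M borel)"
  shows "palm_difference Q K L y B = measure (palm_law Q K y) B - measure (palm_law Q L y) B"
proof -
  interpret q: prob_space "Q y"
    using measurable_space[OF K.Q_measurable, of y] by (simp add: space_prob_algebra)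
  have *: "integrable (Q y) (\<lambda>\<omega>. measure (H \<omega> y \<Otimes>\<^sub>M H \<omega> 0) B)"
    "(LINT \<omega>|Q y. measure (H \<omega> y \<Otimes>\<^sub>M H \<omega> 0) B) = measure (palm_law Q H y) B"
    if H: "probability_kernel P H" for H
  proof -
    note m = palm_law_kernel[OF K.Q_measurable H, of y]
    show "(LINT \<omega>|Q y. measure (H \<omega> y \<Otimes>\<^sub>M H \<omega> 0) B) = measure (palm_law Q H y) B"
      unfolding palm_law_def by (rule q.measure_bind[OF m B, symmetric])
    show "integrable (Q y) (\<lambda>\<omega>. measure (H \<omega> y \<Otimes>\<^sub>M H \<omega> 0) B)"
    proof (rule q.integrable_const_bound[where B=1])
      show "(\<lambda>\<omega>. measure (H \<omega> y \<Otimes>\<^sub>M H \<omega> 0) B) \<in> borel_measurable (Q y)"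
        using measurable_compose[OF m measurable_measure_subprob_algebra[OF B]] .
      show "AE \<omega> in Q y. norm (measure (H \<omega> y \<Otimes>\<^sub>M H \<omega> 0) B) \<le> 1"
        using measurable_space[OF m]
        by (intro AE_I2) (auto simp: space_subprob_algebra intro: subprob_space.subprob_measure_le_1)
    qed
  qed
  show ?thesis
    unfolding palm_difference_def
    using *[OF K.kernel] *[OF L.kernel] by simp
qed

text \<open>The function itself is admissible in the supremum that defines \<open>tv_norm\<close>,
  and its signed integral is the difference of the two means.\<close>

lemma kappa_bound:
  assumes f: "f \<in> borel_measurable (borel \<Otimes>\<^sub>M borel)" and f1: "\<And>p. \<bar>f p\<bar> \<le> (1::real)"
  shows "ennreal \<bar>(LINT p|palm_law Q K y. f p) - (LINT p|palm_law Q L y. f p)\<bar> \<le> kappa Q K L y"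
proof -
  interpret k: prob_space "palm_law Q K y" by (rule palm_law_prob)
  interpret l: prob_space "palm_law Q L y" by (rule palm_law_prob)
  have "signed_integral (borel \<Otimes>\<^sub>M borel) (palm_difference Q K L y) f = (LINT p|palm_law Q K y. f p) - (LINT p|palm_law Q L y. f p)"
    by (rule signed_integral_diff[OF k.finite_measure_axioms l.finite_measure_axioms palm_law_prob(3,4) palm_difference_eq f, where C=1])
      (simp_all add: f1)
  then show ?thesis
    unfolding kappa_def tv_norm_def using f f1
    by (intro SUP_upper2[of f]) (auto simp: abs_le_iff minus_le_iff)
qed

lemma palm_law_section_measurable:
  assumes N: "N \<in> borel \<rightarrow>\<^sub>M prob_algebra (borel \<Otimes>\<^sub>M borel)" and X: "X \<in> sets borel3"
  shows "(\<lambda>y. \<integral>\<^sup>+p. indicator X (y, p) \<partial>N y) \<in> borel_measurable borel"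
  by (rule nn_integral_measurable_subprob_algebra2[OF _ measurable_prob_algebraD[OF N]])
    (use borel_measurable_indicator[OF X] in simp)

lemma emeasure_moment_law:
  assumes N: "N \<in> borel \<rightarrow>\<^sub>M prob_algebra (borel \<Otimes>\<^sub>M borel)" and X: "X \<in> sets borel3"
    and \<beta>: "sets \<beta> = sets borel"
  shows "emeasure (moment_law \<beta> N) X = (\<integral>\<^sup>+y. \<integral>\<^sup>+p. indicator X (y, p) \<partial>N y \<partial>\<beta>)"
  using nn_integral_moment_law[OF N \<beta> borel_measurable_indicator[OF X]] X
  by (simp add: sets_moment_law[OF \<beta>])

text \<open>Both directions are stated because subtraction in \<open>ennreal\<close> is truncated:
  for each \<open>y\<close> at least one of the two differences is \<open>0\<close>.\<close>

lemma section_bound: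
  assumes X: "X \<in> sets borel3"
  shows "(\<integral>\<^sup>+p. indicator X (y, p) \<partial>palm_law Q K y) - (\<integral>\<^sup>+p. indicator X (y, p) \<partial>palm_law Q L y) \<le> kappa Q K L y"
    and "(\<integral>\<^sup>+p. indicator X (y, p) \<partial>palm_law Q L y) - (\<integral>\<^sup>+p. indicator X (y, p) \<partial>palm_law Q K y) \<le> kappa Q K L y"
proof -
  interpret k: prob_space "palm_law Q K y" by (rule palm_law_prob)
  interpret l: prob_space "palm_law Q L y" by (rule palm_law_prob)
  define f where "f p = (indicator X (y, p) :: real)" for p
  have f: "f \<in> borel_measurable (borel \<Otimes>\<^sub>M borel)"
    unfolding f_def[abs_def] using measurable_compose[OF measurable_Pair1' borel_measurable_indicator[OF X], of y] by simp
  have nn: "(\<integral>\<^sup>+p. indicator X (y, p) \<partial>R) = ennreal (LINT p|R. f p)" "0 \<le> (LINT p|R. f p)"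
    if "finite_measure R" "sets R = sets (borel \<Otimes>\<^sub>M borel)" for R
  proof -
    have "integrable R f"
      by (rule integrable_bounded_finite[where C=1])
        (simp_all add: that f_def[abs_def] measurable_cong_sets[OF that(2) refl] f[unfolded f_def[abs_def]])
    then have "(\<integral>\<^sup>+p. ennreal (f p) \<partial>R) = ennreal (LINT p|R. f p)"
      by (rule nn_integral_eq_integral) (simp add: f_def)
    then show "(\<integral>\<^sup>+p. indicator X (y, p) \<partial>R) = ennreal (LINT p|R. f p)" by (simp add: f_def ennreal_indicator)
    show "0 \<le> (LINT p|R. f p)" by (rule integral_nonneg_AE) (simp add: f_def)
  qed
  note nk = nn[OF k.finite_measure_axioms palm_law_prob(3)] and nl = nn[OF l.finite_measure_axioms palm_law_prob(4)]
  have b: "ennreal \<bar>(LINT p|palm_law Q K y. f p) - (LINT p|palm_law Q L y. f p)\<bar> \<le> kappa Q K L y"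
    by (rule kappa_bound[OF f]) (simp add: f_def)
  show "(\<integral>\<^sup>+p. indicator X (y, p) \<partial>palm_law Q K y) - (\<integral>\<^sup>+p. indicator X (y, p) \<partial>palm_law Q L y) \<le> kappa Q K L y"
    unfolding nk(1) nl(1) using order_trans[OF ennreal_leI[OF abs_ge_self] b] by (simp add: ennreal_minus nl(2))
  have "(LINT p|palm_law Q L y. f p) - (LINT p|palm_law Q K y. f p) \<le> \<bar>(LINT p|palm_law Q K y. f p) - (LINT p|palm_law Q L y. f p)\<bar>"
    by simp
  from order_trans[OF ennreal_leI[OF this] b]
  show "(\<integral>\<^sup>+p. indicator X (y, p) \<partial>palm_law Q L y) - (\<integral>\<^sup>+p. indicator X (y, p) \<partial>palm_law Q K y) \<le> kappa Q K L y"
    unfolding nk(1) nl(1) by (simp add: ennreal_minus nk(2))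
qed

text \<open>\<open>kappa\<close> need not be measurable, so it is only used to dominate measurable functions.\<close>

lemma nn_integral_le_add_kappa:
  assumes m: "f \<in> borel_measurable \<alpha>" "g \<in> borel_measurable \<alpha>"
    and le: "\<And>y. f y - g y \<le> kappa Q K L y"
  shows "(\<integral>\<^sup>+y. f y \<partial>\<alpha>) \<le> (\<integral>\<^sup>+y. g y \<partial>\<alpha>) + \<kappa>"
proof -
  have "f y \<le> g y + (f y - g y)" for y
    by (cases "g y \<le> f y") (auto simp: add_diff_inverse_ennreal add_diff_eq_ennreal not_le ennreal_minus_eq_0 intro: order_trans[OF less_imp_le])
  then have "(\<integral>\<^sup>+y. f y \<partial>\<alpha>) \<le> (\<integral>\<^sup>+y. g y + (f y - g y) \<partial>\<alpha>)" by (intro nn_integral_mono)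
  also have "\<dots> = (\<integral>\<^sup>+y. g y \<partial>\<alpha>) + (\<integral>\<^sup>+y. f y - g y \<partial>\<alpha>)"
    using m by (intro nn_integral_add) auto
  also have "\<dots> \<le> (\<integral>\<^sup>+y. g y \<partial>\<alpha>) + \<kappa>"
    using le by (intro add_left_mono nn_integral_mono)
  finally show ?thesis .
qed

lemma moment_law_le:
  assumes X: "X \<in> sets borel3"
  shows "emeasure K.M X \<le> emeasure L.M X + \<kappa>" and "emeasure L.M X \<le> emeasure K.M X + \<kappa>"
proof -
  have m: "(\<lambda>y. \<integral>\<^sup>+p. indicator X (y, p) \<partial>palm_law Q K y) \<in> borel_measurable \<alpha>"
    "(\<lambda>y. \<integral>\<^sup>+p. indicator X (y, p) \<partial>palm_law Q L y) \<in> borel_measurable \<alpha>"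
    using palm_law_section_measurable[OF K.N_measurable X] palm_law_section_measurable[OF L.N_measurable X]
    by (simp_all add: measurable_cong_sets[OF K.sets_alpha refl])
  show "emeasure K.M X \<le> emeasure L.M X + \<kappa>" "emeasure L.M X \<le> emeasure K.M X + \<kappa>"
    unfolding emeasure_moment_law[OF K.N_measurable X K.sets_alpha] emeasure_moment_law[OF L.N_measurable X K.sets_alpha]
    using section_bound[OF X] m by (auto intro!: nn_integral_le_add_kappa)
qed

lemma delta_le:
  assumes B: "B \<in> sets borel"
  shows "emeasure K.\<delta> B \<le> emeasure L.\<delta> B + \<kappa>" and "emeasure L.\<delta> B \<le> emeasure K.\<delta> B + \<kappa>"
proof -
  define X where "X = (\<lambda>(y, u, v). u - v) -` B \<inter> space (borel \<Otimes>\<^sub>M (borel \<Otimes>\<^sub>M (borel :: 'v measure)) :: ('v \<times> 'v \<times> 'v) measure)"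
  have X: "X \<in> sets borel3"
    unfolding X_def by (rule measurable_sets[OF _ B]) (unfold split_beta', measurable)
  have "emeasure K.\<delta> B = emeasure K.M X" "emeasure L.\<delta> B = emeasure L.M X"
    unfolding K.\<delta>_def L.\<delta>_def X_def
    using B by (simp_all add: emeasure_distr[OF K.difference_measurable] emeasure_distr[OF L.difference_measurable] K.space_M L.space_M space_pair_measure)
  then show "emeasure K.\<delta> B \<le> emeasure L.\<delta> B + \<kappa>" "emeasure L.\<delta> B \<le> emeasure K.\<delta> B + \<kappa>"
    using moment_law_le[OF X] by simp_all
qed

text \<open>The two displacement laws differ by at most one finite constant on every Borel set, so
  finiteness on a bounded set passes from one to the other. This carries local square integrability
  from one transport to the other.\<close>

lemma locally_finite_delta_iff: "locally_finite_measure K.\<delta> \<longleftrightarrow> locally_finite_measure L.\<delta>"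
proof -
  have "emeasure K.\<delta> B < \<infinity> \<longleftrightarrow> emeasure L.\<delta> B < \<infinity>" if "B \<in> sets borel" for B
    using delta_le[OF that] kappa_finite by (auto intro: le_less_trans simp: ennreal_add_less_top)
  then show ?thesis
    unfolding locally_finite_measure_def by (simp add: K.sets_delta L.sets_delta)
qed

text \<open>Truncation in \<open>y\<close> alone. Both kernels are probability kernels in the other
  coordinates, so a strip has the same finite mass under both laws.\<close>

definition strip :: "nat \<Rightarrow> ('v \<times> 'v \<times> 'v) set" where
  "strip n = ball 0 (real n) \<times> UNIV"

lemma strip: "strip n \<in> sets borel3" "(\<Union>n. strip n) = UNIV" "incseq strip"
  "emeasure K.M (strip n) < \<infinity>" "emeasure L.M (strip n) < \<infinity>"
proof -
  show "strip n \<in> sets borel3"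
    unfolding strip_def
    by (intro pair_measureI) (auto simp: sets.top[of "borel \<Otimes>\<^sub>M borel", simplified space_pair_measure space_borel UNIV_Times_UNIV])
  show "(\<Union>n. strip n) = UNIV" unfolding strip_def using reals_Archimedean2 by auto
  show "incseq strip" by (auto simp: incseq_def strip_def)
  show "emeasure K.M (strip n) < \<infinity>" "emeasure L.M (strip n) < \<infinity>"
    using K.locally_finite_alpha unfolding strip_def
    by (simp_all add: emeasure_moment_law_strip[OF K.N_measurable K.sets_alpha] emeasure_moment_law_strip[OF L.N_measurable K.sets_alpha] locally_finite_measure_def)
qed

text \<open>On a strip both laws are finite, and on the Hahn set the positive part equals
  \<open>K.M\<close> minus \<open>L.M\<close>, which is at most \<open>\<kappa>\<close>; the
  complement gives the same bound for the negative part. Continuity along the increasing strips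
  extends the bounds to the whole space.\<close>

lemma jordan_parts_exist:
  obtains Jp Jn where "finite_measure Jp" "finite_measure Jn"
    "sets Jp = sets borel3" "sets Jn = sets borel3"
    "\<And>X. X \<in> sets borel3 \<Longrightarrow> emeasure Jp X + emeasure L.M X = emeasure Jn X + emeasure K.M X"
proof -
  have r: "range strip \<subseteq> sets K.M" "(\<Union>n. strip n) = space K.M" "emeasure K.M (strip n) \<noteq> \<infinity>" "emeasure L.M (strip n) \<noteq> \<infinity>" for n
    using strip by (auto simp: K.sets_M K.space_M less_top)
  obtain Jp Jn Y where J: "sets Jp = sets K.M" "sets Jn = sets K.M" "Y \<in> sets K.M"
    "\<And>B. B \<in> sets K.M \<Longrightarrow> emeasure Jp B + emeasure L.M B = emeasure Jn B + emeasure K.M B"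
    "emeasure Jp (space K.M - Y) = 0" "emeasure Jn Y = 0"
    by (rule jordan_decomposition_exists[of L.M K.M strip, OF _ r]) (simp_all add: K.sets_M L.sets_M)
  have sp: "space Jp = UNIV" "space Jn = UNIV"
    using sets_eq_imp_space_eq[OF J(1)] sets_eq_imp_space_eq[OF J(2)] by (simp_all add: K.space_M)
  have bound: "emeasure J UNIV \<le> \<kappa>"
    if sJ: "sets J = sets K.M" and le: "\<And>n. emeasure J (strip n) \<le> \<kappa>" for J
  proof -
    have "emeasure J (\<Union>n. strip n) = (SUP n. emeasure J (strip n))"
      using r(1) sJ by (intro SUP_emeasure_incseq[symmetric] strip) simp
    also have "\<dots> \<le> \<kappa>" by (intro SUP_least le)
    finally show ?thesis by (simp add: strip)
  qed
  \<comment> \<open>Cancellation in \<open>ennreal\<close> requires \<open>c\<close> to be finite;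
    the truncation to strips provides this.\<close>
  have cancel: "a \<le> \<kappa>" if "a + c = b" "b \<le> c + \<kappa>" "c < \<infinity>" for a b c :: ennreal
  proof -
    have "c + a \<le> c + \<kappa>" using that by (simp add: add.commute)
    then show ?thesis using that(3) by (auto simp: ennreal_add_left_cancel_le)
  qed
  have sm: "strip n \<in> sets K.M" for n using r(1) by auto
  have cY: "UNIV - Y \<in> sets K.M" using sets.compl_sets[OF J(3)] by (simp add: K.space_M)
  have "emeasure Jp (strip n) \<le> \<kappa>" for n
  proof -
    \<comment> \<open>All mass of the positive part lies on \<open>Y\<close>, so the strip may be
      intersected with \<open>Y\<close>, where the negative part vanishes.\<close>
    have p: "emeasure Jp (strip n) = emeasure Jp (strip n \<inter> Y)"
    proof (rule antisym)
      have "emeasure Jp (strip n) \<le> emeasure Jp (strip n \<inter> Y \<union> (space K.M - Y))"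
        using J(1,3) sm cY by (intro emeasure_mono) (auto simp: K.space_M)
      also have "\<dots> \<le> emeasure Jp (strip n \<inter> Y) + emeasure Jp (space K.M - Y)"
        using J(1,3) sm by (intro emeasure_subadditive) auto
      finally show "emeasure Jp (strip n) \<le> emeasure Jp (strip n \<inter> Y)" by (simp add: J)
    qed (use J(1) sm in \<open>auto intro!: emeasure_mono\<close>)
    have z: "emeasure Jn (strip n \<inter> Y) = 0"
      using emeasure_mono[of "strip n \<inter> Y" Y Jn] J(2,3,6) by simp
    have mY: "strip n \<inter> Y \<in> sets K.M" using sm J(3) by auto
    show ?thesis
      unfolding p
    proof (rule cancel)
      show "emeasure Jp (strip n \<inter> Y) + emeasure L.M (strip n \<inter> Y) = emeasure K.M (strip n \<inter> Y)"
        using J(4)[OF mY] z by simp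
      show "emeasure K.M (strip n \<inter> Y) \<le> emeasure L.M (strip n \<inter> Y) + \<kappa>"
        using moment_law_le[of "strip n \<inter> Y"] mY by (simp add: K.sets_M)
      show "emeasure L.M (strip n \<inter> Y) < \<infinity>"
        by (rule le_less_trans[OF emeasure_mono strip(5)[of n]]) (use sm in \<open>auto simp: K.sets_M L.sets_M\<close>)
    qed
  qed
  from bound[OF J(1) this] have fp: "finite_measure Jp"
    using kappa_finite sp by (intro finite_measureI) (auto simp: top_unique)
  have "emeasure Jn (strip n) \<le> \<kappa>" for n
  proof -
    have p: "emeasure Jn (strip n) = emeasure Jn (strip n - Y)"
    proof (rule antisym)
      have "emeasure Jn (strip n) \<le> emeasure Jn ((strip n - Y) \<union> Y)"
        using J(2,3) sm by (intro emeasure_mono) auto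
      also have "\<dots> \<le> emeasure Jn (strip n - Y) + emeasure Jn Y"
        using J(2,3) sm by (intro emeasure_subadditive) auto
      finally show "emeasure Jn (strip n) \<le> emeasure Jn (strip n - Y)" by (simp add: J)
    qed (use J(2) sm in \<open>auto intro!: emeasure_mono\<close>)
    have z: "emeasure Jp (strip n - Y) = 0"
    proof -
      have "emeasure Jp (strip n - Y) \<le> emeasure Jp (UNIV - Y)"
        by (rule emeasure_mono) (use J(1) cY in auto)
      also have "\<dots> = 0" using J(5) by (simp only: K.space_M)
      finally show ?thesis by simp
    qed
    have mY: "strip n - Y \<in> sets K.M" using sm J(3) by auto
    show ?thesis
      unfolding p
    proof (rule cancel)
      show "emeasure Jn (strip n - Y) + emeasure K.M (strip n - Y) = emeasure L.M (strip n - Y)"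
        using J(4)[OF mY] z by simp
      show "emeasure L.M (strip n - Y) \<le> emeasure K.M (strip n - Y) + \<kappa>"
        using moment_law_le[of "strip n - Y"] mY by (simp add: K.sets_M)
      show "emeasure K.M (strip n - Y) < \<infinity>"
        by (rule le_less_trans[OF emeasure_mono strip(4)[of n]]) (use sm in \<open>auto simp: K.sets_M L.sets_M\<close>)
    qed
  qed
  from bound[OF J(2) this] have fn: "finite_measure Jn"
    using kappa_finite sp by (intro finite_measureI) (auto simp: top_unique)
  show thesis
    by (rule that[OF fp fn]) (use J in \<open>simp_all add: K.sets_M\<close>)
qed

end

section \<open>Fourier transforms of Palm mixtures\<close>

text \<open>Real and imaginary parts reduce the claim to real mixtures; boundedness of
  \<open>f\<close> and finiteness of the mixing measure give integrability at each stage.\<close>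

lemma integral_bind_complex:
  fixes f :: "'b \<Rightarrow> complex"
  assumes f: "f \<in> borel_measurable K" and le: "\<And>x. norm (f x) \<le> C"
    and N: "N \<in> M \<rightarrow>\<^sub>M subprob_algebra K" and fin: "finite_measure M" and ne: "space M \<noteq> {}"
  shows "(LINT x|Giry_Monad.bind M N. f x) = (LINT x|M. LINT y|N x. f y)"
    and "integrable M (\<lambda>x. LINT y|N x. f y)"
proof -
  interpret finite_measure M by fact
  have C: "0 \<le> C" using le order_trans[OF norm_ge_zero] by blast
  have sp: "subprob_space (N x)" "sets (N x) = sets K" if "x \<in> space M" for x
    using measurable_space[OF N that] by (simp_all add: space_subprob_algebra)
  have fi: "integrable (N x) f" if x: "x \<in> space M" for x
  proof -
    interpret s: subprob_space "N x" by (rule sp[OF x])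
    show ?thesis
      by (rule integrable_bounded_finite[OF s.finite_measure_axioms, where C=C])
        (simp_all add: measurable_cong_sets[OF sp(2)[OF x] refl] f le)
  qed
  have fN: "norm (LINT y|N x. f y) \<le> C" if x: "x \<in> space M" for x
  proof -
    interpret s: subprob_space "N x" by (rule sp[OF x])
    have "norm (LINT y|N x. f y) \<le> (LINT y|N x. norm (f y))" by (rule integral_norm_bound)
    also have "\<dots> \<le> (LINT y|N x. C)"
      using fi[OF x] le by (intro integral_mono) auto
    also have "\<dots> \<le> C"
      using C s.subprob_measure_le_1[of "space (N x)"] by (simp add: mult_left_le_one_le)
    finally show ?thesis .
  qed
  have meas: "(\<lambda>x. LINT y|N x. f y) \<in> borel_measurable M"
    by (rule measurable_compose[OF N integral_measurable_subprob_algebra[OF f]])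
  show int: "integrable M (\<lambda>x. LINT y|N x. f y)"
    by (rule integrable_bounded_finite[OF fin meas fN])
  have Re: "(\<lambda>x. Re (f x)) \<in> borel_measurable K" and Im: "(\<lambda>x. Im (f x)) \<in> borel_measurable K"
    using f by measurable
  have bR: "\<bar>Re (f x)\<bar> \<le> C" and bI: "\<bar>Im (f x)\<bar> \<le> C" for x
    using order_trans[OF abs_Re_le_cmod le] order_trans[OF abs_Im_le_cmod le] by auto
  have ae: "AE x in M. emeasure (N x) (space (N x)) \<le> ennreal 1"
    using sp(1) by (intro AE_I2) (simp add: subprob_space.emeasure_space_le_1)
  have iR: "integrable (Giry_Monad.bind M N) (\<lambda>x. Re (f x))" and eR: "(LINT x|Giry_Monad.bind M N. Re (f x)) = (LINT x|M. LINT y|N x. Re (f y))"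
    using integrable_bind[OF Re bR N fin ae] integral_bind[OF Re bR N fin ae] by auto
  have iI: "integrable (Giry_Monad.bind M N) (\<lambda>x. Im (f x))" and eI: "(LINT x|Giry_Monad.bind M N. Im (f x)) = (LINT x|M. LINT y|N x. Im (f y))"
    using integrable_bind[OF Im bI N fin ae] integral_bind[OF Im bI N fin ae] by auto
  have ib: "integrable (Giry_Monad.bind M N) f"
  proof -
    have "integrable (Giry_Monad.bind M N) (\<lambda>x. complex_of_real (Re (f x)) + \<i> * complex_of_real (Im (f x)))"
      using iR iI by (intro Bochner_Integration.integrable_add integrable_mult_right integrable_of_real)
    then show ?thesis by (simp add: complex_eq[symmetric])
  qed
  show "(LINT x|Giry_Monad.bind M N. f x) = (LINT x|M. LINT y|N x. f y)"
  proof (rule complex_eqI)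
    have "Re (LINT x|M. LINT y|N x. f y) = (LINT x|M. Re (LINT y|N x. f y))"
      using integral_Re[OF int] by simp
    also have "\<dots> = (LINT x|M. LINT y|N x. Re (f y))"
      using integral_Re[OF fi] by (intro Bochner_Integration.integral_cong refl) simp
    finally show "Re (LINT x|Giry_Monad.bind M N. f x) = Re (LINT x|M. LINT y|N x. f y)"
      using integral_Re[OF ib] eR by simp
    have "Im (LINT x|M. LINT y|N x. f y) = (LINT x|M. Im (LINT y|N x. f y))"
      using integral_Im[OF int] by simp
    also have "\<dots> = (LINT x|M. LINT y|N x. Im (f y))"
      using integral_Im[OF fi] by (intro Bochner_Integration.integral_cong refl) simp
    finally show "Im (LINT x|Giry_Monad.bind M N. f x) = Im (LINT x|M. LINT y|N x. f y)"
      using integral_Im[OF ib] eI by simp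
  qed
qed

context palm_kernel
begin

text \<open>The character at \<open>u - v\<close> is a character at \<open>u\<close> times a
  conjugated one at \<open>v\<close>, so its integral against a product measure factors.\<close>

lemma fourier_palm_law:
  "(LINT p|palm_law Q K y. fourier_char k (fst p - snd p))
     = (LINT \<omega>|Q y. fourier_measure (K \<omega> y) k * cnj (fourier_measure (K \<omega> 0) k))"
  "integrable (Q y) (\<lambda>\<omega>. fourier_measure (K \<omega> y) k * cnj (fourier_measure (K \<omega> 0) k))"
proof -
  interpret q: prob_space "Q y"
    using measurable_space[OF Q_measurable, of y] by (simp add: space_prob_algebra)
  have spQ: "space (Q y) = space P"
    using measurable_space[OF Q_measurable, of y] by (auto simp: space_prob_algebra dest: sets_eq_imp_space_eq)
  have f: "(\<lambda>p. fourier_char k (fst p - snd p)) \<in> borel_measurable (borel \<Otimes>\<^sub>M borel)" by measurable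
  note ib = integral_bind_complex[OF f _ palm_law_kernel[OF Q_measurable kernel, of y] q.finite_measure_axioms q.not_empty, of 1]
  have inner: "(LINT p|(K2 \<omega> y 0). fourier_char k (fst p - snd p)) = fourier_measure (K \<omega> y) k * cnj (fourier_measure (K \<omega> 0) k)"
    if "\<omega> \<in> space (Q y)" for \<omega>
  proof -
    have \<omega>: "\<omega> \<in> space P" using that by (simp add: spQ)
    interpret k1: prob_space "K \<omega> y" by (rule kernelD(1)[OF \<omega>])
    interpret k2: prob_space "K \<omega> 0" by (rule kernelD(1)[OF \<omega>])
    interpret pp: pair_prob_space "K \<omega> y" "K \<omega> 0" ..
    have "integrable (K2 \<omega> y 0) (\<lambda>(u, v). fourier_char k (u - v))"
      by (rule integrable_bounded_finite[OF pp.finite_measure_axioms, where C=1])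
        (use f in \<open>simp_all add: split_beta' measurable_cong_sets[OF sets_pair_measure_cong[OF kernelD(2)[OF \<omega>, of y] kernelD(2)[OF \<omega>, of 0]] refl]\<close>)
    from pp.integral_fst[OF this]
    have "(LINT p|(K2 \<omega> y 0). fourier_char k (fst p - snd p)) = (LINT u|K \<omega> y. LINT v|K \<omega> 0. fourier_char k u * cnj (fourier_char k v))"
      by (simp add: split_beta' fourier_char_diff)
    also have "\<dots> = (LINT u|K \<omega> y. fourier_char k u * cnj (fourier_measure (K \<omega> 0) k))"
      by (simp only: integral_mult_right_zero cnj_fourier_measure)
    also have "\<dots> = fourier_measure (K \<omega> y) k * cnj (fourier_measure (K \<omega> 0) k)"
      unfolding fourier_measure_def by (rule integral_mult_left_zero)
    finally show ?thesis .
  qed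
  show "(LINT p|palm_law Q K y. fourier_char k (fst p - snd p))
     = (LINT \<omega>|Q y. fourier_measure (K \<omega> y) k * cnj (fourier_measure (K \<omega> 0) k))"
    unfolding palm_law_def using inner by (subst ib(1)) (auto intro!: Bochner_Integration.integral_cong)
  show "integrable (Q y) (\<lambda>\<omega>. fourier_measure (K \<omega> y) k * cnj (fourier_measure (K \<omega> 0) k))"
    using ib(2) inner by (simp cong: Bochner_Integration.integrable_cong)
qed

end

section \<open>Integration against the difference of the moment measures\<close>

context palm_comparison
begin

text \<open>The integrand in \<open>y\<close> whose integral over \<open>\<alpha>\<close> is the
  integral of \<open>g\<close> against \<eta>. The difference stays inside that integral because the
  two terms need not be integrable over \<open>\<alpha>\<close> separately.\<close>

definition palm_gap :: "('v \<Rightarrow> 'b::{banach, second_countable_topology}) \<Rightarrow> 'v \<Rightarrow> 'b" where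
  "palm_gap g y = (LINT p|palm_law Q K y. g (fst p - snd p)) - (LINT p|palm_law Q L y. g (fst p - snd p))"

text \<open>The gap is measurable and dominated pointwise by \<open>kappa\<close>, so its absolute
  integral is at most \<open>\<kappa>\<close>.\<close>

lemma palm_gap_integrable:
  fixes g :: "'v \<Rightarrow> real"
  assumes [measurable]: "g \<in> borel_measurable borel" and g1: "\<And>z. \<bar>g z\<bar> \<le> 1"
  shows "integrable \<alpha> (palm_gap g)"
proof (rule integrableI_bounded)
  have f: "(\<lambda>p. g (fst p - snd p)) \<in> borel_measurable (borel \<Otimes>\<^sub>M borel)" by measurable
  have "(\<lambda>y. LINT p|N y. g (fst p - snd p)) \<in> borel_measurable borel"
    if "N \<in> borel \<rightarrow>\<^sub>M prob_algebra (borel \<Otimes>\<^sub>M borel)" for N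
    by (rule measurable_compose[OF measurable_prob_algebraD[OF that] integral_measurable_subprob_algebra[OF f]])
  from this[OF K.N_measurable] this[OF L.N_measurable]
  have "palm_gap g \<in> borel_measurable borel"
    unfolding palm_gap_def[abs_def] by (rule borel_measurable_diff)
  then show "palm_gap g \<in> borel_measurable \<alpha>" by (simp add: measurable_cong_sets[OF K.sets_alpha refl])
  have "(\<integral>\<^sup>+y. ennreal (norm (palm_gap g y)) \<partial>\<alpha>) \<le> \<kappa>"
    using kappa_bound[OF f] g1 by (intro nn_integral_mono) (simp add: palm_gap_def)
  then show "(\<integral>\<^sup>+y. ennreal (norm (palm_gap g y)) \<partial>\<alpha>) < \<infinity>" using kappa_finite by (rule le_less_trans)
qed

text \<open>Bochner integrals against a mixture are computed for a finite mixing measure.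
  Restricting \<open>\<alpha>\<close> to a ball provides one, and the resulting mixture is the law
  on triples restricted to a strip.\<close>

lemma integral_moment_law_cut:
  fixes G :: "'v \<times> 'v \<times> 'v \<Rightarrow> real" and n :: nat
  assumes N: "N \<in> borel \<rightarrow>\<^sub>M prob_algebra (borel \<Otimes>\<^sub>M borel)"
    and G: "G \<in> borel_measurable borel3" and G1: "\<And>z. \<bar>G z\<bar> \<le> 1"
  defines "\<beta> \<equiv> cut \<alpha> (ball 0 (real n))"
  shows "(LINT z|moment_law \<beta> N. G z) = (LINT y|\<beta>. LINT p|N y. G (y, p))"
    and "finite_measure (moment_law \<beta> N)"
    and "\<And>X. X \<in> sets borel3 \<Longrightarrow> emeasure (moment_law \<beta> N) X = emeasure (moment_law \<alpha> N) (strip n \<inter> X)"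
proof -
  have s\<beta>: "sets \<beta> = sets borel" by (simp add: \<beta>_def K.sets_alpha)
  have fin: "finite_measure \<beta>"
    unfolding \<beta>_def using K.locally_finite_alpha
    by (intro finite_measure_cut) (simp_all add: K.sets_alpha locally_finite_measure_def)
  have sN: "prob_space (N y)" "sets (N y) = sets (borel \<Otimes>\<^sub>M borel)" for y
    using measurable_space[OF N, of y] by (simp_all add: space_prob_algebra)
  have pm: "Pair y \<in> N y \<rightarrow>\<^sub>M borel3" for y
    unfolding measurable_cong_sets[OF sN(2) refl] by measurable
  note kern = moment_law_kernel[OF N s\<beta>]
  have ae: "AE y in \<beta>. emeasure (distr (N y) borel3 (Pair y)) (space (distr (N y) borel3 (Pair y))) \<le> ennreal 1"
    using prob_space.emeasure_space_1[OF prob_space.prob_space_distr[OF sN(1) pm]] by (intro AE_I2) simp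
  have "(LINT z|moment_law \<beta> N. G z) = (LINT y|\<beta>. LINT z|distr (N y) borel3 (Pair y). G z)"
    unfolding moment_law_def by (rule integral_bind[OF G G1 kern fin ae])
  also have "\<dots> = (LINT y|\<beta>. LINT p|N y. G (y, p))"
    by (simp add: integral_distr[OF pm G])
  finally show "(LINT z|moment_law \<beta> N. G z) = (LINT y|\<beta>. LINT p|N y. G (y, p))" .
  show em: "emeasure (moment_law \<beta> N) X = emeasure (moment_law \<alpha> N) (strip n \<inter> X)"
    if X: "X \<in> sets borel3" for X
  proof -
    have SX: "strip n \<inter> X \<in> sets borel3" using strip(1) X by auto
    have m: "(\<lambda>y. \<integral>\<^sup>+p. indicator X (y, p) \<partial>N y) \<in> borel_measurable \<alpha>"
      using palm_law_section_measurable[OF N X] by (simp add: measurable_cong_sets[OF K.sets_alpha refl])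
    have b: "(\<lambda>y. ennreal (indicator (ball 0 (real n)) y)) \<in> borel_measurable \<alpha>"
      by (intro measurable_compose[OF borel_measurable_indicator measurable_ennreal]) (simp add: K.sets_alpha)
    have "emeasure (moment_law \<beta> N) X = (\<integral>\<^sup>+y. ennreal (indicator (ball 0 (real n)) y) * (\<integral>\<^sup>+p. indicator X (y, p) \<partial>N y) \<partial>\<alpha>)"
      unfolding emeasure_moment_law[OF N X s\<beta>] unfolding \<beta>_def cut_def by (rule nn_integral_density[OF b m])
    also have "\<dots> = (\<integral>\<^sup>+y. \<integral>\<^sup>+p. indicator (strip n \<inter> X) (y, p) \<partial>N y \<partial>\<alpha>)"
      by (intro nn_integral_cong) (simp add: indicator_def strip_def)
    also have "\<dots> = emeasure (moment_law \<alpha> N) (strip n \<inter> X)"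
      by (rule emeasure_moment_law[OF N SX K.sets_alpha, symmetric])
    finally show ?thesis .
  qed
  have sp: "space (moment_law \<beta> N) = UNIV"
    using sets_eq_imp_space_eq[OF sets_moment_law[OF s\<beta>, of N]] by (simp add: space_pair_measure)
  have U: "(UNIV :: ('v \<times> 'v \<times> 'v) set) \<in> sets borel3"
    using sets.top[of "borel3 :: ('v \<times> 'v \<times> 'v) measure"] by (simp add: space_pair_measure)
  show "finite_measure (moment_law \<beta> N)"
  proof
    have "emeasure (moment_law \<beta> N) UNIV = emeasure \<alpha> (ball 0 (real n))"
      using em[OF U] emeasure_moment_law_strip[OF N K.sets_alpha, of "ball 0 (real n)"] by (simp add: strip_def)
    then show "emeasure (moment_law \<beta> N) (space (moment_law \<beta> N)) \<noteq> \<infinity>"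
      using K.locally_finite_alpha by (simp add: sp locally_finite_measure_def less_top)
  qed
qed

text \<open>The representing measures are images of the Jordan parts on triples. On a strip the
  restricted measures are all finite, which gives the integral identity there. As the strips grow,
  one side converges because the Jordan parts are finite, the other because the gap is integrable
  over \<open>\<alpha>\<close>.\<close>

lemma difference_representation:
  obtains Dp Dn :: "'v measure" where "finite_measure Dp" "finite_measure Dn" "sets Dp = sets borel" "sets Dn = sets borel"
    "\<And>B. B \<in> sets borel \<Longrightarrow> emeasure Dp B + emeasure L.\<delta> B = emeasure Dn B + emeasure K.\<delta> B"
    "\<And>g :: 'v \<Rightarrow> real. g \<in> borel_measurable borel \<Longrightarrow> (\<And>z. \<bar>g z\<bar> \<le> 1) \<Longrightarrow>
        (LINT y|\<alpha>. palm_gap g y) = (LINT z|Dp. g z) - (LINT z|Dn. g z)"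
proof -
  obtain Jp Jn where fin: "finite_measure Jp" "finite_measure Jn"
    and sJ: "sets Jp = sets borel3" "sets Jn = sets borel3"
    and J: "\<And>X. X \<in> sets borel3 \<Longrightarrow> emeasure Jp X + emeasure L.M X = emeasure Jn X + emeasure K.M X"
    by (rule jordan_parts_exist) blast
  interpret p: finite_measure Jp by fact
  interpret n: finite_measure Jn by fact
  define d :: "'v \<times> 'v \<times> 'v \<Rightarrow> 'v" where "d z = fst (snd z) - snd (snd z)" for z
  have d: "d \<in> borel3 \<rightarrow>\<^sub>M borel" unfolding d_def[abs_def] by measurable
  have dp: "d \<in> Jp \<rightarrow>\<^sub>M borel" and dn: "d \<in> Jn \<rightarrow>\<^sub>M borel"
    using d by (simp_all add: measurable_cong_sets[OF sJ(1) refl] measurable_cong_sets[OF sJ(2) refl])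
  have d_eq: "(\<lambda>(y, u, v). u - v) = d" by (simp add: fun_eq_iff d_def)
  have spJ: "space Jp = UNIV" "space Jn = UNIV"
    using sets_eq_imp_space_eq[OF sJ(1)] sets_eq_imp_space_eq[OF sJ(2)] by (simp_all add: space_pair_measure)
  show thesis
  proof (rule that)
    show "finite_measure (distr Jp borel d)" "finite_measure (distr Jn borel d)"
      using dp dn by (simp_all add: p.finite_measure_distr n.finite_measure_distr)
    show "sets (distr Jp borel d) = sets borel" "sets (distr Jn borel d) = sets borel" by simp_all
    show "emeasure (distr Jp borel d) B + emeasure L.\<delta> B = emeasure (distr Jn borel d) B + emeasure K.\<delta> B" if B: "B \<in> sets borel" for B
    proof -
      have X: "d -` B \<in> sets borel3"
        using measurable_sets[OF d B] by (simp add: space_pair_measure)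
      show ?thesis
        using J[OF X] emeasure_distr[OF K.difference_measurable B] emeasure_distr[OF L.difference_measurable B]
        by (simp add: emeasure_distr[OF dp B] emeasure_distr[OF dn B] K.\<delta>_def L.\<delta>_def d_eq spJ K.space_M L.space_M)
    qed
    fix g :: "'v \<Rightarrow> real"
    assume g [measurable]: "g \<in> borel_measurable borel" and g1: "\<And>z. \<bar>g z\<bar> \<le> 1"
    define G where "G z = g (d z)" for z
    have G: "G \<in> borel_measurable borel3"
      unfolding G_def[abs_def] using d g by (rule measurable_compose)
    have G1: "\<bar>G z\<bar> \<le> 1" for z unfolding G_def by (rule g1)
    have GJ: "G \<in> borel_measurable Jp" "G \<in> borel_measurable Jn"
      using G by (simp_all add: measurable_cong_sets[OF sJ(1) refl] measurable_cong_sets[OF sJ(2) refl])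
    have gi: "integrable \<alpha> (palm_gap g)" using g g1 by (rule palm_gap_integrable)
    \<comment> \<open>A strip constrains only \<open>y\<close>, so it restricts the outer integral
      and leaves \<open>palm_gap g y\<close> intact.\<close>
    have step: "(LINT z|Jp. indicator (strip n) z *\<^sub>R G z) - (LINT z|Jn. indicator (strip n) z *\<^sub>R G z)
        = (LINT y|\<alpha>. indicator (ball 0 (real n)) y *\<^sub>R palm_gap g y)" for n
    proof -
      let ?\<beta> = "cut \<alpha> (ball 0 (real n))"
      let ?B = "borel3 :: ('v \<times> 'v \<times> 'v) measure"
      note mK = integral_moment_law_cut[OF K.N_measurable G G1, where n=n] and mL = integral_moment_law_cut[OF L.N_measurable G G1, where n=n]
      have s\<beta>: "sets ?\<beta> = sets borel" by (simp add: K.sets_alpha)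
      have fJ: "finite_measure (cut Jp (strip n))" "finite_measure (cut Jn (strip n))"
        using strip(1)[of n] sJ by (auto intro!: finite_measure_cut simp: less_top[symmetric])
      have "(LINT z|cut Jp (strip n). G z) + (LINT z|moment_law ?\<beta> (palm_law Q L). G z)
          = (LINT z|cut Jn (strip n). G z) + (LINT z|moment_law ?\<beta> (palm_law Q K). G z)"
      proof (rule integral_add_eq[where M="?B" and K=1, OF fJ mK(2) mL(2) _ _ _ _ _ G])
        fix X assume X: "X \<in> sets ?B"
        have SX: "strip n \<inter> X \<in> sets ?B" using strip(1) X by auto
        show "emeasure (cut Jp (strip n)) X + emeasure (moment_law ?\<beta> (palm_law Q L)) X
          = emeasure (cut Jn (strip n)) X + emeasure (moment_law ?\<beta> (palm_law Q K)) X"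
          using J[OF SX] strip(1)[of n] X by (simp add: emeasure_cut sJ mK(3)[OF X] mL(3)[OF X])
      qed (simp_all add: sJ sets_moment_law[OF s\<beta>] G1)
      then have e: "(LINT z|Jp. indicator (strip n) z *\<^sub>R G z) - (LINT z|Jn. indicator (strip n) z *\<^sub>R G z)
          = (LINT y|?\<beta>. LINT p|palm_law Q K y. G (y, p)) - (LINT y|?\<beta>. LINT p|palm_law Q L y. G (y, p))"
        unfolding mK(1) mL(1) using strip(1)[of n] by (simp add: integral_cut sJ GJ)
      have \<beta>fin: "finite_measure ?\<beta>"
        using K.locally_finite_alpha by (intro finite_measure_cut) (simp_all add: K.sets_alpha locally_finite_measure_def)
      have f: "(\<lambda>p. g (fst p - snd p)) \<in> borel_measurable (borel \<Otimes>\<^sub>M borel)" by measurable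
      have int: "integrable ?\<beta> (\<lambda>y. LINT p|N y. G (y, p))"
        if N: "N \<in> borel \<rightarrow>\<^sub>M prob_algebra (borel \<Otimes>\<^sub>M borel)" for N
      proof (rule integrable_bounded_finite[OF \<beta>fin, where C=1])
        have "(\<lambda>y. LINT p|N y. G (y, p)) \<in> borel_measurable borel"
          using measurable_compose[OF measurable_prob_algebraD[OF N] integral_measurable_subprob_algebra[OF f]]
          by (simp add: G_def d_def)
        then show "(\<lambda>y. LINT p|N y. G (y, p)) \<in> borel_measurable ?\<beta>"
          by (simp add: measurable_cong_sets[OF s\<beta> refl])
        fix y
        interpret N: prob_space "N y" using measurable_space[OF N, of y] by (simp add: space_prob_algebra)
        have sN: "sets (N y) = sets (borel \<Otimes>\<^sub>M borel)" using measurable_space[OF N, of y] by (simp add: space_prob_algebra)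
        have "integrable (N y) (\<lambda>p. G (y, p))"
          by (rule integrable_bounded_finite[OF N.finite_measure_axioms, where C=1])
            (use f g1 in \<open>simp_all add: G_def d_def measurable_cong_sets[OF sN refl]\<close>)
        then have "(LINT p|N y. \<bar>G (y, p)\<bar>) \<le> (LINT p|N y. 1)"
          using G1 by (intro integral_mono) auto
        then show "norm (LINT p|N y. G (y, p)) \<le> 1"
          using order_trans[OF integral_abs_bound[of "N y" "\<lambda>p. G (y, p)"]] by (simp add: N.prob_space)
      qed
      have "(LINT y|?\<beta>. LINT p|palm_law Q K y. G (y, p)) - (LINT y|?\<beta>. LINT p|palm_law Q L y. G (y, p)) = (LINT y|?\<beta>. palm_gap g y)"
        using int[OF K.N_measurable] int[OF L.N_measurable] by (simp add: palm_gap_def G_def d_def)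
      also have "\<dots> = (LINT y|\<alpha>. indicator (ball 0 (real n)) y *\<^sub>R palm_gap g y)"
        using gi by (intro integral_cut) (auto simp: K.sets_alpha)
      finally show ?thesis using e by simp
    qed
    have limJ: "(\<lambda>n. LINT z|J. indicator (strip n) z *\<^sub>R G z) \<longlonglongrightarrow> (LINT z|J. G z)"
      if J: "finite_measure J" "sets J = sets borel3" for J
    proof (rule integral_dominated_convergence[where w="\<lambda>_. 1"])
      show "G \<in> borel_measurable J" using G by (simp add: measurable_cong_sets[OF J(2) refl])
      then show "(\<lambda>z. indicator (strip n) z *\<^sub>R G z) \<in> borel_measurable J" for n
        using strip(1)[of n] J(2) by (intro borel_measurable_scaleR borel_measurable_indicator) auto
      show "integrable J (\<lambda>_. 1 :: real)" using J(1) by (simp add: finite_measure.integrable_const)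
      show "AE z in J. (\<lambda>n. indicator (strip n) z *\<^sub>R G z) \<longlonglongrightarrow> G z"
      proof (intro AE_I2)
        fix z
        have "z \<in> (\<Union>n. strip n)" using strip(2) by simp
        then obtain n0 where "z \<in> strip n0" by blast
        then have "z \<in> strip n" if "n0 \<le> n" for n
          using strip(3) that by (auto simp: incseq_def)
        then have "eventually (\<lambda>n. indicator (strip n) z *\<^sub>R G z = G z) sequentially"
          unfolding eventually_sequentially by (intro exI[of _ n0]) simp
        then show "(\<lambda>n. indicator (strip n) z *\<^sub>R G z) \<longlonglongrightarrow> G z" by (rule tendsto_eventually)
      qed
      show "AE z in J. norm (indicator (strip n) z *\<^sub>R G z) \<le> 1" for n
        using G1 by (intro AE_I2) (simp add: indicator_def)
    qed
    \<comment> \<open>The measure \<open>\<alpha>\<close> may be infinite, so the majorant here is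
      the norm of the gap; for the finite measures above the constant \<open>1\<close>
      served.\<close>
    have lim\<alpha>: "(\<lambda>n. LINT y|\<alpha>. indicator (ball 0 (real n)) y *\<^sub>R palm_gap g y) \<longlonglongrightarrow> (LINT y|\<alpha>. palm_gap g y)"
    proof (rule integral_dominated_convergence[OF _ _ integrable_norm[OF gi]])
      show "palm_gap g \<in> borel_measurable \<alpha>" using gi by auto
      then show "(\<lambda>y. indicator (ball 0 (real n)) y *\<^sub>R palm_gap g y) \<in> borel_measurable \<alpha>" for n
        by (intro borel_measurable_scaleR borel_measurable_indicator) (auto simp: K.sets_alpha)
      show "AE y in \<alpha>. (\<lambda>n. indicator (ball 0 (real n)) y *\<^sub>R palm_gap g y) \<longlonglongrightarrow> palm_gap g y"
      proof (intro AE_I2)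
        fix y :: 'v
        obtain n0 :: nat where "norm y < real n0" using reals_Archimedean2 by blast
        then have "eventually (\<lambda>n. indicator (ball 0 (real n)) y *\<^sub>R palm_gap g y = palm_gap g y) sequentially"
          unfolding eventually_sequentially by (intro exI[of _ n0]) (auto simp: indicator_def)
        then show "(\<lambda>n. indicator (ball 0 (real n)) y *\<^sub>R palm_gap g y) \<longlonglongrightarrow> palm_gap g y" by (rule tendsto_eventually)
      qed
      show "AE y in \<alpha>. norm (indicator (ball 0 (real n)) y *\<^sub>R palm_gap g y) \<le> norm (palm_gap g y)" for n
        by (intro AE_I2) (simp add: indicator_def)
    qed
    have "(LINT y|\<alpha>. palm_gap g y) = (LINT z|Jp. G z) - (LINT z|Jn. G z)"
      using lim\<alpha> tendsto_diff[OF limJ[OF fin(1) sJ(1)] limJ[OF fin(2) sJ(2)]] unfolding step by (rule LIMSEQ_unique)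
    then show "(LINT y|\<alpha>. palm_gap g y) = (LINT z|distr Jp borel d. g z) - (LINT z|distr Jn borel d. g z)"
      by (simp add: integral_distr[OF dp g] integral_distr[OF dn g] G_def)
  qed
qed

end

section \<open>Covariance measures and the assembly of the comparison\<close>

text \<open>On the bounded set where \<open>h\<close> does not vanish, the covariance measure is a
  difference of two finite measures: the restricted second moment measure and a multiple of
  restricted Lebesgue measure. \<open>signed_integral_diff\<close> then evaluates the
  integral.\<close>

lemma local_signed_integral_covariance:
  fixes \<Psi> :: "'w \<Rightarrow> 'v::euclidean_space measure"
  assumes lf: "locally_finite_measure (reduced_second_moment P \<Psi>)" and h: "bounded_test_fun h"
  shows "local_signed_integral (covariance_measure P \<Psi>) h
    = (LINT x|cut (reduced_second_moment P \<Psi>) {x. h x \<noteq> 0}. h x) - (enn2real (intensity P \<Psi>))\<^sup>2 * (LINT x|lborel. h x)"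
proof -
  define S where "S = {x. h x \<noteq> 0}"
  define m where "m = reduced_second_moment P \<Psi>"
  define c where "c = (enn2real (intensity P \<Psi>))\<^sup>2"
  obtain C R where H: "h \<in> borel_measurable borel" "0 \<le> C" "\<And>x. \<bar>h x\<bar> \<le> C"
    using h by (rule bounded_test_funE) blast
  have bS: "bounded S" using h by (simp add: S_def bounded_test_fun_def)
  have S [measurable]: "S \<in> sets borel" unfolding S_def using H(1) by measurable
  note [measurable] = H(1)
  have sm: "sets m = sets borel" using lf by (simp add: m_def locally_finite_measure_def)
  have mS: "emeasure m S < \<infinity>" using lf S bS by (simp add: m_def locally_finite_measure_def)
  have lS: "emeasure lborel S < \<infinity>" using bS by (rule emeasure_bounded_finite)
  have c0: "0 \<le> c" by (simp add: c_def)
  define D where "D = density lborel (\<lambda>x. ennreal (c * indicator S x))"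
  have sD: "sets D = sets borel" by (simp add: D_def)
  have eD: "emeasure D B = ennreal c * emeasure lborel (S \<inter> B)" if B: "B \<in> sets borel" for B
  proof -
    have "emeasure D B = (\<integral>\<^sup>+x. ennreal c * indicator (S \<inter> B) x \<partial>lborel)"
      unfolding D_def using B by (subst emeasure_density) (auto simp: indicator_def c0 intro!: nn_integral_cong)
    then show ?thesis using B by (simp add: nn_integral_cmult_indicator)
  qed
  have fD: "finite_measure D"
    by (rule finite_measureI) (use eD[of UNIV] lS sets_eq_imp_space_eq[OF sD] in \<open>auto simp: ennreal_mult_eq_top_iff\<close>)
  have "local_signed_integral (covariance_measure P \<Psi>) h = (LINT x|cut m S. h x) - (LINT x|D. h x)"
    unfolding local_signed_integral_def S_def[symmetric]
  proof (rule signed_integral_diff[OF finite_measure_cut fD _ sD _ H(1), where C=C])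
    fix B :: "'v set" assume B: "B \<in> sets borel"
    have "measure D B = c * measure lborel (S \<inter> B)"
      using eD[OF B] c0 by (simp add: measure_def enn2real_mult)
    then show "covariance_measure P \<Psi> (B \<inter> S) = measure (cut m S) B - measure D B"
      using B S by (simp add: covariance_measure_def m_def[symmetric] c_def[symmetric] measure_cut sm Int_commute)
  qed (use H(3) mS in \<open>simp_all add: sm\<close>)
  also have "(LINT x|D. h x) = (LINT x|lborel. (c * indicator S x) *\<^sub>R h x)"
    unfolding D_def using c0 by (intro integral_density) auto
  also have "\<dots> = (LINT x|lborel. c * h x)"
    by (intro Bochner_Integration.integral_cong refl) (auto simp: S_def indicator_def)
  also have "\<dots> = c * (LINT x|lborel. h x)" by (rule integral_mult_right_zero)
  finally show ?thesis by (simp add: m_def c_def S_def)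
qed

lemma fourier_measure_continuous:
  fixes J :: "'v::euclidean_space measure"
  assumes J: "finite_measure J" and s: "sets J = sets borel"
  shows "continuous_on UNIV (fourier_measure J)"
  unfolding continuous_on_sequentially
proof (intro allI ballI impI)
  fix x :: "nat \<Rightarrow> 'v" and k assume "(\<forall>n. x n \<in> UNIV) \<and> x \<longlonglongrightarrow> k"
  then have x: "x \<longlonglongrightarrow> k" by simp
  have m: "fourier_char q \<in> borel_measurable J" for q
    by (simp add: measurable_cong_sets[OF s refl])
  have "(\<lambda>n. LINT z|J. fourier_char (x n) z) \<longlonglongrightarrow> (LINT z|J. fourier_char k z)"
  proof (rule integral_dominated_convergence[where w="\<lambda>_. 1"])
    show "integrable J (\<lambda>_. 1 :: real)" using J by (simp add: finite_measure.integrable_const)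
    show "AE z in J. (\<lambda>n. fourier_char (x n) z) \<longlonglongrightarrow> fourier_char k z"
      unfolding fourier_char_def using x by (intro AE_I2 tendsto_intros)
  qed (simp_all add: m)
  then show "(fourier_measure J \<circ> x) \<longlonglongrightarrow> fourier_measure J k"
    by (simp add: fourier_measure_def o_def)
qed

context palm_comparison
begin

lemma palm_gap_fourier:
  "palm_gap (fourier_char k) y = (LINT \<omega>|Q y.
      fourier_measure (K \<omega> y) k * cnj (fourier_measure (K \<omega> 0) k)
      - fourier_measure (L \<omega> y) k * cnj (fourier_measure (L \<omega> 0) k))"
  unfolding palm_gap_def K.fourier_palm_law(1) L.fourier_palm_law(1)
  using K.fourier_palm_law(2) L.fourier_palm_law(2) by (intro Bochner_Integration.integral_diff[symmetric])

text \<open>The representation of the difference is available for real functions bounded by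
  \<open>1\<close>; the real and imaginary parts of a character are of this kind.\<close>

lemma palm_gap_complex:
  "Re (palm_gap (fourier_char k) y) = palm_gap (\<lambda>z. Re (fourier_char k z)) y"
  "Im (palm_gap (fourier_char k) y) = palm_gap (\<lambda>z. Im (fourier_char k z)) y"
proof -
  interpret k: prob_space "palm_law Q K y" by (rule palm_law_prob)
  interpret l: prob_space "palm_law Q L y" by (rule palm_law_prob)
  have i: "integrable R (\<lambda>p. fourier_char k (fst p - snd p))"
    if "finite_measure R" "sets R = sets (borel \<Otimes>\<^sub>M borel)" for R
    by (rule integrable_bounded_finite[OF that(1), where C=1])
      (simp_all add: measurable_cong_sets[OF that(2) refl])
  note ik = i[OF k.finite_measure_axioms palm_law_prob(3)] and il = i[OF l.finite_measure_axioms palm_law_prob(4)]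
  show "Re (palm_gap (fourier_char k) y) = palm_gap (\<lambda>z. Re (fourier_char k z)) y"
    "Im (palm_gap (fourier_char k) y) = palm_gap (\<lambda>z. Im (fourier_char k z)) y"
    using integral_Re[OF ik] integral_Re[OF il] integral_Im[OF ik] integral_Im[OF il]
    by (simp_all add: palm_gap_def)
qed

text \<open>All claims about \<eta> are read off one pair of finite measures \<open>Dp\<close>,
  \<open>Dn\<close>. Their difference is an extension, and uniqueness lets the pair stand for every
  admissible \<eta>: the transform, its continuity, its Palm formula and the spectral identity are
  proved for the pair.\<close>

theorem transport_comparison:
  assumes lsi: "locally_square_integrable P (transport K \<Phi>) \<or> locally_square_integrable P (transport L \<Phi>)"
  shows "locally_square_integrable P (transport K \<Phi>)" "locally_square_integrable P (transport L \<Phi>)"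
    and "\<exists>\<eta>. extends_moment_difference P (transport K \<Phi>) (transport L \<Phi>) \<eta>"
    and "\<And>\<eta> \<sigma>K \<sigma>L B. extends_moment_difference P (transport K \<Phi>) (transport L \<Phi>) \<eta> \<Longrightarrow>
        bartlett_spectral_measure P (transport K \<Phi>) \<sigma>K \<Longrightarrow>
        bartlett_spectral_measure P (transport L \<Phi>) \<sigma>L \<Longrightarrow> B \<in> sets borel \<Longrightarrow> bounded B \<Longrightarrow>
        complex_of_real (measure \<sigma>K B) = complex_of_real (measure \<sigma>L B) + (LINT k:B|lborel. fourier_signed \<eta> k)"
    and "\<And>k. integrable \<alpha> (palm_gap (fourier_char k) :: 'v \<Rightarrow> complex)"
    and "\<And>\<eta> k. extends_moment_difference P (transport K \<Phi>) (transport L \<Phi>) \<eta> \<Longrightarrow>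
        fourier_signed \<eta> k = (LINT y|\<alpha>. palm_gap (fourier_char k) y)"
    and "\<And>\<eta>. extends_moment_difference P (transport K \<Phi>) (transport L \<Phi>) \<eta> \<Longrightarrow>
        continuous_on UNIV (fourier_signed \<eta>)"
    and "\<And>\<eta>. extends_moment_difference P (transport K \<Phi>) (transport L \<Phi>) \<eta> \<Longrightarrow> fourier_signed \<eta> 0 = 0"
proof -
  have lf: "locally_finite_measure K.\<delta>" "locally_finite_measure L.\<delta>"
    using lsi K.locally_square_integrable_iff L.locally_square_integrable_iff locally_finite_delta_iff by auto
  show lsiK: "locally_square_integrable P (transport K \<Phi>)" and lsiL: "locally_square_integrable P (transport L \<Phi>)"
    using lf K.locally_square_integrable_iff L.locally_square_integrable_iff by auto
  note rK = K.reduced_second_moment_transport[OF lsiK] and rL = L.reduced_second_moment_transport[OF lsiL]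
  obtain Dp Dn :: "'v measure" where fin: "finite_measure Dp" "finite_measure Dn" and s: "sets Dp = sets borel" "sets Dn = sets borel"
    and D: "\<And>B. B \<in> sets borel \<Longrightarrow> emeasure Dp B + emeasure L.\<delta> B = emeasure Dn B + emeasure K.\<delta> B"
    and gap: "\<And>g :: 'v \<Rightarrow> real. g \<in> borel_measurable borel \<Longrightarrow> (\<And>z. \<bar>g z\<bar> \<le> 1) \<Longrightarrow>
        (LINT y|\<alpha>. palm_gap g y) = (LINT z|Dp. g z) - (LINT z|Dn. g z)"
    by (rule difference_representation) blast
  interpret p: finite_measure Dp by fact
  interpret n: finite_measure Dn by fact
  define \<eta>0 where "\<eta>0 B = measure Dp B - measure Dn B" for B
  have \<eta>0: "extends_moment_difference P (transport K \<Phi>) (transport L \<Phi>) \<eta>0"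
    unfolding extends_moment_difference_def rK rL
  proof (intro conjI ballI impI)
    show "finite_signed_measure borel \<eta>0"
      unfolding \<eta>0_def[abs_def] by (rule finite_signed_measure_diff[OF fin s])
    fix B :: "'v set" assume B: "B \<in> sets borel" "bounded B"
    show "\<eta>0 B = measure K.\<delta> B - measure L.\<delta> B"
      unfolding \<eta>0_def
      by (rule measure_diff_eq[OF _ _ _ _ D[OF B(1)]]) (use lf B in \<open>simp_all add: locally_finite_measure_def less_top[symmetric]\<close>)
  qed
  then show "\<exists>\<eta>. extends_moment_difference P (transport K \<Phi>) (transport L \<Phi>) \<eta>" by blast
  have unique: "\<eta> B = measure Dp B - measure Dn B"
    if "extends_moment_difference P (transport K \<Phi>) (transport L \<Phi>) \<eta>" "B \<in> sets borel" for \<eta> B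
    using finite_signed_measure_eq_bounded[of \<eta> \<eta>0 B] that \<eta>0
    by (simp add: extends_moment_difference_def \<eta>0_def)
  have signed: "fourier_signed \<eta> k = fourier_measure Dp k - fourier_measure Dn k"
    if "extends_moment_difference P (transport K \<Phi>) (transport L \<Phi>) \<eta>" for \<eta> k
    unfolding fourier_signed_def fourier_measure_def
    by (rule signed_integral_diff[OF fin s unique[OF that], where C=1]) simp_all
  show gi: "integrable \<alpha> (palm_gap (fourier_char k) :: 'v \<Rightarrow> complex)" for k
  proof -
    have "integrable \<alpha> (palm_gap (\<lambda>z. Re (fourier_char k z)))" "integrable \<alpha> (palm_gap (\<lambda>z. Im (fourier_char k z)))"
      using order_trans[OF abs_Re_le_cmod, of "fourier_char k _" 1] order_trans[OF abs_Im_le_cmod, of "fourier_char k _" 1]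
      by (auto intro!: palm_gap_integrable)
    then have "integrable \<alpha> (\<lambda>y. complex_of_real (palm_gap (\<lambda>z. Re (fourier_char k z)) y) + \<i> * complex_of_real (palm_gap (\<lambda>z. Im (fourier_char k z)) y))"
      by (intro Bochner_Integration.integrable_add integrable_mult_right integrable_of_real)
    then show ?thesis unfolding palm_gap_complex[symmetric] complex_eq[symmetric] .
  qed
  have fourier: "fourier_measure Dp k - fourier_measure Dn k = (LINT y|\<alpha>. palm_gap (fourier_char k) y)" for k
  proof -
    have i: "integrable J (fourier_char k)" if "finite_measure J" "sets J = sets borel" for J :: "'v measure"
      by (rule integrable_bounded_finite[OF that(1), where C=1])
        (simp_all add: measurable_cong_sets[OF that(2) refl])
    note ip = i[OF fin(1) s(1)] and ineg = i[OF fin(2) s(2)]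
    have b: "\<bar>Re (fourier_char k z)\<bar> \<le> 1" "\<bar>Im (fourier_char k z)\<bar> \<le> 1" for z
      using abs_Re_le_cmod[of "fourier_char k z"] abs_Im_le_cmod[of "fourier_char k z"] by auto
    have m: "(\<lambda>z. Re (fourier_char k z)) \<in> borel_measurable borel" "(\<lambda>z. Im (fourier_char k z)) \<in> borel_measurable borel"
      by measurable
    show ?thesis
    proof (rule complex_eqI)
      show "Re (fourier_measure Dp k - fourier_measure Dn k) = Re (LINT y|\<alpha>. palm_gap (fourier_char k) y)"
        using integral_Re[OF ip] integral_Re[OF ineg] integral_Re[OF gi[of k]] gap[OF m(1) b(1)]
        by (simp add: fourier_measure_def palm_gap_complex)
      show "Im (fourier_measure Dp k - fourier_measure Dn k) = Im (LINT y|\<alpha>. palm_gap (fourier_char k) y)"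
        using integral_Im[OF ip] integral_Im[OF ineg] integral_Im[OF gi[of k]] gap[OF m(2) b(2)]
        by (simp add: fourier_measure_def palm_gap_complex)
    qed
  qed
  show formula: "fourier_signed \<eta> k = (LINT y|\<alpha>. palm_gap (fourier_char k) y)"
    if "extends_moment_difference P (transport K \<Phi>) (transport L \<Phi>) \<eta>" for \<eta> k
    unfolding signed[OF that] by (rule fourier)
  show "continuous_on UNIV (fourier_signed \<eta>)"
    if "extends_moment_difference P (transport K \<Phi>) (transport L \<Phi>) \<eta>" for \<eta>
  proof -
    have "fourier_signed \<eta> = (\<lambda>k. fourier_measure Dp k - fourier_measure Dn k)"
      using signed[OF that] by (simp add: fun_eq_iff)
    then show ?thesis
      using fourier_measure_continuous[OF fin(1) s(1)] fourier_measure_continuous[OF fin(2) s(2)]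
      by (simp add: continuous_on_diff)
  qed
  show "fourier_signed \<eta> 0 = 0"
    if "extends_moment_difference P (transport K \<Phi>) (transport L \<Phi>) \<eta>" for \<eta>
  proof -
    \<comment> \<open>The character at frequency \<open>0\<close> is constant, and both Palm laws
      have mass \<open>1\<close>.\<close>
    have "palm_gap (fourier_char 0) y = (0 :: complex)" for y
      using palm_law_prob(1,2)[of y] by (simp add: palm_gap_def prob_space.prob_space)
    then have "palm_gap (fourier_char 0) = (\<lambda>y. 0 :: complex)" by (simp add: fun_eq_iff)
    then show ?thesis unfolding formula[OF that] by simp
  qed
  fix \<eta> \<sigma>K \<sigma>L and B :: "'v set"
  assume \<eta>: "extends_moment_difference P (transport K \<Phi>) (transport L \<Phi>) \<eta>"
    and \<sigma>K: "bartlett_spectral_measure P (transport K \<Phi>) \<sigma>K" and \<sigma>L: "bartlett_spectral_measure P (transport L \<Phi>) \<sigma>L"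
    and B: "B \<in> sets borel" "bounded B"
  have "complex_of_real (measure \<sigma>K B) = complex_of_real (measure \<sigma>L B) + (LINT k:B|lborel. fourier_measure Dp k - fourier_measure Dn k)"
  proof (rule spectral_density[OF _ _ fin s _ _ _ B])
    show "locally_finite_measure \<sigma>K" "locally_finite_measure \<sigma>L"
      using \<sigma>K \<sigma>L by (simp_all add: bartlett_spectral_measure_def)
    fix f g :: "'v \<Rightarrow> real" assume f: "bounded_test_fun f" and g: "bounded_test_fun g"
    show "integrable \<sigma>K (\<lambda>k. fourier_fun f k * cnj (fourier_fun g k))"
      "integrable \<sigma>L (\<lambda>k. fourier_fun f k * cnj (fourier_fun g k))"
      using \<sigma>K \<sigma>L f g by (simp_all add: bartlett_spectral_measure_def)
    define h where "h = correlation f g"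
    have h: "bounded_test_fun h" unfolding h_def using f g by (rule bounded_test_fun_correlation)
    define S where "S = {x. h x \<noteq> 0}"
    obtain C R where H: "h \<in> borel_measurable borel" "\<And>x. \<bar>h x\<bar> \<le> C"
      using h by (rule bounded_test_funE) blast
    have bS: "bounded S" using h by (simp add: S_def bounded_test_fun_def)
    have S: "S \<in> sets borel" unfolding S_def using H(1) by measurable
    \<comment> \<open>Restriction to the set where \<open>h\<close> does not vanish leaves integrals
      of \<open>h\<close> unchanged, and it makes the locally finite displacement laws
      finite.\<close>
    have cutS: "(LINT x|cut J S. h x) = (LINT x|J. h x)" if "sets J = sets borel" for J
    proof -
      have "h \<in> borel_measurable J" using H(1) by (simp add: measurable_cong_sets[OF that refl])
      then have "(LINT x|cut J S. h x) = (LINT x|J. indicator S x *\<^sub>R h x)"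
        using S that by (intro integral_cut) simp_all
      also have "\<dots> = (LINT x|J. h x)"
        by (intro Bochner_Integration.integral_cong refl) (simp add: S_def indicator_def)
      finally show ?thesis .
    qed
    have "(LINT x|cut Dp S. h x) + (LINT x|cut L.\<delta> S. h x) = (LINT x|cut Dn S. h x) + (LINT x|cut K.\<delta> S. h x)"
    proof (rule integral_add_eq[where M=borel and K=C])
      show "finite_measure (cut Dp S)" "finite_measure (cut Dn S)" "finite_measure (cut K.\<delta> S)" "finite_measure (cut L.\<delta> S)"
        using lf S bS by (auto intro!: finite_measure_cut simp: s K.sets_delta L.sets_delta locally_finite_measure_def less_top[symmetric])
      show "emeasure (cut Dp S) X + emeasure (cut L.\<delta> S) X = emeasure (cut Dn S) X + emeasure (cut K.\<delta> S) X"
        if X: "X \<in> sets borel" for X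
        using D[of "S \<inter> X"] S X by (simp add: emeasure_cut s K.sets_delta L.sets_delta)
    qed (simp_all add: s K.sets_delta L.sets_delta H)
    then have diff: "(LINT x|cut K.\<delta> S. h x) - (LINT x|cut L.\<delta> S. h x) = (LINT y|Dp. h y) - (LINT y|Dn. h y)"
      by (simp add: cutS s algebra_simps)
    \<comment> \<open>By \<open>intensity_transport\<close> the Lebesgue terms of the two covariance
      measures have the same coefficient, which leaves only the moment measures.\<close>
    have lK: "local_signed_integral (covariance_measure P (transport K \<Phi>)) h - local_signed_integral (covariance_measure P (transport L \<Phi>)) h
        = (LINT y|Dp. h y) - (LINT y|Dn. h y)"
      using local_signed_integral_covariance[of P "transport K \<Phi>" h] local_signed_integral_covariance[of P "transport L \<Phi>" h] lf h diff
      by (simp add: rK rL K.intensity_transport L.intensity_transport S_def)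
    have pi: "complex_of_real (2 * pi) ^ DIM('v) \<noteq> 0" by simp
    have "complex_of_real (local_signed_integral (covariance_measure P (transport K \<Phi>)) h)
        = (LINT k|\<sigma>K. fourier_fun f k * cnj (fourier_fun g k)) / (2 * pi) ^ DIM('v)"
      "complex_of_real (local_signed_integral (covariance_measure P (transport L \<Phi>)) h)
        = (LINT k|\<sigma>L. fourier_fun f k * cnj (fourier_fun g k)) / (2 * pi) ^ DIM('v)"
      using \<sigma>K \<sigma>L f g by (simp_all add: bartlett_spectral_measure_def h_def)
    then have "(LINT k|\<sigma>K. fourier_fun f k * cnj (fourier_fun g k)) - (LINT k|\<sigma>L. fourier_fun f k * cnj (fourier_fun g k))
      = (2 * pi) ^ DIM('v) * (complex_of_real (local_signed_integral (covariance_measure P (transport K \<Phi>)) h)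
          - complex_of_real (local_signed_integral (covariance_measure P (transport L \<Phi>)) h))"
      by (simp add: right_diff_distrib)
    then show "(LINT k|\<sigma>K. fourier_fun f k * cnj (fourier_fun g k)) - (LINT k|\<sigma>L. fourier_fun f k * cnj (fourier_fun g k))
      = (2 * pi) ^ DIM('v) * complex_of_real ((LINT y|Dp. correlation f g y) - (LINT y|Dn. correlation f g y))"
      unfolding of_real_diff[symmetric] lK unfolding h_def .
  qed
  then show "complex_of_real (measure \<sigma>K B) = complex_of_real (measure \<sigma>L B) + (LINT k:B|lborel. fourier_signed \<eta> k)"
    by (simp add: signed[OF \<eta>])
qed

end

theorem theorem3p4:
  fixes P :: "'w measure"
    and \<theta> :: "'v::euclidean_space \<Rightarrow> 'w \<Rightarrow> 'w"
    and \<Phi> :: "'w \<Rightarrow> 'v measure"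
    and Q :: "'v \<Rightarrow> 'w measure"
    and K L :: "'w \<Rightarrow> 'v \<Rightarrow> 'v measure"
  assumes "stationary_setting P \<theta>"
    and "random_measure P \<Phi>"
    and "invariant_measure P \<theta> \<Phi>"
    and "locally_square_integrable P \<Phi>"
    and "0 < intensity P \<Phi>" and "intensity P \<Phi> < \<infinity>"
    and "two_point_palm P \<theta> \<Phi> Q"
    and "probability_kernel P K" and "invariant_kernel P \<theta> K"
    and "probability_kernel P L" and "invariant_kernel P \<theta> L"
    and "locally_square_integrable P (transport K \<Phi>) \<or> locally_square_integrable P (transport L \<Phi>)"
    and "(\<integral>\<^sup>+y. kappa Q K L y \<partial>reduced_second_moment P \<Phi>) < \<infinity>"
  shows "locally_square_integrable P (transport K \<Phi>)
    \<and> locally_square_integrable P (transport L \<Phi>)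
    \<and> (\<exists>\<eta>. extends_moment_difference P (transport K \<Phi>) (transport L \<Phi>) \<eta>)
    \<and> (\<forall>\<eta>. extends_moment_difference P (transport K \<Phi>) (transport L \<Phi>) \<eta> \<longrightarrow>
        (\<forall>\<sigma>K \<sigma>L. bartlett_spectral_measure P (transport K \<Phi>) \<sigma>K \<longrightarrow>
           bartlett_spectral_measure P (transport L \<Phi>) \<sigma>L \<longrightarrow>
           (\<forall>B\<in>sets borel. bounded B \<longrightarrow>
              complex_of_real (measure \<sigma>K B) =
                complex_of_real (measure \<sigma>L B) + (LINT k:B|lborel. fourier_signed \<eta> k)))
        \<and> (\<forall>k. let F = (\<lambda>y. LINT \<omega>|Q y.
                   fourier_measure (K \<omega> y) k * cnj (fourier_measure (K \<omega> 0) k)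
                   - fourier_measure (L \<omega> y) k * cnj (fourier_measure (L \<omega> 0) k))
             in integrable (reduced_second_moment P \<Phi>) F
              \<and> fourier_signed \<eta> k = (LINT y|reduced_second_moment P \<Phi>. F y))
        \<and> continuous_on UNIV (fourier_signed \<eta>)
        \<and> fourier_signed \<eta> 0 = 0)"
proof -
  interpret palm_comparison P \<theta> \<Phi> Q K L
    by (intro palm_comparison.intro palm_kernel.intro palm_setting.intro palm_setting_axioms.intro
        palm_kernel_axioms.intro palm_comparison_axioms.intro assms)
  note main = transport_comparison[OF assms(12)]
  show ?thesis
    using main unfolding palm_gap_fourier[abs_def] Let_def by blast
qed

end
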